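(* Suppose that $\phi\in L^2(\mathbb{R}\to\mathbb{C})$ is a stationary wave solution of $iu_t=\mathcal{T}_4(u,u,u)$; that is, $\phi$ satisfies $$\omega\phi(x)=\mathcal{T}_4(\phi,\phi,\phi)(x)$$ for some $\omega\in\mathbb{R}$. Then there exist $\alpha>0$ and $\beta>0$ such that $\phi e^{\alpha x^2}\in L^\infty$ and $\widehat{\phi}e^{\beta x^2}\in L^\infty$. As a result, $\phi$ can be extended to an entire function on the complex plane.
   Context: $H=-\Delta+x^2$ on $L^2(\mathbb{R})$, and $e^{itH}$ is the unitary propagator of $iu_t+Hu=0$ (so $e^{itH}\phi_n=e^{it(2n+1)}\phi_n$ for the Hermite functions $\phi_n$, $H\phi_n=(2n+1)\phi_n$). $$\mathcal{T}_4(u,u,u)=\frac{8}{\pi}\int_{-\pi/4}^{\pi/4}e^{-isH}\left(|e^{isH}u|^2e^{isH}u\right)ds.$$ The Fourier transform is $\widehat{\phi}(\xi)=(2\pi)^{-1/2}\int_{\mathbb{R}} e^{-ix\xi}\phi(x)\,dx$. *)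

theory Defs
  imports "HOL-Complex_Analysis.Complex_Analysis"
begin

text \<open>Elements of the Lebesgue spaces over \<open>\<real>\<close> are handled through Borel representatives;
  equality in these spaces is equality almost everywhere with respect to \<^term>\<open>lborel\<close>.\<close>

definition L2 :: "(real \<Rightarrow> complex) set" where
  "L2 = {f \<in> borel_measurable lborel. integrable lborel (\<lambda>x. (norm (f x))\<^sup>2)}"

definition Linf :: "(real \<Rightarrow> complex) set" where
  "Linf = {f \<in> borel_measurable lborel. \<exists>C. AE x in lborel. norm (f x) \<le> C}"

definition L2_inner :: "(real \<Rightarrow> complex) \<Rightarrow> (real \<Rightarrow> complex) \<Rightarrow> complex" where
  "L2_inner f g = (LINT x|lborel. f x * cnj (g x))"

definition L2_norm :: "(real \<Rightarrow> complex) \<Rightarrow> real" where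
  "L2_norm f = sqrt (LINT x|lborel. (norm (f x))\<^sup>2)"

definition harmonic_oscillator :: "(real \<Rightarrow> complex) \<Rightarrow> real \<Rightarrow> complex" where
  "harmonic_oscillator u x =
     - vector_derivative (\<lambda>y. vector_derivative u (at y)) (at x) + of_real (x\<^sup>2) * u x"

text \<open>The physicists' Hermite polynomials, \<open>H\<^sub>n(x) = (-1)\<^sup>n exp(x\<^sup>2) (d/dx)\<^sup>n exp(-x\<^sup>2)\<close>.\<close>

fun hermite_poly :: "nat \<Rightarrow> real poly" where
  "hermite_poly 0 = 1"
| "hermite_poly (Suc n) = [:0, 2:] * hermite_poly n - pderiv (hermite_poly n)"

text \<open>The \<open>L\<^sup>2\<close>-normalized Hermite functions, the orthonormal eigenbasis of
  \<^const>\<open>harmonic_oscillator\<close>.\<close>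

definition hermite_fun :: "nat \<Rightarrow> real \<Rightarrow> complex" where
  "hermite_fun n x =
     of_real (poly (hermite_poly n) x * exp (- x\<^sup>2 / 2) / sqrt (2 ^ n * fact n * sqrt pi))"

lemma hermite_poly_ode:
  "pderiv (pderiv (hermite_poly n)) =
     [:0, 2:] * pderiv (hermite_poly n) - smult (2 * real n) (hermite_poly n)"
proof (induction n)
  case 0
  show ?case by simp
next
  case (Suc n)
  have D: "pderiv (hermite_poly (Suc n)) = smult (2 * real (Suc n)) (hermite_poly n)"
    by (rule poly_ext) (simp add: Suc.IH pderiv_diff pderiv_smult pderiv_pCons algebra_simps)
  show ?case
    unfolding D by (rule poly_ext) (simp add: pderiv_smult algebra_simps)
qed

lemma harmonic_oscillator_hermite_fun:
  "harmonic_oscillator (hermite_fun n) x = of_nat (2 * n + 1) * hermite_fun n x"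
proof -
  define c where "c = sqrt (2 ^ n * fact n * sqrt pi)"
  define p where "p = hermite_poly n"
  have der: "((\<lambda>x. complex_of_real (poly q x * exp (- x\<^sup>2 / 2) / c)) has_vector_derivative
      complex_of_real (poly (pderiv q - [:0, 1:] * q) y * exp (- y\<^sup>2 / 2) / c)) (at y)" for q y
  proof -
    have "((\<lambda>x. poly q x * exp (- x\<^sup>2 / 2) / c) has_real_derivative
        (poly (pderiv q - [:0, 1:] * q) y * exp (- y\<^sup>2 / 2) / c)) (at y)"
      unfolding divide_inverse[of _ c]
      by (auto intro!: derivative_eq_intros simp: algebra_simps)
    then show ?thesis
      by (intro has_vector_derivative_of_real)
        (simp add: has_real_derivative_iff_has_vector_derivative)
  qed
  have hf: "hermite_fun n = (\<lambda>x. complex_of_real (poly p x * exp (- x\<^sup>2 / 2) / c))"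
    by (simp add: hermite_fun_def fun_eq_iff p_def c_def)
  let ?r = "pderiv p - [:0, 1:] * p"
  have d1: "vector_derivative (hermite_fun n) (at y) =
      complex_of_real (poly ?r y * exp (- y\<^sup>2 / 2) / c)" for y
    unfolding hf by (rule vector_derivative_at[OF der])
  have d2: "vector_derivative (\<lambda>y. vector_derivative (hermite_fun n) (at y)) (at x) =
      complex_of_real (poly (pderiv ?r - [:0, 1:] * ?r) x * exp (- x\<^sup>2 / 2) / c)"
    unfolding d1 by (rule vector_derivative_at[OF der])
  have ode: "poly (pderiv (pderiv p)) x = 2 * x * poly (pderiv p) x - 2 * real n * poly p x"
    unfolding p_def hermite_poly_ode by simp
  have "poly (pderiv ?r - [:0, 1:] * ?r) x = (x\<^sup>2 - (2 * real n + 1)) * poly p x"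
    by (simp add: pderiv_diff pderiv_pCons ode algebra_simps power2_eq_square)
  then have "harmonic_oscillator (hermite_fun n) x = complex_of_real
      (- ((x\<^sup>2 - (2 * real n + 1)) * poly p x * exp (- x\<^sup>2 / 2) / c)
       + x\<^sup>2 * (poly p x * exp (- x\<^sup>2 / 2) / c))"
    unfolding harmonic_oscillator_def d2 by (simp add: hf)
  also have "\<dots> = complex_of_real (real (2 * n + 1) * (poly p x * exp (- x\<^sup>2 / 2) / c))"
    by (rule arg_cong[of _ _ complex_of_real])
      (simp add: algebra_simps add_divide_distrib diff_divide_distrib)
  finally show ?thesis
    unfolding hf by simp
qed

text \<open>The propagator \<open>exp(itH)\<close> for \<open>H\<close> = \<^const>\<open>harmonic_oscillator\<close>, the solution map of
  \<open>i u\<^sub>t + H u = 0\<close> on \<open>L\<^sup>2\<close>, given by the spectral decomposition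
  \<open>exp(itH) f = \<Sum>n. exp(it(2n+1)) \<langle>f, h\<^sub>n\<rangle> h\<^sub>n\<close>, with \<open>h\<^sub>n\<close> = \<^term>\<open>hermite_fun n\<close> and
  convergence in \<open>L\<^sup>2\<close>. For \<open>f\<close> in \<^const>\<open>L2\<close> the choice picks a representative of the unique limit;
  the value for other \<open>f\<close> is immaterial.\<close>

definition propagator :: "real \<Rightarrow> (real \<Rightarrow> complex) \<Rightarrow> real \<Rightarrow> complex" where
  "propagator t f = (SOME g. g \<in> L2 \<and>
     (\<lambda>N. L2_norm (\<lambda>x. g x -
        (\<Sum>n<N. exp (\<i> * of_real t * of_nat (2 * n + 1)) * L2_inner f (hermite_fun n) * hermite_fun n x)))
     \<longlonglongrightarrow> 0)"

text \<open>The integral of an \<open>L\<^sup>2\<close>-valued function over \<open>A\<close>, characterized by testing against \<open>L\<^sup>2\<close>; it is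
  unique up to almost everywhere equality and agrees with the Bochner integral whenever the latter
  exists. The outer integral uses the complete measure \<^term>\<open>lebesgue\<close> because \<open>F s\<close> may be
  arbitrary for \<open>s\<close> in a null set.\<close>

definition has_L2_integral ::
    "(real \<Rightarrow> real \<Rightarrow> complex) \<Rightarrow> (real \<Rightarrow> complex) \<Rightarrow> real set \<Rightarrow> bool" where
  "has_L2_integral F w A \<longleftrightarrow> w \<in> L2 \<and> (AE s in lebesgue. s \<in> A \<longrightarrow> F s \<in> L2) \<and>
     (\<forall>g\<in>L2. set_integrable lebesgue A (\<lambda>s. L2_inner (F s) g) \<and>
        (LINT s:A|lebesgue. L2_inner (F s) g) = L2_inner w g)"

definition L2_integral :: "real set \<Rightarrow> (real \<Rightarrow> real \<Rightarrow> complex) \<Rightarrow> real \<Rightarrow> complex" where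
  "L2_integral A F = (SOME w. has_L2_integral F w A)"

text \<open>\<open>T4 u\<close> is \<open>\<T>\<^sub>4(u,u,u)\<close>. For \<open>u\<close> in \<^const>\<open>L2\<close> the Strichartz estimate places
  \<open>exp(isH) u\<close> in \<open>L\<^sup>6\<close> of \<open>(s, x)\<close>, so the cubic expression lies in \<^const>\<open>L2\<close> for almost every \<open>s\<close>
  and the integral exists.\<close>

definition T4 :: "(real \<Rightarrow> complex) \<Rightarrow> real \<Rightarrow> complex" where
  "T4 u x = of_real (8 / pi) *
     L2_integral {- pi / 4..pi / 4}
       (\<lambda>s. propagator (- s)
          (\<lambda>y. of_real ((norm (propagator s u y))\<^sup>2) * propagator s u y)) x"

text \<open>The integral converges absolutely only for integrable \<open>\<phi>\<close> (and is \<open>0\<close> by convention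
  otherwise), which holds as soon as \<open>\<phi>(x) exp(\<alpha> x\<^sup>2)\<close> is essentially bounded for some \<open>\<alpha> > 0\<close>.\<close>

definition fourier_transform :: "(real \<Rightarrow> complex) \<Rightarrow> real \<Rightarrow> complex" where
  "fourier_transform \<phi> \<xi> =
     of_real (1 / sqrt (2 * pi)) * (LINT x|lborel. exp (- \<i> * of_real (x * \<xi>)) * \<phi> x)"

end

theory Submission
  imports Defs "HOL-Probability.Probability"
begin

text \<open>Expand a stationary wave in Hermite functions, \<open>\<phi> = \<Sum>n. c\<^sub>n h\<^sub>n\<close>. Averaging in time leaves only
  the resonant interactions \<open>a + b = l + n\<close>, so the equation becomes a cubic system for the
  coefficients. Products \<open>h\<^sub>a h\<^sub>b\<close> with \<open>a + b\<close> fixed form an eigenspace of the two-dimensional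
  oscillator, which is rotation invariant; rotating turns restriction to the diagonal into restriction
  to an axis, and this yields the Strichartz estimate together with bilinear estimates that gain on
  interactions of high with low modes. Geometric weights \<open>\<theta>\<^sup>n\<close> pass through the resonance condition
  exactly, so the contraction determining the high modes also works in a weighted space, and the
  coefficients decay geometrically. Pointwise bounds for \<open>h\<^sub>n\<close> that lose at most a factor \<open>q\<^sup>n\<close>,
  with \<open>q > 1\<close> arbitrarily close to 1, then make the series converge to an entire function with Gaussian
  decay on the real axis, and the Fourier transform only multiplies \<open>c\<^sub>n\<close> by \<open>(-i)\<^sup>n\<close>. For \<open>\<omega> = 0\<close> pairing the equation with \<open>\<phi>\<close> gives \<open>\<phi> = 0\<close>.\<close>

section \<open>Rotations of two-dimensional Hermite expansions\<close>

text \<open>A stationary wave is only known to lie in L2, so a weighted norm of its coefficients may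
  be infinite and cannot be absorbed into itself. The weights are therefore tested on Picard
  iterates, which start from the low modes and have finite support, and the bound is carried to the
  limit. The high modes are small in ell2, the low modes are not. Terms with a low factor become
  small for another reason: only outputs n \<ge> K are kept, so a factor h_l with l bounded always
  meets a partner of high index, and the integral of h_l^2 h_n^2 tends to 0 as n grows. Interactions
  oscillate with frequency 2 (a + b - l - n), and the window [-pi/4, pi/4] is only half a period: it
  removes the even nonzero values of a + b - l - n, while the odd ones drop out because the product
  of the four Hermite functions is then odd. \<open>propagator\<close> chooses a representative
  separately at each time, so nothing is measurable in time until it is replaced by limits of
  partial sums along one subsequence common to all times.\<close>

definition lower1 :: "(nat \<Rightarrow> nat \<Rightarrow> complex) \<Rightarrow> nat \<Rightarrow> nat \<Rightarrow> complex" where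
  "lower1 \<alpha> a b = of_real (sqrt (Suc a)) * \<alpha> (Suc a) b"

definition lower2 :: "(nat \<Rightarrow> nat \<Rightarrow> complex) \<Rightarrow> nat \<Rightarrow> nat \<Rightarrow> complex" where
  "lower2 \<alpha> a b = of_real (sqrt (Suc b)) * \<alpha> a (Suc b)"

text \<open>The arrays hold the coefficients of sums of h_a(x) h_b(y). In these coordinates
  \<open>lower1\<close>, \<open>lower2\<close> are the annihilation operators and
  \<open>raise1\<close>, \<open>raise2\<close> the creation operators; at index 0 the factor
  \<open>sqrt 0\<close> removes the spurious value at \<open>a - 1\<close>.\<close>

definition raise1 :: "(nat \<Rightarrow> nat \<Rightarrow> complex) \<Rightarrow> nat \<Rightarrow> nat \<Rightarrow> complex" where
  "raise1 \<alpha> a b = of_real (sqrt a) * \<alpha> (a - 1) b"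

definition raise2 :: "(nat \<Rightarrow> nat \<Rightarrow> complex) \<Rightarrow> nat \<Rightarrow> nat \<Rightarrow> complex" where
  "raise2 \<alpha> a b = of_real (sqrt b) * \<alpha> a (b - 1)"

text \<open>Change of variables X = c x + s y, Y = s x - c y on the homogeneous part of degree N,
  without closed formulas for its matrix. The recursion is Euler's identity: the degree times the
  array is creation after annihilation, summed over both variables, and the creation operators of x
  and y are the combinations (c, s) and (s, -c) of those of X and Y.\<close>

fun rot :: "real \<Rightarrow> real \<Rightarrow> nat \<Rightarrow> (nat \<Rightarrow> nat \<Rightarrow> complex) \<Rightarrow> nat \<Rightarrow> nat \<Rightarrow> complex" where
  "rot c s 0 \<alpha> = \<alpha>"
| "rot c s (Suc N) \<alpha> = (\<lambda>a b.
     (of_real c * raise1 (rot c s N (lower1 \<alpha>)) a b + of_real s * raise2 (rot c s N (lower1 \<alpha>)) a b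
      + of_real s * raise1 (rot c s N (lower2 \<alpha>)) a b - of_real c * raise2 (rot c s N (lower2 \<alpha>)) a b)
     / of_nat (Suc N))"

declare rot.simps(2) [simp del]

lemma lower_linear:
  "lower1 (\<lambda>a b. u * \<alpha> a b + v * \<beta> a b) = (\<lambda>a b. u * lower1 \<alpha> a b + v * lower1 \<beta> a b)"
  "lower2 (\<lambda>a b. u * \<alpha> a b + v * \<beta> a b) = (\<lambda>a b. u * lower2 \<alpha> a b + v * lower2 \<beta> a b)"
  by (auto simp: lower1_def lower2_def fun_eq_iff algebra_simps)

lemma rot_linear:
  "rot c s N (\<lambda>a b. u * \<alpha> a b + v * \<beta> a b) = (\<lambda>a b. u * rot c s N \<alpha> a b + v * rot c s N \<beta> a b)"
proof (induction N arbitrary: \<alpha> \<beta>)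
  case (Suc N)
  show ?case
    by (simp only: rot.simps lower_linear Suc.IH)
      (simp add: fun_eq_iff raise1_def raise2_def algebra_simps add_divide_distrib diff_divide_distrib)
qed simp

lemma lower_commute: "lower1 (lower2 \<alpha>) = lower2 (lower1 \<alpha>)"
  by (simp add: lower1_def lower2_def fun_eq_iff)

lemma of_real_sqrt_mult_self:
  "0 \<le> x \<Longrightarrow> complex_of_real (sqrt x) * (of_real (sqrt x) * z) = of_real x * z"
  by (metis mult.assoc of_real_mult real_sqrt_mult_self abs_of_nonneg)

text \<open>The canonical commutation relations.\<close>

lemma lower_raise:
  "lower1 (raise1 \<alpha>) a b = raise1 (lower1 \<alpha>) a b + \<alpha> a b"
  "lower2 (raise2 \<alpha>) a b = raise2 (lower2 \<alpha>) a b + \<alpha> a b"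
  "lower1 (raise2 \<alpha>) a b = raise2 (lower1 \<alpha>) a b"
  "lower2 (raise1 \<alpha>) a b = raise1 (lower2 \<alpha>) a b"
proof -
  have succ: "of_nat (Suc n) * z = of_nat n * z + z" for n and z :: complex
    by (simp add: algebra_simps)
  show "lower1 (raise1 \<alpha>) a b = raise1 (lower1 \<alpha>) a b + \<alpha> a b"
    by (cases a) (simp_all add: lower1_def raise1_def of_real_sqrt_mult_self succ del: of_nat_Suc)
  show "lower2 (raise2 \<alpha>) a b = raise2 (lower2 \<alpha>) a b + \<alpha> a b"
    by (cases b) (simp_all add: lower2_def raise2_def of_real_sqrt_mult_self succ del: of_nat_Suc)
qed (simp_all add: lower1_def lower2_def raise1_def raise2_def)

lemma rot_Suc_combined:
  assumes "r1 = rot c s N (lower1 \<alpha>)" "r2 = rot c s N (lower2 \<alpha>)"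
  shows "of_nat (Suc N) * rot c s (Suc N) \<alpha> a b =
    of_real c * raise1 r1 a b + of_real s * raise2 r1 a b
      + of_real s * raise1 r2 a b - of_real c * raise2 r2 a b"
  unfolding rot.simps assms by (simp del: of_nat_Suc)

text \<open>Annihilation operators transform with the same matrix as the variables. Only entries
  with a + b = N are compared, since \<open>rot c s (Suc N)\<close> describes the homogeneous part
  of degree N + 1 alone.\<close>

lemma lower_rot_aux:
  "a + b = N \<Longrightarrow> lower1 (rot c s (Suc N) \<alpha>) a b =
      rot c s N (\<lambda>a b. of_real c * lower1 \<alpha> a b + of_real s * lower2 \<alpha> a b) a b
    \<and> lower2 (rot c s (Suc N) \<alpha>) a b =
      rot c s N (\<lambda>a b. of_real s * lower1 \<alpha> a b + of_real (- c) * lower2 \<alpha> a b) a b"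
proof (induction N arbitrary: \<alpha> a b)
  case 0
  then show ?case
    by (simp add: rot.simps(2) lower1_def lower2_def raise1_def raise2_def)
next
  case (Suc N)
  define \<beta>1 where "\<beta>1 = (\<lambda>a b. of_real c * lower1 \<alpha> a b + of_real s * lower2 \<alpha> a b)"
  define \<beta>2 where "\<beta>2 = (\<lambda>a b. of_real s * lower1 \<alpha> a b + of_real (- c) * lower2 \<alpha> a b)"
  define r1 r2 where "r1 = rot c s (Suc N) (lower1 \<alpha>)" and "r2 = rot c s (Suc N) (lower2 \<alpha>)"
  have rr: "rot c s (Suc N) \<beta>1 = (\<lambda>a b. of_real c * r1 a b + of_real s * r2 a b)"
    "rot c s (Suc N) \<beta>2 = (\<lambda>a b. of_real s * r1 a b + of_real (- c) * r2 a b)"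
    unfolding \<beta>1_def \<beta>2_def rot_linear r1_def r2_def by auto
  have IH: "lower1 r1 a b = rot c s N (lower1 \<beta>1) a b" "lower1 r2 a b = rot c s N (lower2 \<beta>1) a b"
    "lower2 r1 a b = rot c s N (lower1 \<beta>2) a b" "lower2 r2 a b = rot c s N (lower2 \<beta>2) a b"
    if "a + b = N" for a b
    unfolding r1_def r2_def \<beta>1_def \<beta>2_def
    using Suc.IH[OF that, of "lower1 \<alpha>"] Suc.IH[OF that, of "lower2 \<alpha>"]
    by (simp_all only: lower_linear lower_commute)
  have raise_cong: "raise1 f a b = raise1 g a b \<and> raise2 f a b = raise2 g a b"
    if "a + b = Suc N" "\<And>a b. a + b = N \<Longrightarrow> f a b = g a b" for f g a b
    using that by (cases a; cases b) (auto simp: raise1_def raise2_def)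
  have full: "of_nat (Suc (Suc N)) * rot c s (Suc (Suc N)) \<alpha> a b =
    of_real c * raise1 r1 a b + of_real s * raise2 r1 a b
      + of_real s * raise1 r2 a b - of_real c * raise2 r2 a b" for a b
    by (rule rot_Suc_combined) (auto simp: r1_def r2_def)
  have mult: "of_nat (Suc (Suc N)) * lower1 (rot c s (Suc (Suc N)) \<alpha>) a b =
     of_real (sqrt (Suc a)) * (of_nat (Suc (Suc N)) * rot c s (Suc (Suc N)) \<alpha> (Suc a) b)"
    "of_nat (Suc (Suc N)) * lower2 (rot c s (Suc (Suc N)) \<alpha>) a b =
     of_real (sqrt (Suc b)) * (of_nat (Suc (Suc N)) * rot c s (Suc (Suc N)) \<alpha> a (Suc b))" for a b
    by (simp_all only: lower1_def lower2_def mult_ac)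
  have nz: "of_nat (Suc (Suc N)) \<noteq> (0::complex)" by (simp del: of_nat_Suc)
  have "lower1 (rot c s (Suc (Suc N)) \<alpha>) a b = rot c s (Suc N) \<beta>1 a b"
  proof -
    have eqs: "raise1 (lower1 r1) a b = raise1 (rot c s N (lower1 \<beta>1)) a b"
      "raise2 (lower1 r1) a b = raise2 (rot c s N (lower1 \<beta>1)) a b"
      "raise1 (lower1 r2) a b = raise1 (rot c s N (lower2 \<beta>1)) a b"
      "raise2 (lower1 r2) a b = raise2 (rot c s N (lower2 \<beta>1)) a b"
      using raise_cong[OF Suc.prems IH(1)] raise_cong[OF Suc.prems IH(2)] by simp_all
    have "of_nat (Suc (Suc N)) * lower1 (rot c s (Suc (Suc N)) \<alpha>) a b =
      of_real c * lower1 (raise1 r1) a b + of_real s * lower1 (raise2 r1) a b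
      + of_real s * lower1 (raise1 r2) a b - of_real c * lower1 (raise2 r2) a b"
      by (rule trans[OF mult(1)], subst full) (simp add: lower1_def algebra_simps del: of_nat_Suc)
    \<comment> \<open>The commutators in \<open>lower_raise\<close> contribute exactly one more copy
      of the rotated array, which raises the factor from N + 1 to N + 2.\<close>
    also have "\<dots> = of_nat (Suc N) * rot c s (Suc N) \<beta>1 a b + rot c s (Suc N) \<beta>1 a b"
      unfolding lower_raise eqs rot_Suc_combined[OF refl refl]
      by (simp add: rr algebra_simps)
    also have "\<dots> = of_nat (Suc (Suc N)) * rot c s (Suc N) \<beta>1 a b"
      by (simp add: algebra_simps)
    finally show ?thesis using nz by (metis mult_left_cancel)
  qed
  moreover have "lower2 (rot c s (Suc (Suc N)) \<alpha>) a b = rot c s (Suc N) \<beta>2 a b"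
  proof -
    have eqs: "raise1 (lower2 r1) a b = raise1 (rot c s N (lower1 \<beta>2)) a b"
      "raise2 (lower2 r1) a b = raise2 (rot c s N (lower1 \<beta>2)) a b"
      "raise1 (lower2 r2) a b = raise1 (rot c s N (lower2 \<beta>2)) a b"
      "raise2 (lower2 r2) a b = raise2 (rot c s N (lower2 \<beta>2)) a b"
      using raise_cong[OF Suc.prems IH(3)] raise_cong[OF Suc.prems IH(4)] by simp_all
    have "of_nat (Suc (Suc N)) * lower2 (rot c s (Suc (Suc N)) \<alpha>) a b =
      of_real c * lower2 (raise1 r1) a b + of_real s * lower2 (raise2 r1) a b
      + of_real s * lower2 (raise1 r2) a b - of_real c * lower2 (raise2 r2) a b"
      by (rule trans[OF mult(2)], subst full) (simp add: lower2_def algebra_simps del: of_nat_Suc)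
    also have "\<dots> = of_nat (Suc N) * rot c s (Suc N) \<beta>2 a b + rot c s (Suc N) \<beta>2 a b"
      unfolding lower_raise eqs rot_Suc_combined[OF refl refl]
      by (simp add: rr algebra_simps)
    also have "\<dots> = of_nat (Suc (Suc N)) * rot c s (Suc N) \<beta>2 a b"
      by (simp add: algebra_simps)
    finally show ?thesis using nz by (metis mult_left_cancel)
  qed
  ultimately show ?case by (simp only: \<beta>1_def \<beta>2_def)
qed

lemma lower_rot:
  assumes "a + b = N"
  shows "lower1 (rot c s (Suc N) \<alpha>) a b =
      rot c s N (\<lambda>a b. of_real c * lower1 \<alpha> a b + of_real s * lower2 \<alpha> a b) a b"
    and "lower2 (rot c s (Suc N) \<alpha>) a b =
      rot c s N (\<lambda>a b. of_real s * lower1 \<alpha> a b + of_real (- c) * lower2 \<alpha> a b) a b"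
  using lower_rot_aux[OF assms] by blast+

definition degree_energy :: "nat \<Rightarrow> (nat \<Rightarrow> nat \<Rightarrow> complex) \<Rightarrow> real" where
  "degree_energy N \<alpha> = (\<Sum>a\<le>N. (norm (\<alpha> a (N - a)))\<^sup>2)"

text \<open>Expectation of the number operator: the weight a + b = N + 1 splits into the two weights
  that annihilation produces. It reduces unitarity of \<open>rot\<close> to the previous
  degree.\<close>

lemma degree_energy_Suc:
  "real (Suc N) * degree_energy (Suc N) \<alpha> = degree_energy N (lower1 \<alpha>) + degree_energy N (lower2 \<alpha>)"
proof -
  have "real (Suc N) * degree_energy (Suc N) \<alpha> =
      (\<Sum>a\<le>Suc N. real a * (norm (\<alpha> a (Suc N - a)))\<^sup>2) +
      (\<Sum>a\<le>Suc N. real (Suc N - a) * (norm (\<alpha> a (Suc N - a)))\<^sup>2)"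
    unfolding degree_energy_def sum_distrib_left sum.distrib[symmetric]
    by (intro sum.cong refl) (simp add: of_nat_diff flip: distrib_right)
  also have "(\<Sum>a\<le>Suc N. real a * (norm (\<alpha> a (Suc N - a)))\<^sup>2) = degree_energy N (lower1 \<alpha>)"
    unfolding degree_energy_def sum.atMost_Suc_shift
    by (simp add: lower1_def norm_mult power_mult_distrib)
  also have "(\<Sum>a\<le>Suc N. real (Suc N - a) * (norm (\<alpha> a (Suc N - a)))\<^sup>2) = degree_energy N (lower2 \<alpha>)"
    unfolding degree_energy_def
    by (simp add: lower2_def norm_mult power_mult_distrib Suc_diff_le algebra_simps)
  finally show ?thesis .
qed

lemma degree_energy_rotate:
  assumes "c\<^sup>2 + s\<^sup>2 = 1"
  shows "degree_energy N (\<lambda>a b. of_real c * \<alpha> a b + of_real s * \<beta> a b)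
    + degree_energy N (\<lambda>a b. of_real s * \<alpha> a b + of_real (- c) * \<beta> a b)
    = degree_energy N \<alpha> + degree_energy N \<beta>"
proof -
  have "(norm (of_real c * z + of_real s * w))\<^sup>2 + (norm (of_real s * z + of_real (- c) * w))\<^sup>2
      = (norm z)\<^sup>2 + (norm w)\<^sup>2" for z w :: complex
  proof -
    have "(norm (of_real c * z + of_real s * w))\<^sup>2 + (norm (of_real s * z + of_real (- c) * w))\<^sup>2
        = (c\<^sup>2 + s\<^sup>2) * ((norm z)\<^sup>2 + (norm w)\<^sup>2)"
      unfolding cmod_power2 by (simp add: power2_eq_square algebra_simps)
    then show ?thesis using assms by simp
  qed
  then show ?thesis
    unfolding degree_energy_def by (simp flip: sum.distrib)
qed

lemma degree_energy_rot:
  assumes "c\<^sup>2 + s\<^sup>2 = 1"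
  shows "degree_energy N (rot c s N \<alpha>) = degree_energy N \<alpha>"
proof (induction N arbitrary: \<alpha>)
  case (Suc N)
  let ?\<beta>1 = "\<lambda>a b. of_real c * lower1 \<alpha> a b + of_real s * lower2 \<alpha> a b"
  let ?\<beta>2 = "\<lambda>a b. of_real s * lower1 \<alpha> a b + of_real (- c) * lower2 \<alpha> a b"
  have 1: "degree_energy N (lower1 (rot c s (Suc N) \<alpha>)) = degree_energy N (rot c s N ?\<beta>1)"
    unfolding degree_energy_def
    by (intro sum.cong refl) (subst lower_rot(1), simp_all)
  have 2: "degree_energy N (lower2 (rot c s (Suc N) \<alpha>)) = degree_energy N (rot c s N ?\<beta>2)"
    unfolding degree_energy_def
    by (intro sum.cong refl) (subst lower_rot(2), simp_all)
  have "real (Suc N) * degree_energy (Suc N) (rot c s (Suc N) \<alpha>) =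
      real (Suc N) * degree_energy (Suc N) \<alpha>"
    unfolding degree_energy_Suc 1 2 Suc.IH degree_energy_rotate[OF assms] ..
  then show ?case by (simp del: of_nat_Suc)
qed simp

section \<open>Evaluation of two-variable expansions at a point, and rotation covariance\<close>

definition expand :: "nat \<Rightarrow> (nat \<Rightarrow> nat \<Rightarrow> complex) \<Rightarrow> (nat \<Rightarrow> complex) \<Rightarrow> (nat \<Rightarrow> complex) \<Rightarrow> complex" where
  "expand N \<alpha> f g = (\<Sum>a\<le>N. \<alpha> a (N - a) * f a * g (N - a))"

text \<open>At n = 0 the factor \<open>sqrt n\<close> removes \<open>f (n - 1)\<close>, so the
  recurrence fixes f up to its entry at index 0. Hence \<open>expand_rot\<close> needs, besides the
  recurrences, only one condition on the entries of index 0.\<close>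

definition hermite_rec :: "complex \<Rightarrow> (nat \<Rightarrow> complex) \<Rightarrow> bool" where
  "hermite_rec x f \<longleftrightarrow> (\<forall>n. of_real (sqrt (Suc n)) * f (Suc n) =
     of_real (sqrt 2) * x * f n - of_real (sqrt n) * f (n - 1))"

text \<open>Creation plus annihilation is multiplication by sqrt 2 times the variable: the
  recurrence is moved from the functions to the coefficients.\<close>

lemma expand_raise1:
  assumes "hermite_rec x f"
  shows "expand (Suc N) (raise1 \<alpha>) f g =
    of_real (sqrt 2) * x * expand N \<alpha> f g - (if N = 0 then 0 else expand (N - 1) (lower1 \<alpha>) f g)"
proof -
  have "expand (Suc N) (raise1 \<alpha>) f g =
      (\<Sum>a\<le>N. \<alpha> a (N - a) * (of_real (sqrt (Suc a)) * f (Suc a)) * g (N - a))"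
    unfolding expand_def sum.atMost_Suc_shift by (simp add: raise1_def mult_ac)
  also have "\<dots> = (\<Sum>a\<le>N. \<alpha> a (N - a) * (of_real (sqrt 2) * x * f a) * g (N - a))
       - (\<Sum>a\<le>N. \<alpha> a (N - a) * (of_real (sqrt a) * f (a - 1)) * g (N - a))"
  proof -
    have rec: "of_real (sqrt (Suc n)) * f (Suc n) =
        of_real (sqrt 2) * x * f n - of_real (sqrt n) * f (n - 1)" for n
      using assms unfolding hermite_rec_def by blast
    show ?thesis
      unfolding rec right_diff_distrib left_diff_distrib sum_subtractf ..
  qed
  also have "(\<Sum>a\<le>N. \<alpha> a (N - a) * (of_real (sqrt a) * f (a - 1)) * g (N - a)) =
     (if N = 0 then 0 else expand (N - 1) (lower1 \<alpha>) f g)"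
    by (cases N) (simp_all add: sum.atMost_Suc_shift expand_def lower1_def mult_ac del: sum.atMost_Suc)
  finally show ?thesis
    by (simp add: expand_def sum_distrib_left mult_ac)
qed

lemma expand_swap: "expand N (\<lambda>a b. \<alpha> b a) g f = expand N \<alpha> f g"
  unfolding expand_def
  by (rule sum.reindex_bij_witness[where i = "\<lambda>a. N - a" and j = "\<lambda>a. N - a"])
    (auto simp: mult_ac)

lemma expand_raise2:
  assumes "hermite_rec y g"
  shows "expand (Suc N) (raise2 \<alpha>) f g =
    of_real (sqrt 2) * y * expand N \<alpha> f g - (if N = 0 then 0 else expand (N - 1) (lower2 \<alpha>) f g)"
proof -
  have "raise1 (\<lambda>a b. \<alpha> b a) = (\<lambda>a b. raise2 \<alpha> b a)" "lower1 (\<lambda>a b. \<alpha> b a) = (\<lambda>a b. lower2 \<alpha> b a)"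
    by (simp_all add: raise1_def raise2_def lower1_def lower2_def fun_eq_iff)
  then show ?thesis
    using expand_raise1[OF assms, of N "\<lambda>a b. \<alpha> b a" f]
    unfolding expand_swap[of _ \<alpha>] by (simp only: expand_swap[of _ "raise2 \<alpha>"] expand_swap[of _ "lower2 \<alpha>"])
qed

lemma expand_linear:
  "expand N (\<lambda>a b. u * \<alpha> a b + v * \<beta> a b) f g = u * expand N \<alpha> f g + v * expand N \<beta> f g"
  unfolding expand_def sum_distrib_left sum.distrib[symmetric]
  by (intro sum.cong refl) (simp add: algebra_simps)

lemma number_operator: "raise1 (lower1 \<alpha>) a b + raise2 (lower2 \<alpha>) a b = of_nat (a + b) * \<alpha> a b"
proof -
  have "raise1 (lower1 \<alpha>) a b = of_nat a * \<alpha> a b"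
    by (cases a) (simp_all add: raise1_def lower1_def of_real_sqrt_mult_self del: of_nat_Suc)
  moreover have "raise2 (lower2 \<alpha>) a b = of_nat b * \<alpha> a b"
    by (cases b) (simp_all add: raise2_def lower2_def of_real_sqrt_mult_self del: of_nat_Suc)
  ultimately show ?thesis by (simp add: algebra_simps)
qed

text \<open>Rotation covariance of the eigenspaces of the two-dimensional oscillator. Only the
  three-term recurrence enters, so no integration over the plane is needed.\<close>

lemma expand_rot:
  assumes cs: "c\<^sup>2 + s\<^sup>2 = 1"
    and f: "hermite_rec x f" and g: "hermite_rec y g"
    and F: "hermite_rec (of_real c * x + of_real s * y) F"
    and G: "hermite_rec (of_real s * x - of_real c * y) G"
    and base: "F 0 * G 0 = f 0 * g 0"
  shows "expand N (rot c s N \<alpha>) F G = expand N \<alpha> f g"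
proof (induction N arbitrary: \<alpha> rule: less_induct)
  case (less N)
  show ?case
  proof (cases N)
    case 0
    then show ?thesis using base by (simp add: expand_def mult.assoc)
  next
    case (Suc M)
    define r1 r2 where "r1 = rot c s M (lower1 \<alpha>)" and "r2 = rot c s M (lower2 \<alpha>)"
    have cs': "of_real c * of_real c + of_real s * of_real s = (1::complex)"
      using cs by (simp add: power2_eq_square flip: of_real_mult of_real_add)
    define l where "l = (\<lambda>\<beta>. if M = 0 then 0 else expand (M - 1) \<beta> F G)"
    \<comment> \<open>The matrix with rows (c, s) and (s, -c) is its own inverse, so lowering a
      rotated array and recombining with this matrix returns the lowered unrotated array, evaluated
      in the old variables.\<close>
    have low: "of_real c * l (lower1 r) + of_real s * l (lower2 r) =
        (if M = 0 then 0 else expand (M - 1) (lower1 \<beta>) f g)"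
      "of_real s * l (lower1 r) - of_real c * l (lower2 r) =
        (if M = 0 then 0 else expand (M - 1) (lower2 \<beta>) f g)"
      if r: "r = rot c s M \<beta>" for r \<beta>
    proof -
      have "of_real c * l (lower1 r) + of_real s * l (lower2 r) =
          (if M = 0 then 0 else expand (M - 1) (lower1 \<beta>) f g) \<and>
          of_real s * l (lower1 r) - of_real c * l (lower2 r) =
          (if M = 0 then 0 else expand (M - 1) (lower2 \<beta>) f g)"
      proof (cases M)
        case (Suc K)
        have 1: "expand K (lower1 r) F G = expand K (rot c s K
            (\<lambda>a b. of_real c * lower1 \<beta> a b + of_real s * lower2 \<beta> a b)) F G"
          unfolding expand_def r Suc
          by (intro sum.cong refl) (subst lower_rot(1), simp_all)
        have 2: "expand K (lower2 r) F G = expand K (rot c s K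
            (\<lambda>a b. of_real s * lower1 \<beta> a b + of_real (- c) * lower2 \<beta> a b)) F G"
          unfolding expand_def r Suc
          by (intro sum.cong refl) (subst lower_rot(2), simp_all)
        have "K < N" using \<open>N = Suc M\<close> Suc by simp
        then have 1: "expand K (lower1 r) F G =
            of_real c * expand K (lower1 \<beta>) f g + of_real s * expand K (lower2 \<beta>) f g"
          and 2: "expand K (lower2 r) F G =
            of_real s * expand K (lower1 \<beta>) f g + of_real (- c) * expand K (lower2 \<beta>) f g"
          unfolding 1 2 by (simp_all only: less.IH expand_linear)
        have ca: "of_real c * (of_real c * u + of_real s * v) + of_real s * (of_real s * u + of_real (- c) * v) = u"
          "of_real s * (of_real c * u + of_real s * v) - of_real c * (of_real s * u + of_real (- c) * v) = v"
          for u v :: complex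
        proof -
          have "of_real c * (of_real c * u + of_real s * v) + of_real s * (of_real s * u + of_real (- c) * v)
            = (of_real c * of_real c + of_real s * of_real s) * u"
            by (simp add: algebra_simps)
          then show "of_real c * (of_real c * u + of_real s * v) + of_real s * (of_real s * u + of_real (- c) * v) = u"
            using cs' by simp
          have "of_real s * (of_real c * u + of_real s * v) - of_real c * (of_real s * u + of_real (- c) * v)
            = (of_real c * of_real c + of_real s * of_real s) * v"
            by (simp add: algebra_simps)
          then show "of_real s * (of_real c * u + of_real s * v) - of_real c * (of_real s * u + of_real (- c) * v) = v"
            using cs' by simp
        qed
        show ?thesis
          using Suc by (simp only: l_def Suc nat.distinct if_False diff_Suc_1 1 2 ca)
      qed (simp add: l_def)
      then show "of_real c * l (lower1 r) + of_real s * l (lower2 r) =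
          (if M = 0 then 0 else expand (M - 1) (lower1 \<beta>) f g)"
        "of_real s * l (lower1 r) - of_real c * l (lower2 r) =
          (if M = 0 then 0 else expand (M - 1) (lower2 \<beta>) f g)" by blast+
    qed
    have x: "of_real c * (of_real c * x + of_real s * y) + of_real s * (of_real s * x - of_real c * y) = x"
      "of_real s * (of_real c * x + of_real s * y) - of_real c * (of_real s * x - of_real c * y) = y"
    proof -
      have "of_real c * (of_real c * x + of_real s * y) + of_real s * (of_real s * x - of_real c * y)
         = (of_real c * of_real c + of_real s * of_real s) * x" by (simp add: algebra_simps)
      then show "of_real c * (of_real c * x + of_real s * y) + of_real s * (of_real s * x - of_real c * y) = x"
        using cs' by simp
      have "of_real s * (of_real c * x + of_real s * y) - of_real c * (of_real s * x - of_real c * y)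
         = (of_real c * of_real c + of_real s * of_real s) * y" by (simp add: algebra_simps)
      then show "of_real s * (of_real c * x + of_real s * y) - of_real c * (of_real s * x - of_real c * y) = y"
        using cs' by simp
    qed
    have E: "expand M r1 F G = expand M (lower1 \<alpha>) f g" "expand M r2 F G = expand M (lower2 \<alpha>) f g"
      unfolding r1_def r2_def using less.IH[of M] Suc by auto
    have raiseF: "expand (Suc M) (raise1 r) F G =
        of_real (sqrt 2) * (of_real c * x + of_real s * y) * expand M r F G - l (lower1 r)"
      and raiseG: "expand (Suc M) (raise2 r) F G =
        of_real (sqrt 2) * (of_real s * x - of_real c * y) * expand M r F G - l (lower2 r)" for r
      unfolding expand_raise1[OF F] expand_raise2[OF G] l_def by (rule refl)+
    let ?X = "of_real c * x + of_real s * y" and ?Y = "of_real s * x - of_real c * y"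
    have R: "of_real c * expand (Suc M) (raise1 r1) F G + of_real s * expand (Suc M) (raise2 r1) F G
        = expand (Suc M) (raise1 (lower1 \<alpha>)) f g"
    proof -
      have "of_real c * expand (Suc M) (raise1 r1) F G + of_real s * expand (Suc M) (raise2 r1) F G
        = of_real (sqrt 2) * (of_real c * ?X + of_real s * ?Y) * expand M r1 F G
          - (of_real c * l (lower1 r1) + of_real s * l (lower2 r1))"
        unfolding raiseF raiseG by (simp add: algebra_simps)
      also have "\<dots> = expand (Suc M) (raise1 (lower1 \<alpha>)) f g"
        by (simp only: x low[OF r1_def] E expand_raise1[OF f])
      finally show ?thesis .
    qed
    have R2: "of_real s * expand (Suc M) (raise1 r2) F G - of_real c * expand (Suc M) (raise2 r2) F G
        = expand (Suc M) (raise2 (lower2 \<alpha>)) f g"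
    proof -
      have "of_real s * expand (Suc M) (raise1 r2) F G - of_real c * expand (Suc M) (raise2 r2) F G
        = of_real (sqrt 2) * (of_real s * ?X - of_real c * ?Y) * expand M r2 F G
          - (of_real s * l (lower1 r2) - of_real c * l (lower2 r2))"
        unfolding raiseF raiseG by (simp add: algebra_simps)
      also have "\<dots> = expand (Suc M) (raise2 (lower2 \<alpha>)) f g"
        by (simp only: x low[OF r2_def] E expand_raise2[OF g])
      finally show ?thesis .
    qed
    \<comment> \<open>Multiplying by the degree exposes the Euler identity inside
      \<open>rot\<close>; once the recurrences have been applied, \<open>number_operator\<close>
      collapses it again.\<close>
    have "of_nat (Suc M) * expand (Suc M) (rot c s (Suc M) \<alpha>) F G =
       expand (Suc M) (\<lambda>a b. of_nat (Suc M) * rot c s (Suc M) \<alpha> a b) F G"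
      by (simp only: expand_def sum_distrib_left mult_ac)
    also have "\<dots> = of_real c * expand (Suc M) (raise1 r1) F G + of_real s * expand (Suc M) (raise2 r1) F G
        + (of_real s * expand (Suc M) (raise1 r2) F G - of_real c * expand (Suc M) (raise2 r2) F G)"
      unfolding rot_Suc_combined[OF r1_def r2_def]
      by (simp only: expand_def sum_distrib_left flip: sum.distrib sum_subtractf)
        (simp add: algebra_simps)
    also have "\<dots> = expand (Suc M) (\<lambda>a b. raise1 (lower1 \<alpha>) a b + raise2 (lower2 \<alpha>) a b) f g"
      unfolding R R2 by (simp only: expand_def ring_distribs sum.distrib)
    also have "\<dots> = of_nat (Suc M) * expand (Suc M) \<alpha> f g"
      unfolding number_operator expand_def sum_distrib_left by (intro sum.cong) auto
    finally have "expand (Suc M) (rot c s (Suc M) \<alpha>) F G = expand (Suc M) \<alpha> f g"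
      by (subst (asm) mult_cancel_left) (simp del: of_nat_Suc)
    then show ?thesis by (simp only: Suc)
  qed
qed

section \<open>Hermite functions\<close>

definition hh :: "nat \<Rightarrow> real \<Rightarrow> real" where
  "hh n x = poly (hermite_poly n) x * exp (- x\<^sup>2 / 2) / sqrt (2 ^ n * fact n * sqrt pi)"

lemma hermite_fun_hh: "hermite_fun n x = of_real (hh n x)"
  by (simp add: hermite_fun_def hh_def)

lemma pderiv_hermite_poly_Suc:
  "pderiv (hermite_poly (Suc n)) = smult (2 * real (Suc n)) (hermite_poly n)"
  by (rule poly_ext)
    (simp add: hermite_poly_ode pderiv_diff pderiv_smult pderiv_pCons algebra_simps)

lemma hh_0: "hh 0 x = exp (- x\<^sup>2 / 2) / sqrt (sqrt pi)"
  by (simp add: hh_def)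

lemma hermite_norm_Suc:
  "sqrt (2 ^ Suc n * fact (Suc n) * sqrt pi) = sqrt 2 * sqrt (Suc n) * sqrt (2 ^ n * fact n * sqrt pi)"
  by (simp add: algebra_simps flip: real_sqrt_mult)

lemma hh_rec:
  "sqrt (Suc n) * hh (Suc n) x = sqrt 2 * x * hh n x - sqrt n * hh (n - 1) x"
proof -
  define e where "e = exp (- x\<^sup>2 / 2)"
  define k where "k = (\<lambda>n. sqrt (2 ^ n * fact n * sqrt pi) :: real)"
  have k: "k (Suc m) = sqrt 2 * sqrt (Suc m) * k m" "k m > 0" for m
    unfolding k_def by (rule hermite_norm_Suc) simp
  have hh: "hh m x = poly (hermite_poly m) x * e / k m" for m
    by (simp add: hh_def e_def k_def)
  have 2: "2 / sqrt 2 = sqrt (2::real)" by (rule real_div_sqrt) simp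
  have "sqrt (Suc n) * hh (Suc n) x = poly (hermite_poly (Suc n)) x * e / (sqrt 2 * k n)"
    unfolding hh k by (simp add: field_simps del: of_nat_Suc hermite_poly.simps)
  also have "\<dots> = (2 / sqrt 2) * x * hh n x - poly (pderiv (hermite_poly n)) x * e / (sqrt 2 * k n)"
    unfolding hh by (simp add: left_diff_distrib diff_divide_distrib)
  also have "poly (pderiv (hermite_poly n)) x * e / (sqrt 2 * k n) = sqrt n * hh (n - 1) x"
  proof (cases n)
    case (Suc m)
    have "real (Suc m) = sqrt (Suc m) * sqrt (Suc m)" by simp
    then show ?thesis
      unfolding hh Suc pderiv_hermite_poly_Suc k using k(2)[of m]
      by (simp add: field_simps del: of_nat_Suc)
  qed simp
  finally show ?thesis unfolding 2 .
qed

lemma hh_deriv: "(hh n has_real_derivative (sqrt 2 * sqrt n * hh (n - 1) x - x * hh n x)) (at x)"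
proof -
  define k where "k = (\<lambda>n. sqrt (2 ^ n * fact n * sqrt pi) :: real)"
  have k: "k (Suc m) = sqrt 2 * sqrt (Suc m) * k m" "k m > 0" for m
    unfolding k_def by (rule hermite_norm_Suc) simp
  have hh: "hh m x = poly (hermite_poly m) x * exp (- x\<^sup>2 / 2) / k m" for m x
    by (simp add: hh_def k_def)
  have "poly (pderiv (hermite_poly n)) x * exp (- x\<^sup>2 / 2) / k n = sqrt 2 * sqrt n * hh (n - 1) x"
  proof (cases n)
    case (Suc m)
    have "real (Suc m) = sqrt (Suc m) * sqrt (Suc m)" "2 = sqrt 2 * sqrt (2::real)" by simp_all
    then show ?thesis
      unfolding hh Suc pderiv_hermite_poly_Suc k using k(2)[of m]
      by (simp add: field_simps real_sqrt_mult del: of_nat_Suc)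
  qed simp
  moreover have "((\<lambda>x. poly (hermite_poly n) x * exp (- x\<^sup>2 / 2) / k n) has_real_derivative
      (poly (pderiv (hermite_poly n)) x * exp (- x\<^sup>2 / 2) / k n
        - x * (poly (hermite_poly n) x * exp (- x\<^sup>2 / 2) / k n))) (at x)"
    unfolding divide_inverse[of _ "k n"]
    by (auto intro!: derivative_eq_intros simp: algebra_simps)
  ultimately show ?thesis unfolding hh[symmetric] by (simp add: hh[abs_def])
qed

text \<open>The differentiated function is the derivative of \<open>hh n\<close>, so this is the
  eigenvalue equation of the oscillator.\<close>

lemma hh_deriv2:
  "((\<lambda>x. sqrt 2 * sqrt n * hh (n - 1) x - x * hh n x) has_real_derivative
     ((x\<^sup>2 - (2 * real n + 1)) * hh n x)) (at x)"
proof -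
  have d: "((\<lambda>x. sqrt 2 * sqrt n * hh (n - 1) x - x * hh n x) has_real_derivative
     (sqrt 2 * sqrt n * (sqrt 2 * sqrt (n - 1) * hh (n - 1 - 1) x - x * hh (n - 1) x)
       - (hh n x + x * (sqrt 2 * sqrt n * hh (n - 1) x - x * hh n x)))) (at x)"
    by (auto intro!: derivative_eq_intros hh_deriv)
  have "sqrt 2 * sqrt n * (sqrt 2 * sqrt (n - 1) * hh (n - 1 - 1) x) =
      2 * (sqrt 2 * sqrt n * x * hh (n - 1) x) - 2 * n * hh n x"
  proof (cases n)
    case (Suc m)
    have "sqrt m * hh (m - 1) x = sqrt 2 * x * hh m x - sqrt (Suc m) * hh (Suc m) x"
      using hh_rec[of m x] by simp
    then have "sqrt 2 * sqrt (Suc m) * (sqrt 2 * sqrt m * hh (m - 1) x) =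
        sqrt 2 * sqrt (Suc m) * sqrt 2 * (sqrt 2 * x * hh m x - sqrt (Suc m) * hh (Suc m) x)"
      by (simp add: real_sqrt_mult del: of_nat_Suc)
    also have "\<dots> = (sqrt 2 * sqrt 2) * (sqrt 2 * sqrt (Suc m) * x * hh m x)
        - (sqrt 2 * sqrt 2) * (sqrt (Suc m) * sqrt (Suc m)) * hh (Suc m) x"
      by (simp add: real_sqrt_mult algebra_simps del: of_nat_Suc)
    finally show ?thesis using Suc by simp
  qed simp
  then have e: "sqrt 2 * sqrt n * (sqrt 2 * sqrt (n - 1) * hh (n - 1 - 1) x - x * hh (n - 1) x)
       - (hh n x + x * (sqrt 2 * sqrt n * hh (n - 1) x - x * hh n x)) = (x\<^sup>2 - (2 * real n + 1)) * hh n x"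
    by (simp add: algebra_simps power2_eq_square)
  show ?thesis using d unfolding e .
qed

lemma hh_minus: "hh n (- x) = (- 1) ^ n * hh n x"
proof (induction n rule: less_induct)
  case (less n)
  show ?case
  proof (cases n)
    case (Suc m)
    have "sqrt (Suc m) * hh (Suc m) (- x) = - (sqrt 2 * x * hh m (- x)) - sqrt m * hh (m - 1) (- x)"
      using hh_rec[of m "- x"] by simp
    also have "\<dots> = (- 1) ^ Suc m * (sqrt 2 * x * hh m x - sqrt m * hh (m - 1) x)"
      using less.IH[of m] less.IH[of "m - 1"] Suc by (cases m) (simp_all add: algebra_simps)
    also have "\<dots> = sqrt (Suc m) * ((- 1) ^ Suc m * hh (Suc m) x)"
      using hh_rec[of m x] by simp
    finally show ?thesis using Suc by (subst (asm) mult_cancel_left) (simp del: power_Suc)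
  qed (simp add: hh_0)
qed

section \<open>Values at the origin and a uniform bound in the oscillatory region\<close>

lemma hh_zero_recurrence: "real (n + 2) * (hh (n + 2) 0)\<^sup>2 = real (n + 1) * (hh n 0)\<^sup>2"
proof -
  have "(sqrt (n + 2) * hh (n + 2) 0)\<^sup>2 = (sqrt (n + 1) * hh n 0)\<^sup>2"
    using hh_rec[of "Suc n" 0] by (simp add: add_ac)
  then show ?thesis by (simp add: power_mult_distrib)
qed

lemma hh_1_0: "hh (Suc 0) 0 = 0"
  using hh_rec[of 0 0] by simp

lemma hh_0_0_sq: "(hh 0 0)\<^sup>2 \<le> 1"
proof -
  have "sqrt pi \<ge> 1" using pi_ge_two by simp
  then show ?thesis by (simp add: hh_0 power_divide)
qed

text \<open>Two steps multiply the square by (n + 1) / (n + 2), which is at most sqrt ((n + 1) / (n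
  + 3)); the odd values vanish.\<close>

lemma hh_zero_sq_le: "(hh n 0)\<^sup>2 \<le> 1 / sqrt (n + 1)"
proof (induction n rule: less_induct)
  case (less n)
  consider "n = 0" | "n = 1" | m where "n = m + 2"
    by (metis One_nat_def Suc_1 add.commute add_2_eq_Suc less_2_cases_iff not_less le_Suc_ex)
  then show ?case
  proof cases
    case 3
    have "(hh n 0)\<^sup>2 = real (m + 1) * (hh m 0)\<^sup>2 / real (m + 2)"
      using hh_zero_recurrence[of m] 3 by (simp add: field_simps)
    also have "\<dots> \<le> real (m + 1) * (1 / sqrt (m + 1)) / real (m + 2)"
      using less.IH[of m] 3 by (intro divide_right_mono mult_left_mono) auto
    also have "real (m + 1) * (1 / sqrt (m + 1)) = sqrt (m + 1)"
      by (simp add: real_div_sqrt)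
    also have "sqrt (m + 1) / real (m + 2) \<le> 1 / sqrt (m + 3)"
    proof -
      have "sqrt (m + 1) * sqrt (m + 3) = sqrt (real (m + 1) * real (m + 3))"
        by (simp only: real_sqrt_mult)
      also have "\<dots> \<le> sqrt ((real (m + 2))\<^sup>2)"
        by (intro real_sqrt_le_mono) (simp add: power2_eq_square algebra_simps)
      finally have "sqrt (m + 1) * sqrt (m + 3) \<le> real (m + 2)" by simp
      then show ?thesis by (simp add: field_simps)
    qed
    finally show ?thesis using 3 by (simp add: add_ac)
  qed (use hh_0_0_sq hh_1_0 in auto)
qed

lemma hh_zero_sq_le_1: "(hh n 0)\<^sup>2 \<le> 1"
proof -
  have "1 / sqrt (n + 1) \<le> 1" by simp
  then show ?thesis using hh_zero_sq_le[of n] by linarith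
qed

text \<open>The squares h_m(0)^2 have the generating function (1 - t^2)^(-1/2) / sqrt pi, whose
  square has coefficients 1 / pi in even and 0 in odd degrees. The proof is the differential
  equation of this series in coefficients: weight by m, symmetrize, and use the two-step
  recurrence.\<close>

lemma hh_zero_convolution: "(\<Sum>m\<le>M. (hh m 0)\<^sup>2 * (hh (M - m) 0)\<^sup>2) \<le> 1"
proof (induction M rule: less_induct)
  case (less M)
  define z where "z = (\<lambda>m. (hh m 0)\<^sup>2)"
  define S where "S = (\<lambda>M. \<Sum>m\<le>M. z m * z (M - m))"
  have sym: "2 * (\<Sum>m\<le>M. real m * (z m * z (M - m))) = real M * S M" for M
  proof -
    have "(\<Sum>m\<le>M. real m * (z m * z (M - m))) = (\<Sum>m\<le>M. real (M - m) * (z m * z (M - m)))"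
      by (rule sum.reindex_bij_witness[where i = "\<lambda>a. M - a" and j = "\<lambda>a. M - a"]) (auto simp: mult_ac)
    then have "2 * (\<Sum>m\<le>M. real m * (z m * z (M - m))) =
        (\<Sum>m\<le>M. real m * (z m * z (M - m))) + (\<Sum>m\<le>M. real (M - m) * (z m * z (M - m)))" by simp
    also have "\<dots> = (\<Sum>m\<le>M. real M * (z m * z (M - m)))"
      unfolding sum.distrib[symmetric] by (intro sum.cong) (auto simp: algebra_simps of_nat_diff)
    finally show ?thesis by (simp add: S_def sum_distrib_left)
  qed
  consider "M = 0" | "M = 1" | K where "M = Suc (Suc K)"
    by (metis One_nat_def not0_implies_Suc)
  then have "S M \<le> 1"
  proof cases
    case 3
    have "real M * S M = 2 * (\<Sum>m\<le>M. real m * (z m * z (M - m)))" by (rule sym[symmetric])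
    also have "(\<Sum>m\<le>M. real m * (z m * z (M - m))) = (\<Sum>m\<le>K. real (m + 2) * z (m + 2) * z (K - m))"
      unfolding 3 sum.atMost_Suc_shift[of _ "Suc K"] sum.atMost_Suc_shift[of _ K]
      by (simp add: z_def hh_1_0 mult_ac)
    also have "\<dots> = (\<Sum>m\<le>K. real (m + 1) * z m * z (K - m))"
      using hh_zero_recurrence unfolding z_def by simp
    also have "\<dots> = (\<Sum>m\<le>K. real m * (z m * z (K - m))) + S K"
      unfolding S_def sum.distrib[symmetric] by (intro sum.cong) (auto simp: algebra_simps)
    also have "2 * \<dots> = real M * S K"
      using sym[of K] 3 by (simp add: algebra_simps)
    finally have "S M = S K" using 3 by simp
    then show ?thesis using less.IH[of K] 3 by (simp add: S_def z_def)
  next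
    case 1
    have "z 0 * z 0 \<le> 1 * 1"
      unfolding z_def using hh_0_0_sq by (intro mult_mono) auto
    then show ?thesis using 1 by (simp add: S_def)
  qed (simp add: S_def z_def hh_1_0)
  then show ?case by (simp add: S_def z_def)
qed

text \<open>Sonin's energy argument. The quantity e = h'^2 + (2n + 1 - x^2) h^2 decreases away from
  the origin, since its derivative is -2 x h^2; its value at 0 is controlled by h_n(0) and
  h_(n-1)(0), and for x^2 \<le> n the coefficient of h^2 is at least n + 1.\<close>

lemma hh_local_bound:
  assumes "x\<^sup>2 \<le> real n"
  shows "(hh n x)\<^sup>2 \<le> 4 / sqrt (n + 1)"
proof -
  define d where "d = (\<lambda>x. sqrt 2 * sqrt n * hh (n - 1) x - x * hh n x)"
  define e where "e = (\<lambda>x. (d x)\<^sup>2 + (2 * real n + 1 - x\<^sup>2) * (hh n x)\<^sup>2)"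
  have e': "(e has_real_derivative (- 2 * x * (hh n x)\<^sup>2)) (at x)" for x
    unfolding e_def
    by (rule derivative_eq_intros hh_deriv2[of n, folded d_def] hh_deriv[of n] refl)+
      (simp add: d_def algebra_simps power2_eq_square)
  have "e y \<le> e 0" if "0 \<le> y" for y
    using that e' by (intro DERIV_nonpos_imp_nonincreasing[of 0 y e]) (auto intro!: exI mult_nonneg_nonneg)
  then have le: "e \<bar>x\<bar> \<le> e 0" by simp
  have abs: "(hh n \<bar>x\<bar>)\<^sup>2 = (hh n x)\<^sup>2"
    by (cases "x \<ge> 0") (simp_all add: hh_minus power_mult_distrib flip: power_mult)
  have s: "sqrt (real n + 1) > 0" "sqrt (real n + 1) * sqrt (real n + 1) = real n + 1" by simp_all
  have "(n + 1) * (hh n x)\<^sup>2 \<le> (2 * real n + 1 - x\<^sup>2) * (hh n x)\<^sup>2"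
    using assms by (intro mult_right_mono) auto
  also have "\<dots> \<le> e \<bar>x\<bar>" by (simp add: e_def abs)
  also note le
  also have "e 0 = 2 * real n * (hh (n - 1) 0)\<^sup>2 + (2 * real n + 1) * (hh n 0)\<^sup>2"
    by (simp add: e_def d_def power_mult_distrib)
  also have "\<dots> \<le> 2 * sqrt (n + 1) + 2 * sqrt (n + 1)"
  proof (rule add_mono)
    show "2 * real n * (hh (n - 1) 0)\<^sup>2 \<le> 2 * sqrt (n + 1)"
    proof (cases n)
      case (Suc m)
      have "real n * (hh m 0)\<^sup>2 \<le> real n * (1 / sqrt n)"
        using hh_zero_sq_le[of m] Suc by (intro mult_left_mono) (auto simp: add_ac)
      also have "\<dots> = sqrt n" by (simp add: real_div_sqrt)
      also have "\<dots> \<le> sqrt (n + 1)" by simp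
      finally show ?thesis using Suc by (simp only: diff_Suc_1 mult.assoc)
    qed simp
    have "(2 * real n + 1) * (hh n 0)\<^sup>2 \<le> (2 * (n + 1)) * (1 / sqrt (n + 1))"
      using hh_zero_sq_le[of n] by (intro mult_mono) auto
    also have "\<dots> = 2 * sqrt (n + 1)" using s by (simp add: field_simps)
    finally show "(2 * real n + 1) * (hh n 0)\<^sup>2 \<le> 2 * sqrt (n + 1)" .
  qed
  finally have "(sqrt (real n + 1) * sqrt (real n + 1)) * (hh n x)\<^sup>2 \<le> 4 * sqrt (real n + 1)"
    by (simp add: add_ac)
  then have "sqrt (real n + 1) * (hh n x)\<^sup>2 \<le> 4"
    using s(1) by (simp only: mult.assoc mult.commute[of 4] mult_le_cancel_left_pos)
  then show ?thesis using s(1) by (simp add: field_simps)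
qed

lemma hermite_rec_hh: "hermite_rec (of_real x) (\<lambda>n. of_real (hh n x))"
  unfolding hermite_rec_def
proof
  fix n show "complex_of_real (sqrt (real (Suc n))) * of_real (hh (Suc n) x) =
     of_real (sqrt 2) * of_real x * of_real (hh n x) - of_real (sqrt n) * of_real (hh (n - 1) x)"
    using arg_cong[OF hh_rec[of n x], of complex_of_real] by simp
qed

text \<open>A product of k Hermite functions, times any polynomial, has this form. One closed class
  thus settles integrability and vanishing at infinity for all integrands below; k \<ge> 1 lets
  every member be dominated by a polynomial times a single Gaussian.\<close>

definition gaussian_poly :: "(real \<Rightarrow> real) \<Rightarrow> bool" where
  "gaussian_poly f \<longleftrightarrow> (\<exists>p k. 1 \<le> k \<and> f = (\<lambda>x. poly p x * exp (- real k * x\<^sup>2 / 2)))"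

lemma gaussian_poly_hh: "gaussian_poly (hh n)"
proof -
  have "hh n = (\<lambda>x. poly (smult (1 / sqrt (2 ^ n * fact n * sqrt pi)) (hermite_poly n)) x
      * exp (- real 1 * x\<^sup>2 / 2))"
    by (simp add: hh_def fun_eq_iff)
  then show ?thesis unfolding gaussian_poly_def by blast
qed

lemma gaussian_poly_mult:
  assumes "gaussian_poly f" "gaussian_poly g"
  shows "gaussian_poly (\<lambda>x. f x * g x)"
proof -
  obtain p k q l where pq: "1 \<le> k" "f = (\<lambda>x. poly p x * exp (- real k * x\<^sup>2 / 2))"
      "1 \<le> l" "g = (\<lambda>x. poly q x * exp (- real l * x\<^sup>2 / 2))"
    using assms unfolding gaussian_poly_def by blast
  have "(\<lambda>x. f x * g x) = (\<lambda>x. poly (p * q) x * exp (- real (k + l) * x\<^sup>2 / 2))"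
  proof
    fix x
    have "exp (- real (k + l) * x\<^sup>2 / 2) = exp (- real k * x\<^sup>2 / 2) * exp (- real l * x\<^sup>2 / 2)"
      unfolding mult_exp_exp by (rule arg_cong[of _ _ exp]) (simp add: field_simps)
    then show "f x * g x = poly (p * q) x * exp (- real (k + l) * x\<^sup>2 / 2)"
      unfolding pq by (simp only: poly_mult mult_ac)
  qed
  moreover have "1 \<le> k + l" using pq by simp
  ultimately show ?thesis unfolding gaussian_poly_def by blast
qed

lemma gaussian_poly_poly_mult:
  assumes "gaussian_poly f"
  shows "gaussian_poly (\<lambda>x. poly q x * f x)"
proof -
  obtain p k where pq: "1 \<le> k" "f = (\<lambda>x. poly p x * exp (- real k * x\<^sup>2 / 2))"
    using assms unfolding gaussian_poly_def by blast
  then have "(\<lambda>x. poly q x * f x) = (\<lambda>x. poly (q * p) x * exp (- real k * x\<^sup>2 / 2))"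
    by (simp add: fun_eq_iff mult_ac)
  then show ?thesis using pq(1) unfolding gaussian_poly_def by blast
qed

lemma integrable_poly_gaussian:
  fixes p :: "real poly"
  shows "integrable lborel (\<lambda>x. poly p x * exp (- x\<^sup>2 / 2))"
proof -
  have "integrable lborel (\<lambda>x. sqrt (2 * pi) * (\<Sum>i\<le>degree p. coeff p i * (std_normal_density x * x ^ i)))"
    by (intro integrable_mult_right Bochner_Integration.integrable_sum integrable_std_normal_moment)
  also have "(\<lambda>x. sqrt (2 * pi) * (\<Sum>i\<le>degree p. coeff p i * (std_normal_density x * x ^ i))) =
      (\<lambda>x. poly p x * exp (- x\<^sup>2 / 2))"
    by (simp add: fun_eq_iff std_normal_density_def poly_altdef sum_distrib_left sum_distrib_right mult_ac)
  finally show ?thesis .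
qed

lemma gaussian_poly_integrable:
  assumes "gaussian_poly f"
  shows "integrable lborel f"
proof -
  obtain p k where pk: "1 \<le> k" "f = (\<lambda>x. poly p x * exp (- real k * x\<^sup>2 / 2))"
    using assms unfolding gaussian_poly_def by blast
  show ?thesis
  proof (rule Bochner_Integration.integrable_bound[OF integrable_poly_gaussian[of p]])
    have "continuous_on UNIV f" unfolding pk(2) by (intro continuous_intros) auto
    then show "f \<in> borel_measurable lborel" by (simp add: borel_measurable_continuous_onI)
    show "AE x in lborel. norm (f x) \<le> norm (poly p x * exp (- x\<^sup>2 / 2))"
    proof (rule AE_I2)
      fix x :: real
      have "1 * x\<^sup>2 \<le> real k * x\<^sup>2" using pk(1) by (intro mult_right_mono) auto
      then have "exp (- real k * x\<^sup>2 / 2) \<le> exp (- x\<^sup>2 / 2)" by simp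
      then show "norm (f x) \<le> norm (poly p x * exp (- x\<^sup>2 / 2))"
        unfolding pk(2) norm_mult by (intro mult_left_mono) auto
    qed
  qed
qed

lemma tendsto_poly_gaussian_at_top:
  fixes p :: "real poly"
  shows "((\<lambda>x. poly p x * exp (- x\<^sup>2 / 2)) \<longlongrightarrow> 0) at_top"
proof -
  have "((\<lambda>x. \<Sum>i\<le>degree p. coeff p i * (x ^ i * exp (- x\<^sup>2 / 2))) \<longlongrightarrow> (\<Sum>i\<le>degree p. coeff p i * 0)) at_top"
  proof (intro tendsto_sum tendsto_mult_left)
    fix i
    have "((\<lambda>x. x ^ i / exp x) \<longlongrightarrow> (0::real)) at_top"
      by (rule tendsto_power_div_exp_0)
    then show "((\<lambda>x. x ^ i * exp (- x\<^sup>2 / 2)) \<longlongrightarrow> (0::real)) at_top"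
    proof (rule Lim_null_comparison[rotated])
      show "\<forall>\<^sub>F x in at_top. norm (x ^ i * exp (- x\<^sup>2 / 2)) \<le> x ^ i / exp (x::real)"
        using eventually_ge_at_top[of 2]
      proof eventually_elim
        fix x :: real assume x: "2 \<le> x"
        then have "2 * x \<le> x * x" by (intro mult_right_mono) auto
        then have "exp (- x\<^sup>2 / 2) \<le> exp (- x)" by (simp add: power2_eq_square)
        then have "x ^ i * exp (- x\<^sup>2 / 2) \<le> x ^ i * exp (- x)"
          using x by (intro mult_left_mono) auto
        moreover have "norm (x ^ i * exp (- x\<^sup>2 / 2)) = x ^ i * exp (- x\<^sup>2 / 2)"
          using x by simp
        moreover have "x ^ i * exp (- x) = x ^ i / exp x" by (simp add: exp_minus divide_inverse)
        ultimately show "norm (x ^ i * exp (- x\<^sup>2 / 2)) \<le> x ^ i / exp x" by linarith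
      qed
    qed
  qed
  then show ?thesis
    by (simp only: poly_altdef sum_distrib_right mult.assoc mult_zero_right sum.neutral_const)
qed

lemma gaussian_poly_tendsto:
  assumes "gaussian_poly f"
  shows "(f \<longlongrightarrow> 0) at_top" "(f \<longlongrightarrow> 0) at_bot"
proof -
  obtain p k where pk: "1 \<le> k" "f = (\<lambda>x. poly p x * exp (- real k * x\<^sup>2 / 2))"
    using assms unfolding gaussian_poly_def by blast
  have bound: "norm (f x) \<le> norm (poly p x * exp (- x\<^sup>2 / 2))" for x
  proof -
    have "1 * x\<^sup>2 \<le> real k * x\<^sup>2" using pk(1) by (intro mult_right_mono) auto
    then have "exp (- real k * x\<^sup>2 / 2) \<le> exp (- x\<^sup>2 / 2)" by simp
    then show "norm (f x) \<le> norm (poly p x * exp (- x\<^sup>2 / 2))"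
      unfolding pk(2) norm_mult by (intro mult_left_mono) auto
  qed
  show "(f \<longlongrightarrow> 0) at_top"
    by (rule Lim_null_comparison[OF _ tendsto_norm_zero[OF tendsto_poly_gaussian_at_top[of p]]])
      (simp add: bound[simplified])
  have "((\<lambda>x. f (- x)) \<longlongrightarrow> 0) at_top"
  proof (rule Lim_null_comparison[OF _ tendsto_norm_zero[OF tendsto_poly_gaussian_at_top[of "pcompose p [:0, -1:]"]]])
    show "\<forall>\<^sub>F x in at_top. norm (f (- x)) \<le> norm (poly (pcompose p [:0, -1:]) x * exp (- x\<^sup>2 / 2))"
      using bound[of "- _"] by (simp add: poly_pcompose)
  qed
  then show "(f \<longlongrightarrow> 0) at_bot"
    by (simp add: filterlim_at_bot_mirror)
qed

section \<open>Orthonormality, overlaps and the Fourier transform of Hermite functions\<close>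

lemma integral_deriv_eq_0:
  fixes F f :: "real \<Rightarrow> 'a::euclidean_space"
  assumes "\<And>x. (F has_vector_derivative f x) (at x)" "\<And>x. isCont f x" "integrable lborel f"
    "(F \<longlongrightarrow> 0) at_top" "(F \<longlongrightarrow> 0) at_bot"
  shows "(LINT x|lborel. f x) = 0"
proof -
  have "(LBINT x=-\<infinity>..\<infinity>. f x) = 0 - 0"
  proof (rule interval_integral_FTC_integrable[where F = F])
    show "((F \<circ> real_of_ereal) \<longlongrightarrow> 0) (at_right (- \<infinity>))"
      using assms(5) by (simp add: ereal_tendsto_simps)
    show "((F \<circ> real_of_ereal) \<longlongrightarrow> 0) (at_left \<infinity>)"
      using assms(4) by (simp add: ereal_tendsto_simps)
    show "set_integrable lborel (einterval (- \<infinity>) \<infinity>) f"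
      using assms(3) by (simp add: einterval_eq_UNIV set_integrable_def)
  qed (use assms in auto)
  then show ?thesis
    by (simp add: interval_lebesgue_integral_def einterval_eq_UNIV set_lebesgue_integral_def)
qed

lemma isCont_hh [continuous_intros]: "continuous_on S (hh n)" "isCont (hh n) x"
  using DERIV_isCont[OF hh_deriv] by (auto intro: continuous_at_imp_continuous_on)

lemma measurable_hh [measurable]: "hh n \<in> borel_measurable borel"
  by (intro borel_measurable_continuous_onI isCont_hh)

lemma integrable_hh: "integrable lborel (hh n)"
  by (intro gaussian_poly_integrable gaussian_poly_hh)

lemma integrable_hh2: "integrable lborel (\<lambda>x. hh m x * hh n x)"
  by (intro gaussian_poly_integrable gaussian_poly_mult gaussian_poly_hh)

lemma integrable_hh4: "integrable lborel (\<lambda>x. hh a x * hh b x * (hh c x * hh d x))"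
  by (intro gaussian_poly_integrable gaussian_poly_mult gaussian_poly_hh)

text \<open>Creation and annihilation are adjoint: integrate the derivative of h_m h_n and eliminate
  the terms containing x by the recurrence.\<close>

lemma hh_ladder: "sqrt (Suc m) * (LINT x|lborel. hh (Suc m) x * hh n x) =
    sqrt n * (LINT x|lborel. hh m x * hh (n - 1) x)"
proof -
  define I where "I = (\<lambda>m n. LINT x|lborel. hh m x * hh n x)"
  define f where "f = (\<lambda>x. sqrt 2 * (sqrt n * (hh m x * hh (n - 1) x) - sqrt (Suc m) * (hh (Suc m) x * hh n x)))"
  have d: "((\<lambda>x. hh m x * hh n x) has_real_derivative f x) (at x)" for x
  proof -
    have 2: "2 = sqrt 2 * sqrt (2::real)" by simp
    have "((\<lambda>x. hh m x * hh n x) has_real_derivative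
      ((sqrt 2 * sqrt m * hh (m - 1) x - x * hh m x) * hh n x
        + hh m x * (sqrt 2 * sqrt n * hh (n - 1) x - x * hh n x))) (at x)"
      by (auto intro!: derivative_eq_intros hh_deriv)
    also have "((sqrt 2 * sqrt m * hh (m - 1) x - x * hh m x) * hh n x
        + hh m x * (sqrt 2 * sqrt n * hh (n - 1) x - x * hh n x)) =
        sqrt 2 * (sqrt n * (hh m x * hh (n - 1) x)) -
        sqrt 2 * ((sqrt 2 * x * hh m x - sqrt m * hh (m - 1) x) * hh n x)"
      by (simp add: algebra_simps)
    also have "\<dots> = f x" unfolding hh_rec[of m x, symmetric] f_def by (simp add: algebra_simps)
    finally show ?thesis .
  qed
  have "(LINT x|lborel. f x) = 0"
  proof (rule integral_deriv_eq_0)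
    show "((\<lambda>x. hh m x * hh n x) has_vector_derivative f x) (at x)" for x
      using d by (simp add: has_real_derivative_iff_has_vector_derivative)
    show "isCont f x" for x unfolding f_def by (intro continuous_intros isCont_hh)
    show "integrable lborel f" unfolding f_def
      by (intro integrable_mult_right Bochner_Integration.integrable_diff integrable_hh2)
  qed (intro gaussian_poly_tendsto gaussian_poly_mult gaussian_poly_hh)+
  then show ?thesis
    unfolding f_def by (simp add: integrable_hh2 del: of_nat_Suc)
qed

lemma hh_norm_0: "(LINT x|lborel. hh 0 x * hh 0 x) = 1"
proof -
  have "hh 0 x * hh 0 x = normal_density 0 (1 / sqrt 2) x" for x
    by (simp add: hh_0 normal_density_def power_divide mult_exp_exp)
  then show ?thesis by (simp add: integral_normal_density)
qed

lemma hh_orthonormal: "(LINT x|lborel. hh m x * hh n x) = (if m = n then 1 else 0)"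
proof (induction m arbitrary: n)
  case 0
  show ?case
  proof (cases n)
    case (Suc k)
    have "(LINT x|lborel. hh 0 x * hh n x) = (LINT x|lborel. hh n x * hh 0 x)" by (simp add: mult.commute)
    then show ?thesis using hh_ladder[of k 0] Suc by (simp del: of_nat_Suc)
  qed (simp add: hh_norm_0)
next
  case (Suc m)
  show ?case
  proof (cases n)
    case 0
    then show ?thesis using hh_ladder[of m 0] by (simp del: of_nat_Suc)
  next
    case (Suc k)
    then show ?thesis using hh_ladder[of m n] Suc.IH[of k] by (simp del: of_nat_Suc split: if_splits)
  qed
qed

lemma hh_quartic_parity:
  assumes "odd (a + b + c + d)"
  shows "(LINT x|lborel. hh a x * hh b x * (hh c x * hh d x)) = 0"
proof -
  have "(LINT x|lborel. hh a x * hh b x * (hh c x * hh d x)) =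
      (LINT x|lborel. hh a (- x) * hh b (- x) * (hh c (- x) * hh d (- x)))"
    using lborel_integral_real_affine[of "-1" "\<lambda>x. hh a x * hh b x * (hh c x * hh d x)" 0] by simp
  also have "(\<lambda>x. hh a (- x) * hh b (- x) * (hh c (- x) * hh d (- x))) =
      (\<lambda>x. (- 1) ^ (a + b + c + d) * (hh a x * hh b x * (hh c x * hh d x)))"
    by (simp add: hh_minus power_add fun_eq_iff)
  finally show ?thesis using assms by simp
qed

text \<open>Split at x^2 = n. Inside, h_n^2 is uniformly small by \<open>hh_local_bound\<close> and
  h_l^2 has mass 1; outside, h_l^2 is uniformly small by its decay and h_n^2 has mass 1.\<close>

lemma hh_sq_overlap_tendsto:
  "(\<lambda>n. LINT x|lborel. (hh l x)\<^sup>2 * (hh n x)\<^sup>2) \<longlonglongrightarrow> 0"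
proof (rule LIMSEQ_I)
  fix r :: real assume r: "0 < r"
  have sq: "gaussian_poly (\<lambda>x. hh l x * hh l x)"
    by (intro gaussian_poly_mult gaussian_poly_hh)
  have "\<forall>\<^sub>F x in at_top. norm (hh l x * hh l x) < r / 4" "\<forall>\<^sub>F x in at_bot. norm (hh l x * hh l x) < r / 4"
    using gaussian_poly_tendsto[OF sq, THEN tendstoD, of "r / 4"] r by simp_all
  then obtain A B where "\<forall>x\<ge>A. norm (hh l x * hh l x) < r / 4" "\<forall>x\<le>B. norm (hh l x * hh l x) < r / 4"
    unfolding eventually_at_top_linorder eventually_at_bot_linorder by blast
  then have A: "A \<le> x \<Longrightarrow> (hh l x)\<^sup>2 \<le> r / 4" and B: "x \<le> B \<Longrightarrow> (hh l x)\<^sup>2 \<le> r / 4" for x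
    by (force simp: power2_eq_square)+
  define X where "X = max \<bar>A\<bar> \<bar>B\<bar>"
  have X: "(hh l x)\<^sup>2 \<le> r / 4" if "\<bar>x\<bar> \<ge> X" for x
    using that A[of x] B[of x] unfolding X_def by (cases "x \<ge> 0") auto
  obtain N where N: "real N \<ge> max (X\<^sup>2) ((16 / r)\<^sup>2)" using real_arch_simple by blast
  show "\<exists>no. \<forall>n\<ge>no. norm ((LINT x|lborel. (hh l x)\<^sup>2 * (hh n x)\<^sup>2) - 0) < r"
  proof (intro exI allI impI)
    fix n assume n: "N \<le> n"
    have nX: "X\<^sup>2 \<le> real n" "(16 / r)\<^sup>2 \<le> real n" using N n by auto
    have "16 / r \<le> sqrt (n + 1)" using nX(2) r by (intro real_le_rsqrt) auto
    then have small: "4 / sqrt (n + 1) \<le> r / 4" using r by (simp add: field_simps)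
    have pt: "(hh l x)\<^sup>2 * (hh n x)\<^sup>2 \<le> r / 4 * (hh l x * hh l x) + r / 4 * (hh n x * hh n x)" for x
    proof (cases "x\<^sup>2 \<le> real n")
      case True
      then have "(hh n x)\<^sup>2 \<le> r / 4" using hh_local_bound small by force
      then have "(hh l x)\<^sup>2 * (hh n x)\<^sup>2 \<le> (hh l x)\<^sup>2 * (r / 4)" by (intro mult_left_mono) auto
      moreover have "0 \<le> r / 4 * (hh n x * hh n x)" using r by simp
      ultimately show ?thesis by (simp add: power2_eq_square algebra_simps)
    next
      case False
      then have "X\<^sup>2 \<le> x\<^sup>2" using nX by simp
      then have "\<bar>x\<bar> \<ge> X" using abs_le_square_iff[of X x] X_def by simp
      then have "(hh l x)\<^sup>2 * (hh n x)\<^sup>2 \<le> (r / 4) * (hh n x)\<^sup>2" using X by (intro mult_right_mono) auto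
      moreover have "0 \<le> r / 4 * (hh l x * hh l x)" using r by simp
      ultimately show ?thesis by (simp add: power2_eq_square algebra_simps)
    qed
    have int: "integrable lborel (\<lambda>x. (hh l x)\<^sup>2 * (hh n x)\<^sup>2)"
      using integrable_hh4[of l l n n] by (simp add: power2_eq_square)
    have "(LINT x|lborel. (hh l x)\<^sup>2 * (hh n x)\<^sup>2) \<le>
        (LINT x|lborel. r / 4 * (hh l x * hh l x) + r / 4 * (hh n x * hh n x))"
      by (intro integral_mono int pt Bochner_Integration.integrable_add integrable_mult_right integrable_hh2)
    also have "\<dots> = r / 4 + r / 4"
      by (subst Bochner_Integration.integral_add, intro integrable_mult_right integrable_hh2,
          intro integrable_mult_right integrable_hh2, simp only: integral_mult_right_zero)
        (simp add: hh_orthonormal)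
    finally have "(LINT x|lborel. (hh l x)\<^sup>2 * (hh n x)\<^sup>2) < r" using r by simp
    moreover have "0 \<le> (LINT x|lborel. (hh l x)\<^sup>2 * (hh n x)\<^sup>2)" by (intro integral_nonneg_AE) auto
    ultimately show "norm ((LINT x|lborel. (hh l x)\<^sup>2 * (hh n x)\<^sup>2) - 0) < r" by simp
  qed
qed

text \<open>Integrating the derivative of exp(-i x \<xi>) h_n(x) gives the transforms the same
  recurrence as (-i)^n h_n, so the induction only needs the Gaussian, whose transform is the
  characteristic function of the normal distribution.\<close>

lemma fourier_hermite_fun: "fourier_transform (hermite_fun n) \<xi> = (- \<i>) ^ n * hermite_fun n \<xi>"
proof -
  define J where "J = (\<lambda>n. LINT x|lborel. exp (- \<i> * of_real (x * \<xi>)) * complex_of_real (hh n x))"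
  have int: "integrable lborel (\<lambda>x. exp (- \<i> * of_real (x * \<xi>)) * complex_of_real (hh n x))" for n
    by (rule Bochner_Integration.integrable_bound[OF integrable_hh[of n]]) (auto simp: norm_mult)
  have J_rec: "of_real (sqrt (Suc n)) * J (Suc n) = of_real (sqrt n) * J (n - 1) - \<i> * of_real (sqrt 2) * of_real \<xi> * J n" for n
  proof -
    define f where "f = (\<lambda>x. - \<i> * of_real \<xi> * (exp (- \<i> * of_real (x * \<xi>)) * complex_of_real (hh n x))
      + of_real (1 / sqrt 2) * (of_real (sqrt n) * (exp (- \<i> * of_real (x * \<xi>)) * complex_of_real (hh (n - 1) x))
      - of_real (sqrt (Suc n)) * (exp (- \<i> * of_real (x * \<xi>)) * complex_of_real (hh (Suc n) x))))"
    have "(LINT x|lborel. f x) = 0"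
    proof (rule integral_deriv_eq_0)
      fix x
      have eq: "sqrt 2 * sqrt n * hh (n - 1) x - x * hh n x =
          1 / sqrt 2 * (sqrt n * hh (n - 1) x - sqrt (Suc n) * hh (Suc n) x)"
        unfolding hh_rec[of n x] by (simp add: field_simps)
      have dh: "((\<lambda>x. complex_of_real (hh n x)) has_vector_derivative of_real (sqrt 2 * sqrt n * hh (n - 1) x - x * hh n x)) (at x)"
        using hh_deriv[of n x]
        by (intro has_vector_derivative_of_real) (simp add: has_real_derivative_iff_has_vector_derivative)
      have de: "((\<lambda>x. exp (- \<i> * of_real (x * \<xi>))) has_vector_derivative (- \<i> * of_real \<xi> * exp (- \<i> * of_real (x * \<xi>)))) (at x)"
      proof -
        have "((\<lambda>z. exp (- \<i> * (z * of_real \<xi>))) has_field_derivative (- \<i> * of_real \<xi> * exp (- \<i> * (of_real x * of_real \<xi>)))) (at (of_real x))"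
          by (auto intro!: derivative_eq_intros)
        from has_vector_derivative_real_field[OF this]
        show ?thesis by simp
      qed
      show "((\<lambda>x. exp (- \<i> * of_real (x * \<xi>)) * complex_of_real (hh n x)) has_vector_derivative f x) (at x)"
        by (rule has_vector_derivative_eq_rhs[OF has_vector_derivative_mult[OF de dh[unfolded eq]]])
          (simp add: f_def algebra_simps diff_divide_distrib)
      show "isCont f x" unfolding f_def by (intro continuous_intros isCont_hh)
    next
      show "integrable lborel f" unfolding f_def
        by (intro integrable_mult_right Bochner_Integration.integrable_diff Bochner_Integration.integrable_add int)
      show "((\<lambda>x. exp (- \<i> * of_real (x * \<xi>)) * complex_of_real (hh n x)) \<longlongrightarrow> 0) at_top"
        by (rule Lim_null_comparison[OF _ tendsto_norm_zero[OF gaussian_poly_tendsto(1)[OF gaussian_poly_hh[of n]]]])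
          (simp add: norm_mult)
      show "((\<lambda>x. exp (- \<i> * of_real (x * \<xi>)) * complex_of_real (hh n x)) \<longlongrightarrow> 0) at_bot"
        by (rule Lim_null_comparison[OF _ tendsto_norm_zero[OF gaussian_poly_tendsto(2)[OF gaussian_poly_hh[of n]]]])
          (simp add: norm_mult)
    qed
    also have "(LINT x|lborel. f x) = - \<i> * of_real \<xi> * J n + of_real (1 / sqrt 2) *
        (of_real (sqrt n) * J (n - 1) - of_real (sqrt (Suc n)) * J (Suc n))"
    proof -
      define E where "E = (\<lambda>n x. exp (- \<i> * of_real (x * \<xi>)) * complex_of_real (hh n x))"
      have intE: "integrable lborel (E n)" for n unfolding E_def by (rule int)
      have JE: "J n = (LINT x|lborel. E n x)" for n by (simp only: J_def E_def)
      have "f x = - \<i> * of_real \<xi> * E n x + of_real (1 / sqrt 2) *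
        (of_real (sqrt n) * E (n - 1) x - of_real (sqrt (Suc n)) * E (Suc n) x)" for x
        by (simp only: f_def E_def)
      then show ?thesis
        unfolding JE by (simp add: intE del: of_nat_Suc)
    qed
    finally show ?thesis
      by (simp add: field_simps del: of_nat_Suc)
  qed
  have J0: "J 0 = of_real (sqrt (2 * pi)) * of_real (hh 0 \<xi>)"
  proof -
    have "char std_normal_distribution (- \<xi>) = (LINT x|lborel. std_normal_density x *\<^sub>R iexp (- \<xi> * x))"
      unfolding char_def by (subst integral_density) auto
    then have e: "(LINT x|lborel. std_normal_density x *\<^sub>R iexp (- \<xi> * x)) = of_real (exp (- \<xi>\<^sup>2 / 2))"
      by (simp add: char_std_normal_distribution)
    have "exp (- \<i> * of_real (x * \<xi>)) * complex_of_real (hh 0 x) =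
        of_real (sqrt (2 * pi) / sqrt (sqrt pi)) * (std_normal_density x *\<^sub>R iexp (- \<xi> * x))" for x
      by (simp add: std_normal_density_def hh_0 scaleR_conv_of_real mult_ac)
    then have "J 0 = of_real (sqrt (2 * pi) / sqrt (sqrt pi)) * (LINT x|lborel. std_normal_density x *\<^sub>R iexp (- \<xi> * x))"
      unfolding J_def by (simp only: integral_mult_right_zero)
    also have "\<dots> = of_real (sqrt (2 * pi)) * of_real (hh 0 \<xi>)"
      unfolding e hh_0 by simp
    finally show ?thesis .
  qed
  have "J n = of_real (sqrt (2 * pi)) * ((- \<i>) ^ n * of_real (hh n \<xi>))" for n
  proof (induction n rule: less_induct)
    case (less n)
    show ?case
    proof (cases n)
      case (Suc m)
      have m: "of_real (sqrt m) * J (m - 1) = of_real (sqrt m) * (of_real (sqrt (2 * pi)) * (\<i> * (- \<i>) ^ m * of_real (hh (m - 1) \<xi>)))"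
        using less.IH[of "m - 1"] Suc by (cases m) simp_all
      have "of_real (sqrt (Suc m)) * J (Suc m) =
        of_real (sqrt (2 * pi)) * (- \<i>) ^ Suc m * (of_real (sqrt 2) * of_real \<xi> * of_real (hh m \<xi>)
           - of_real (sqrt m) * of_real (hh (m - 1) \<xi>))"
        unfolding J_rec m using less.IH[of m] Suc by (simp add: algebra_simps)
      also have "\<dots> = of_real (sqrt (2 * pi)) * (- \<i>) ^ Suc m * (of_real (sqrt (Suc m)) * of_real (hh (Suc m) \<xi>))"
        by (simp only: hermite_rec_hh[of \<xi>, unfolded hermite_rec_def, rule_format])
      finally have "of_real (sqrt (Suc m)) * J (Suc m) =
        of_real (sqrt (Suc m)) * (of_real (sqrt (2 * pi)) * ((- \<i>) ^ Suc m * of_real (hh (Suc m) \<xi>)))"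
        by (simp only: mult_ac)
      then show ?thesis unfolding Suc by (subst (asm) mult_cancel_left) (simp del: of_nat_Suc power_Suc)
    qed (simp add: J0)
  qed
  moreover have "fourier_transform (hermite_fun n) \<xi> = of_real (1 / sqrt (2 * pi)) * J n"
    by (simp only: fourier_transform_def J_def hermite_fun_hh)
  ultimately show ?thesis by (simp add: hermite_fun_hh)
qed

section \<open>Bilinear and trilinear estimates\<close>

abbreviation hhc :: "real \<Rightarrow> nat \<Rightarrow> complex" where
  "hhc x \<equiv> (\<lambda>n. complex_of_real (hh n x))"

lemma expand_rot_hh:
  assumes "c\<^sup>2 + s\<^sup>2 = 1"
  shows "expand N (rot c s N \<alpha>) (hhc (c * x + s * y)) (hhc (s * x - c * y)) =
    expand N \<alpha> (hhc x) (hhc y)"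
proof (rule expand_rot[OF assms hermite_rec_hh hermite_rec_hh])
  show "hermite_rec (of_real c * of_real x + of_real s * of_real y) (hhc (c * x + s * y))"
    "hermite_rec (of_real s * of_real x - of_real c * of_real y) (hhc (s * x - c * y))"
    using hermite_rec_hh[of "c * x + s * y"] hermite_rec_hh[of "s * x - c * y"] by simp_all
  have "(c * x + s * y)\<^sup>2 + (s * x - c * y)\<^sup>2 = (c\<^sup>2 + s\<^sup>2) * (x\<^sup>2 + y\<^sup>2)"
    by (simp add: power2_eq_square algebra_simps)
  then have "exp (- (c * x + s * y)\<^sup>2 / 2) * exp (- (s * x - c * y)\<^sup>2 / 2) = exp (- x\<^sup>2 / 2) * exp (- y\<^sup>2 / 2)"
    using assms unfolding mult_exp_exp by (intro arg_cong[of _ _ exp]) simp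
  then have "hh 0 (c * x + s * y) * hh 0 (s * x - c * y) = hh 0 x * hh 0 y"
    by (simp add: hh_0)
  then show "hhc (c * x + s * y) 0 * hhc (s * x - c * y) 0 = hhc x 0 * hhc y 0"
    by (simp flip: of_real_mult)
qed

lemma integral_hh_sum_sq_real:
  fixes r :: "nat \<Rightarrow> real"
  assumes "finite A"
  shows "integrable lborel (\<lambda>x. (\<Sum>j\<in>A. r j * hh j x)\<^sup>2)"
    and "(LINT x|lborel. (\<Sum>j\<in>A. r j * hh j x)\<^sup>2) = (\<Sum>j\<in>A. (r j)\<^sup>2)"
proof -
  have e: "(\<lambda>x. (\<Sum>j\<in>A. r j * hh j x)\<^sup>2) = (\<lambda>x. \<Sum>i\<in>A. \<Sum>j\<in>A. r i * r j * (hh i x * hh j x))"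
    by (simp add: power2_eq_square sum_product mult_ac)
  show "integrable lborel (\<lambda>x. (\<Sum>j\<in>A. r j * hh j x)\<^sup>2)"
    unfolding e by (intro Bochner_Integration.integrable_sum integrable_mult_right integrable_hh2)
  have "(LINT x|lborel. (\<Sum>j\<in>A. r j * hh j x)\<^sup>2) = (\<Sum>i\<in>A. \<Sum>j\<in>A. r i * r j * (if i = j then 1 else 0))"
    unfolding e hh_orthonormal[symmetric]
    by (simp add: Bochner_Integration.integral_sum Bochner_Integration.integrable_sum integrable_hh2)
  also have "\<dots> = (\<Sum>j\<in>A. (r j)\<^sup>2)"
    using assms by (simp add: power2_eq_square if_distrib[of "\<lambda>x. _ * x"] cong: if_cong)
  finally show "(LINT x|lborel. (\<Sum>j\<in>A. r j * hh j x)\<^sup>2) = (\<Sum>j\<in>A. (r j)\<^sup>2)" .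
qed

lemma integral_hh_sum_sq:
  fixes \<gamma> :: "nat \<Rightarrow> complex"
  assumes "finite A"
  shows "integrable lborel (\<lambda>x. (norm (\<Sum>j\<in>A. \<gamma> j * of_real (hh j x)))\<^sup>2)"
    and "(LINT x|lborel. (norm (\<Sum>j\<in>A. \<gamma> j * of_real (hh j x)))\<^sup>2) = (\<Sum>j\<in>A. (norm (\<gamma> j))\<^sup>2)"
proof -
  have e: "(\<lambda>x. (norm (\<Sum>j\<in>A. \<gamma> j * of_real (hh j x)))\<^sup>2) =
      (\<lambda>x. (\<Sum>j\<in>A. Re (\<gamma> j) * hh j x)\<^sup>2 + (\<Sum>j\<in>A. Im (\<gamma> j) * hh j x)\<^sup>2)"
    by (simp add: cmod_power2)
  show "integrable lborel (\<lambda>x. (norm (\<Sum>j\<in>A. \<gamma> j * of_real (hh j x)))\<^sup>2)"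
    unfolding e by (intro Bochner_Integration.integrable_add integral_hh_sum_sq_real assms)
  show "(LINT x|lborel. (norm (\<Sum>j\<in>A. \<gamma> j * of_real (hh j x)))\<^sup>2) = (\<Sum>j\<in>A. (norm (\<gamma> j))\<^sup>2)"
    unfolding e
    by (subst Bochner_Integration.integral_add)
      (simp_all add: integral_hh_sum_sq_real[OF assms] cmod_power2 sum.distrib)
qed

text \<open>The dilations that occur are sqrt 2 and sqrt 3, the lengths of (1, 1) and (1, 1, 1);
  dilating by a factor at least 1 can only decrease the integral.\<close>

lemma integral_hh_sum_sq_scaled:
  fixes \<gamma> :: "nat \<Rightarrow> complex"
  assumes "finite A" "1 \<le> l"
  shows "integrable lborel (\<lambda>x. (norm (\<Sum>j\<in>A. \<gamma> j * of_real (hh j (l * x))))\<^sup>2)"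
    and "(LINT x|lborel. (norm (\<Sum>j\<in>A. \<gamma> j * of_real (hh j (l * x))))\<^sup>2) \<le> (\<Sum>j\<in>A. (norm (\<gamma> j))\<^sup>2)"
proof -
  define f where "f = (\<lambda>x. (norm (\<Sum>j\<in>A. \<gamma> j * of_real (hh j x)))\<^sup>2)"
  have l: "l \<noteq> 0" using assms by simp
  show "integrable lborel (\<lambda>x. (norm (\<Sum>j\<in>A. \<gamma> j * of_real (hh j (l * x))))\<^sup>2)"
    using lborel_integrable_real_affine[of f l 0] integral_hh_sum_sq(1)[OF assms(1), of \<gamma>] l
    by (simp add: f_def)
  have "(\<Sum>j\<in>A. (norm (\<gamma> j))\<^sup>2) = \<bar>l\<bar> *\<^sub>R (LINT x|lborel. f (0 + l * x))"
    using lborel_integral_real_affine[OF l, of f 0] integral_hh_sum_sq(2)[OF assms(1), of \<gamma>]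
    by (simp add: f_def)
  then have "(\<Sum>j\<in>A. (norm (\<gamma> j))\<^sup>2) = l * (LINT x|lborel. f (l * x))" using assms by simp
  moreover have "1 * (LINT x|lborel. f (l * x)) \<le> l * (LINT x|lborel. f (l * x))"
    using assms by (intro mult_right_mono integral_nonneg_AE) (auto simp: f_def)
  ultimately show "(LINT x|lborel. (norm (\<Sum>j\<in>A. \<gamma> j * of_real (hh j (l * x))))\<^sup>2) \<le> (\<Sum>j\<in>A. (norm (\<gamma> j))\<^sup>2)"
    by (simp add: f_def)
qed

text \<open>The change of variables takes (t, t) to (sqrt 2 t, 0). What remains is a one-variable
  Hermite sum whose coefficients are damped by h_j(0); orthonormality and h_j(0)^2 \<le> 1 bound it
  by the rotated energy, which equals the original one.\<close>

lemma bilinear_bound: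
  shows "integrable lborel (\<lambda>t. (norm (expand N \<alpha> (hhc t) (hhc t)))\<^sup>2)"
    and "(LINT t|lborel. (norm (expand N \<alpha> (hhc t) (hhc t)))\<^sup>2) \<le> degree_energy N \<alpha>"
proof -
  define c where "c = 1 / sqrt (2::real)"
  define \<beta> where "\<beta> = rot c c N \<alpha>"
  have c: "c\<^sup>2 + c\<^sup>2 = 1" by (simp add: c_def power_divide)
  have "c * t + c * t = sqrt 2 * t" for t
  proof -
    have "c * t + c * t = (2 / sqrt 2) * t" by (simp add: c_def)
    also have "2 / sqrt 2 = sqrt (2::real)" by (rule real_div_sqrt) simp
    finally show ?thesis .
  qed
  then have "expand N \<beta> (hhc (sqrt 2 * t)) (hhc 0) = expand N \<alpha> (hhc t) (hhc t)" for t
    using expand_rot_hh[OF c, of N \<alpha> t t] by (simp only: diff_self \<beta>_def)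
  then have e: "expand N \<alpha> (hhc t) (hhc t) =
      (\<Sum>a\<le>N. \<beta> a (N - a) * of_real (hh (N - a) 0) * of_real (hh a (sqrt 2 * t)))" for t
    by (simp only: expand_def mult_ac)
  show "integrable lborel (\<lambda>t. (norm (expand N \<alpha> (hhc t) (hhc t)))\<^sup>2)"
    unfolding e by (rule integral_hh_sum_sq_scaled) auto
  have "(LINT t|lborel. (norm (expand N \<alpha> (hhc t) (hhc t)))\<^sup>2) \<le>
      (\<Sum>a\<le>N. (norm (\<beta> a (N - a) * of_real (hh (N - a) 0)))\<^sup>2)"
    unfolding e by (rule integral_hh_sum_sq_scaled) auto
  also have "\<dots> \<le> (\<Sum>a\<le>N. (norm (\<beta> a (N - a)))\<^sup>2 * 1)"
    unfolding norm_mult power_mult_distrib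
    by (intro sum_mono mult_left_mono) (auto intro: hh_zero_sq_le_1)
  also have "\<dots> = degree_energy N \<alpha>"
    unfolding \<beta>_def using degree_energy_rot[OF c, of N \<alpha>] by (simp add: degree_energy_def)
  finally show "(LINT t|lborel. (norm (expand N \<alpha> (hhc t) (hhc t)))\<^sup>2) \<le> degree_energy N \<alpha>" .
qed

section \<open>Sums over triangles and the trilinear estimate\<close>

lemma sum_triangle_swap:
  fixes F :: "nat \<Rightarrow> nat \<Rightarrow> 'a::comm_monoid_add"
  shows "(\<Sum>k\<le>N. \<Sum>l\<le>N - k. F k l) = (\<Sum>l\<le>N. \<Sum>k\<le>N - l. F k l)"
  unfolding sum.Sigma[OF finite_atMost ballI[OF finite_atMost]]
  by (rule sum.reindex_bij_witness[where i = "\<lambda>(a, b). (b, a)" and j = "\<lambda>(a, b). (b, a)"]) auto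

lemma sum_triangle_rotate:
  fixes F :: "nat \<Rightarrow> nat \<Rightarrow> 'a::comm_monoid_add"
  shows "(\<Sum>k\<le>N. \<Sum>l\<le>N - k. F k l) = (\<Sum>m\<le>N. \<Sum>l\<le>N - m. F (N - m - l) l)"
  unfolding sum.Sigma[OF finite_atMost ballI[OF finite_atMost]]
  by (rule sum.reindex_bij_witness[where i = "\<lambda>(m, l). (N - m - l, l)" and j = "\<lambda>(k, l). (N - k - l, l)"]) auto

lemma norm_sum_mult_sq_le:
  fixes a z :: "'i \<Rightarrow> complex"
  shows "(norm (\<Sum>i\<in>A. a i * z i))\<^sup>2 \<le> (\<Sum>i\<in>A. (norm (a i))\<^sup>2) * (\<Sum>i\<in>A. (norm (z i))\<^sup>2)"
proof -
  have "norm (\<Sum>i\<in>A. a i * z i) \<le> (\<Sum>i\<in>A. norm (a i) * norm (z i))"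
    by (rule sum_norm_le) (simp add: norm_mult)
  then have "(norm (\<Sum>i\<in>A. a i * z i))\<^sup>2 \<le> (\<Sum>i\<in>A. norm (a i) * norm (z i))\<^sup>2"
    by (intro power_mono) auto
  also have "\<dots> \<le> (\<Sum>i\<in>A. (norm (a i))\<^sup>2) * (\<Sum>i\<in>A. (norm (z i))\<^sup>2)"
    by (rule Cauchy_Schwarz_ineq_sum)
  finally show ?thesis .
qed

text \<open>Two successive rotations turn the restriction to the diagonal of \<open>\<real>\<^sup>3\<close> into evaluation of two
  of the three coordinates at \<open>0\<close>.\<close>

lemma trilinear_bound:
  fixes \<alpha> :: "nat \<Rightarrow> nat \<Rightarrow> nat \<Rightarrow> complex" and N :: nat
  defines "g \<equiv> (\<lambda>t. \<Sum>k\<le>N. expand (N - k) (\<lambda>a b. \<alpha> a b k) (hhc t) (hhc t) * hhc t k)"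
  shows "integrable lborel (\<lambda>t. (norm (g t))\<^sup>2)"
    and "(LINT t|lborel. (norm (g t))\<^sup>2) \<le> (\<Sum>k\<le>N. degree_energy (N - k) (\<lambda>a b. \<alpha> a b k))"
proof -
  define c where "c = 1 / sqrt (2::real)"
  have c: "c\<^sup>2 + c\<^sup>2 = 1" by (simp add: c_def power_divide)
  have ct: "c * t + c * t = sqrt 2 * t" for t
  proof -
    have "c * t + c * t = (2 / sqrt 2) * t" by (simp add: c_def)
    also have "2 / sqrt 2 = sqrt (2::real)" by (rule real_div_sqrt) simp
    finally show ?thesis .
  qed
  \<comment> \<open>Coefficients of the second rotation, which takes (sqrt 2 t, t) to (sqrt 3 t,
    0).\<close>
  define p q where "p = sqrt 2 / sqrt (3::real)" and "q = 1 / sqrt (3::real)"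
  have pq: "p\<^sup>2 + q\<^sup>2 = 1" by (simp add: p_def q_def power_divide)
  have pqt: "p * (sqrt 2 * t) + q * t = sqrt 3 * t" "q * (sqrt 2 * t) - p * t = 0" for t
  proof -
    have "p * (sqrt 2 * t) + q * t = (sqrt 2 * sqrt 2 + 1) / sqrt 3 * t"
      unfolding p_def q_def by (simp add: field_simps del: real_sqrt_mult_self)
    also have "(sqrt 2 * sqrt 2 + 1) / sqrt 3 = 3 / sqrt (3::real)" by simp
    also have "3 / sqrt 3 = sqrt (3::real)" by (rule real_div_sqrt) simp
    finally show "p * (sqrt 2 * t) + q * t = sqrt 3 * t" .
  qed (simp add: p_def q_def)
  define \<beta> where "\<beta> = (\<lambda>k. rot c c (N - k) (\<lambda>a b. \<alpha> a b k))"
  \<comment> \<open>Regroups by the degree m in the coordinate that the first rotation has set to 0,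
    so that the second rotation acts on the remaining pair.\<close>
  define \<gamma> where "\<gamma> = (\<lambda>m l k. \<beta> k l m)"
  define \<delta> where "\<delta> = (\<lambda>m. rot p q (N - m) (\<gamma> m))"
  define \<epsilon> where "\<epsilon> = (\<lambda>j. \<Sum>m\<le>N - j. \<delta> m j (N - m - j) * (of_real (hh m 0) * of_real (hh (N - j - m) 0)))"
  have "g t = (\<Sum>j\<le>N. \<epsilon> j * of_real (hh j (sqrt 3 * t)))" for t
  proof -
    have "g t = (\<Sum>k\<le>N. \<Sum>l\<le>N - k. \<beta> k l (N - k - l) * hhc (sqrt 2 * t) l * hhc 0 (N - k - l) * hhc t k)"
    proof -
      have "expand M (rot c c M \<alpha>') (hhc (sqrt 2 * t)) (hhc 0) = expand M \<alpha>' (hhc t) (hhc t)" for M \<alpha>'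
        using expand_rot_hh[OF c, of M \<alpha>' t t] by (simp only: diff_self ct)
      then have "g t = (\<Sum>k\<le>N. expand (N - k) (\<beta> k) (hhc (sqrt 2 * t)) (hhc 0) * hhc t k)"
        by (simp only: g_def \<beta>_def)
      then show ?thesis by (simp only: expand_def sum_distrib_right)
    qed
    also have "\<dots> = (\<Sum>m\<le>N. \<Sum>l\<le>N - m. \<gamma> m l (N - m - l) * hhc (sqrt 2 * t) l * hhc 0 m * hhc t (N - m - l))"
      unfolding \<gamma>_def
      by (subst sum_triangle_rotate) (auto intro!: sum.cong simp: diff_diff_cancel diff_right_commute)
    also have "\<dots> = (\<Sum>m\<le>N. expand (N - m) (\<gamma> m) (hhc (sqrt 2 * t)) (hhc t) * hhc 0 m)"
      by (simp only: expand_def sum_distrib_right) (simp add: mult_ac)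
    also have "\<dots> = (\<Sum>m\<le>N. expand (N - m) (\<delta> m) (hhc (sqrt 3 * t)) (hhc 0) * hhc 0 m)"
      using expand_rot_hh[OF pq, of _ _ "sqrt 2 * t" t] unfolding \<delta>_def pqt by simp
    also have "\<dots> = (\<Sum>m\<le>N. \<Sum>j\<le>N - m. \<delta> m j (N - m - j) * (hhc 0 m * hhc 0 (N - j - m)) * hhc (sqrt 3 * t) j)"
      by (simp only: expand_def sum_distrib_right) (simp add: mult_ac add.commute)
    also have "\<dots> = (\<Sum>j\<le>N. \<epsilon> j * of_real (hh j (sqrt 3 * t)))"
      by (subst sum_triangle_swap) (simp add: \<epsilon>_def sum_distrib_right)
    finally show ?thesis .
  qed
  note g = this
  show "integrable lborel (\<lambda>t. (norm (g t))\<^sup>2)"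
    unfolding g by (rule integral_hh_sum_sq_scaled) auto
  have "(LINT t|lborel. (norm (g t))\<^sup>2) \<le> (\<Sum>j\<le>N. (norm (\<epsilon> j))\<^sup>2)"
    unfolding g by (rule integral_hh_sum_sq_scaled) auto
  also have "\<dots> \<le> (\<Sum>j\<le>N. \<Sum>m\<le>N - j. (norm (\<delta> m j (N - m - j)))\<^sup>2)"
  proof (rule sum_mono)
    fix j
    have "(norm (\<epsilon> j))\<^sup>2 \<le> (\<Sum>m\<le>N - j. (norm (\<delta> m j (N - m - j)))\<^sup>2) *
        (\<Sum>m\<le>N - j. (norm (complex_of_real (hh m 0) * of_real (hh (N - j - m) 0)))\<^sup>2)"
      unfolding \<epsilon>_def by (rule norm_sum_mult_sq_le)
    \<comment> \<open>Two coordinates at 0 leave a convolution of the squares h_m(0)^2; its bound,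
      uniform in the degree, is what gives the trilinear estimate the constant 1.\<close>
    also have "(\<Sum>m\<le>N - j. (norm (complex_of_real (hh m 0) * of_real (hh (N - j - m) 0)))\<^sup>2) \<le> 1"
      using hh_zero_convolution[of "N - j"] by (simp add: norm_mult power_mult_distrib)
    finally show "(norm (\<epsilon> j))\<^sup>2 \<le> (\<Sum>m\<le>N - j. (norm (\<delta> m j (N - m - j)))\<^sup>2)"
      by (simp add: mult_left_mono sum_nonneg)
  qed
  also have "\<dots> = (\<Sum>m\<le>N. degree_energy (N - m) (\<delta> m))"
    by (subst sum_triangle_swap) (simp add: degree_energy_def)
  also have "\<dots> = (\<Sum>m\<le>N. degree_energy (N - m) (\<gamma> m))"
    unfolding \<delta>_def by (simp add: degree_energy_rot[OF pq])
  also have "\<dots> = (\<Sum>k\<le>N. degree_energy (N - k) (\<beta> k))"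
    unfolding degree_energy_def \<gamma>_def by (subst sum_triangle_rotate) (auto intro!: sum.cong)
  also have "\<dots> = (\<Sum>k\<le>N. degree_energy (N - k) (\<lambda>a b. \<alpha> a b k))"
    unfolding \<beta>_def by (simp add: degree_energy_rot[OF c])
  finally show "(LINT t|lborel. (norm (g t))\<^sup>2) \<le> (\<Sum>k\<le>N. degree_energy (N - k) (\<lambda>a b. \<alpha> a b k))" .
qed

lemma integral_Cauchy_Schwarz:
  fixes f g :: "'a \<Rightarrow> complex"
  assumes [measurable]: "f \<in> borel_measurable M" "g \<in> borel_measurable M"
    and f: "integrable M (\<lambda>x. (norm (f x))\<^sup>2)" and g: "integrable M (\<lambda>x. (norm (g x))\<^sup>2)"
  shows "integrable M (\<lambda>x. f x * g x)"
    and "(LINT x|M. norm (f x) * norm (g x)) \<le>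
      sqrt (LINT x|M. (norm (f x))\<^sup>2) * sqrt (LINT x|M. (norm (g x))\<^sup>2)"
    and "norm (LINT x|M. f x * g x) \<le>
      sqrt (LINT x|M. (norm (f x))\<^sup>2) * sqrt (LINT x|M. (norm (g x))\<^sup>2)"
proof -
  have amgm: "2 * (norm (f x) * norm (g x)) \<le> (norm (f x))\<^sup>2 + (norm (g x))\<^sup>2" for x
    using sum_squares_bound[of "norm (f x)" "norm (g x)"] by (simp add: mult_ac)
  have int: "integrable M (\<lambda>x. norm (f x) * norm (g x))"
  proof (rule Bochner_Integration.integrable_bound[OF Bochner_Integration.integrable_add[OF f g]])
    show "AE x in M. norm (norm (f x) * norm (g x)) \<le> norm ((norm (f x))\<^sup>2 + (norm (g x))\<^sup>2)"
    proof (rule AE_I2)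
      fix x show "norm (norm (f x) * norm (g x)) \<le> norm ((norm (f x))\<^sup>2 + (norm (g x))\<^sup>2)"
        using amgm[of x] mult_nonneg_nonneg[of "norm (f x)" "norm (g x)"] by (simp del: mult_nonneg_nonneg)
    qed
  qed measurable
  then have "integrable M (\<lambda>x. norm (f x * g x))" by (simp add: norm_mult)
  then show "integrable M (\<lambda>x. f x * g x)" by (subst integrable_norm_iff[symmetric]) auto
  define F G C where "F = (LINT x|M. (norm (f x))\<^sup>2)" and "G = (LINT x|M. (norm (g x))\<^sup>2)"
    and "C = (LINT x|M. norm (f x) * norm (g x))"
  have nonneg: "0 \<le> F" "0 \<le> G" "0 \<le> C" unfolding F_def G_def C_def by (auto intro!: integral_nonneg_AE)
  have quad: "2 * t * C \<le> F + t\<^sup>2 * G" for t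
  proof -
    have "(LINT x|M. 2 * t * (norm (f x) * norm (g x))) \<le> (LINT x|M. (norm (f x))\<^sup>2 + t\<^sup>2 * (norm (g x))\<^sup>2)"
    proof (intro integral_mono integrable_mult_right Bochner_Integration.integrable_add f g int)
      fix x
      show "2 * t * (norm (f x) * norm (g x)) \<le> (norm (f x))\<^sup>2 + t\<^sup>2 * (norm (g x))\<^sup>2"
        using sum_squares_bound[of "norm (f x)" "t * norm (g x)"] by (simp add: power_mult_distrib mult_ac)
    qed
    then show ?thesis by (simp add: F_def G_def C_def f g)
  qed
  have "C\<^sup>2 \<le> F * G"
  proof (cases "G = 0")
    case True
    have "C = 0"
    proof (rule ccontr)
      assume "C \<noteq> 0"
      then have "C > 0" using nonneg by simp
      have "2 * ((F + 1) / C) * C \<le> F" using quad[of "(F + 1) / C"] True by simp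
      then show False using \<open>C > 0\<close> nonneg by simp
    qed
    then show ?thesis using True by simp
  next
    case False
    then have "G > 0" using nonneg by simp
    then show ?thesis using quad[of "C / G"] by (simp add: field_simps power2_eq_square)
  qed
  then have "C \<le> sqrt (F * G)" by (rule real_le_rsqrt)
  then show 1: "(LINT x|M. norm (f x) * norm (g x)) \<le>
      sqrt (LINT x|M. (norm (f x))\<^sup>2) * sqrt (LINT x|M. (norm (g x))\<^sup>2)"
    by (simp add: C_def F_def G_def real_sqrt_mult)
  have "norm (LINT x|M. f x * g x) \<le> (LINT x|M. norm (f x) * norm (g x))"
    using integral_norm_bound[of M "\<lambda>x. f x * g x"] by (simp add: norm_mult)
  with 1 show "norm (LINT x|M. f x * g x) \<le>
      sqrt (LINT x|M. (norm (f x))\<^sup>2) * sqrt (LINT x|M. (norm (g x))\<^sup>2)" by linarith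
qed

text \<open>The last antidiagonal that meets the A by B rectangle has index A + B - 2, which must
  lie below M.\<close>

lemma sum_triangle_rectangle:
  fixes F :: "nat \<Rightarrow> nat \<Rightarrow> 'a::comm_monoid_add"
  assumes "\<And>a b. A \<le> a \<or> B \<le> b \<Longrightarrow> F a b = 0" "A + B \<le> M + 1"
  shows "(\<Sum>N<M. \<Sum>a\<le>N. F a (N - a)) = (\<Sum>a<A. \<Sum>b<B. F a b)"
proof -
  have "(\<Sum>N<M. \<Sum>a\<le>N. F a (N - a)) = (\<Sum>(a, b)\<in>{(a, b). a + b < M}. F a b)"
    by (rule sum.triangle_reindex[symmetric])
  also have "\<dots> = (\<Sum>(a, b)\<in>{..<A} \<times> {..<B}. F a b)"
  proof (rule sum.mono_neutral_right)
    have "{(a, b). a + b < M} \<subseteq> {..<M} \<times> {..<M}" by auto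
    then show "finite {(a, b). a + b < M}" by (rule finite_subset) auto
    show "{..<A} \<times> {..<B} \<subseteq> {(a, b). a + b < M}" using assms(2) by auto
    show "\<forall>i\<in>{(a, b). a + b < M} - {..<A} \<times> {..<B}. (case i of (a, b) \<Rightarrow> F a b) = 0"
    proof
      fix i assume i: "i \<in> {(a, b). a + b < M} - {..<A} \<times> {..<B}"
      have "A \<le> fst i \<or> B \<le> snd i" using i by (cases i) (auto simp: not_less[symmetric])
      then show "(case i of (a, b) \<Rightarrow> F a b) = 0" using assms(1) by (cases i) simp
    qed
  qed
  also have "\<dots> = (\<Sum>a<A. \<Sum>b<B. F a b)" by (simp add: sum.cartesian_product)
  finally show ?thesis .
qed

section \<open>The resonant system\<close>

text \<open>A bound instead of a norm: it carries its own finiteness, can be added and scaled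
  without summability conditions, and survives pointwise limits (\<open>ell2_limit\<close>).\<close>

definition ell2 :: "real \<Rightarrow> (nat \<Rightarrow> complex) \<Rightarrow> bool" where
  "ell2 M x \<longleftrightarrow> 0 \<le> M \<and> (\<forall>R. (\<Sum>n<R. (norm (x n))\<^sup>2) \<le> M\<^sup>2)"

lemma ell2_L2_set: "ell2 M x \<longleftrightarrow> 0 \<le> M \<and> (\<forall>R. L2_set (\<lambda>n. norm (x n)) {..<R} \<le> M)"
proof -
  have "(\<Sum>n<R. (norm (x n))\<^sup>2) \<le> M\<^sup>2 \<longleftrightarrow> L2_set (\<lambda>n. norm (x n)) {..<R} \<le> M" if "0 \<le> M" for R
    unfolding L2_set_def using that real_sqrt_le_iff[of "\<Sum>n<R. (norm (x n))\<^sup>2" "M\<^sup>2"] by simp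
  then show ?thesis unfolding ell2_def by blast
qed

lemma ell2_add:
  assumes "ell2 M x" "ell2 M' y"
  shows "ell2 (M + M') (\<lambda>n. x n + y n)"
  unfolding ell2_L2_set
proof (intro conjI allI)
  show "0 \<le> M + M'" using assms by (simp add: ell2_def)
  fix R
  have "L2_set (\<lambda>n. norm (x n + y n)) {..<R} \<le> L2_set (\<lambda>n. norm (x n) + norm (y n)) {..<R}"
    by (intro L2_set_mono norm_triangle_ineq) auto
  also have "\<dots> \<le> L2_set (\<lambda>n. norm (x n)) {..<R} + L2_set (\<lambda>n. norm (y n)) {..<R}"
    by (rule L2_set_triangle_ineq)
  also have "\<dots> \<le> M + M'" using assms unfolding ell2_L2_set by (intro add_mono) auto
  finally show "L2_set (\<lambda>n. norm (x n + y n)) {..<R} \<le> M + M'" .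
qed

lemma ell2_mono:
  assumes "ell2 M x" "\<And>n. norm (y n) \<le> norm (x n)" "M \<le> M'"
  shows "ell2 M' y"
  unfolding ell2_def
proof (intro conjI allI)
  show "0 \<le> M'" using assms by (simp add: ell2_def)
  fix R
  have "(\<Sum>n<R. (norm (y n))\<^sup>2) \<le> (\<Sum>n<R. (norm (x n))\<^sup>2)"
    by (intro sum_mono power_mono assms) auto
  also have "\<dots> \<le> M\<^sup>2" using assms by (simp add: ell2_def)
  also have "\<dots> \<le> M'\<^sup>2" using assms by (intro power_mono) (auto simp: ell2_def)
  finally show "(\<Sum>n<R. (norm (y n))\<^sup>2) \<le> M'\<^sup>2" .
qed

lemma ell2_scale:
  assumes "ell2 M x"
  shows "ell2 (norm u * M) (\<lambda>n. u * x n)"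
  using assms unfolding ell2_def
  by (auto simp: norm_mult power_mult_distrib sum_distrib_left[symmetric] intro!: mult_left_mono)

lemma ell2_component:
  assumes "ell2 M x"
  shows "norm (x n) \<le> M"
proof -
  have "(norm (x n))\<^sup>2 \<le> (\<Sum>n<Suc n. (norm (x n))\<^sup>2)" by (simp add: sum_nonneg)
  also have "\<dots> \<le> M\<^sup>2" using assms unfolding ell2_def by blast
  finally show ?thesis
    by (rule power2_le_imp_le) (use assms in \<open>simp add: ell2_def\<close>)
qed

lemma ell2_limit:
  assumes "\<And>n. (\<lambda>j. x j n) \<longlonglongrightarrow> y n" "\<forall>\<^sub>F j in sequentially. ell2 M (x j)"
  shows "ell2 M y"
  unfolding ell2_def
proof (intro conjI allI)
  obtain j where "ell2 M (x j)" using eventually_happens[OF assms(2)] by auto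
  then show "0 \<le> M" by (simp add: ell2_def)
  fix R
  have "(\<lambda>j. \<Sum>n<R. (norm (x j n))\<^sup>2) \<longlonglongrightarrow> (\<Sum>n<R. (norm (y n))\<^sup>2)"
    by (intro tendsto_sum tendsto_power tendsto_norm assms(1))
  moreover have "\<forall>\<^sub>F j in sequentially. (\<Sum>n<R. (norm (x j n))\<^sup>2) \<le> M\<^sup>2"
    using assms(2) by (rule eventually_mono) (simp add: ell2_def)
  ultimately show "(\<Sum>n<R. (norm (y n))\<^sup>2) \<le> M\<^sup>2"
    by (rule tendsto_upperbound) simp
qed

section \<open>Products of two Hermite series by degree, and the resonant cubic form\<close>

definition pair_prod :: "nat \<Rightarrow> (nat \<Rightarrow> complex) \<Rightarrow> (nat \<Rightarrow> complex) \<Rightarrow> real \<Rightarrow> complex" where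
  "pair_prod N x y t = expand N (\<lambda>a b. x a * y b) (hhc t) (hhc t)"

definition pair_mass :: "nat \<Rightarrow> (nat \<Rightarrow> complex) \<Rightarrow> (nat \<Rightarrow> complex) \<Rightarrow> real" where
  "pair_mass N x y = degree_energy N (\<lambda>a b. x a * y b)"

definition quartic :: "nat \<Rightarrow> nat \<Rightarrow> nat \<Rightarrow> nat \<Rightarrow> real" where
  "quartic a b c d = (LINT x|lborel. hh a x * hh b x * (hh c x * hh d x))"

text \<open>\<open>pair_prod N x y\<close> is the part of degree N in the product of two Hermite
  series, and \<open>pair_mass N x y\<close> its mass before restriction to the diagonal. The
  constant 1 is always admissible by \<open>bilinear_bound\<close>; small constants come from
  \<open>pair_bound_low\<close>.\<close>

definition pair_bound :: "real \<Rightarrow> nat \<Rightarrow> (nat \<Rightarrow> complex) \<Rightarrow> (nat \<Rightarrow> complex) \<Rightarrow> bool" where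
  "pair_bound \<kappa> K x y \<longleftrightarrow> (\<forall>N\<ge>K. (LINT t|lborel. (norm (pair_prod N x y t))\<^sup>2) \<le> \<kappa> * pair_mass N x y)"

lemma pair_prod_sq_integrable: "integrable lborel (\<lambda>t. (norm (pair_prod N x y t))\<^sup>2)"
  unfolding pair_prod_def by (rule bilinear_bound)

lemma pair_prod_measurable [measurable]: "pair_prod N x y \<in> borel_measurable borel"
  unfolding pair_prod_def[abs_def] expand_def
  by (intro borel_measurable_continuous_onI continuous_intros isCont_hh)

lemma pair_bound_1: "pair_bound 1 K x y"
  unfolding pair_bound_def pair_prod_def pair_mass_def using bilinear_bound(2) by simp

lemma pair_prod_swap: "pair_prod N x y t = pair_prod N y x t"
  unfolding pair_prod_def by (subst expand_swap[symmetric]) (simp add: expand_def mult_ac)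

lemma pair_mass_swap: "pair_mass N x y = pair_mass N y x"
  unfolding pair_mass_def degree_energy_def
  by (rule sum.reindex_bij_witness[where i = "\<lambda>a. N - a" and j = "\<lambda>a. N - a"]) (auto simp: mult_ac)

lemma pair_bound_swap: "pair_bound \<kappa> K x y \<Longrightarrow> pair_bound \<kappa> K y x"
  unfolding pair_bound_def using pair_prod_swap[of _ x y] pair_mass_swap[of _ x y] by simp

lemma pair_mass_nonneg: "0 \<le> pair_mass N x y"
  by (simp add: pair_mass_def degree_energy_def sum_nonneg)

lemma sum_pair_mass_le:
  assumes "ell2 X x" "ell2 Y y"
  shows "(\<Sum>N<M. pair_mass N x y) \<le> X\<^sup>2 * Y\<^sup>2"
proof -
  have "(\<Sum>N<M. pair_mass N x y) = (\<Sum>N<M. \<Sum>a\<le>N. (norm (x a))\<^sup>2 * (norm (y (N - a)))\<^sup>2)"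
    by (simp add: pair_mass_def degree_energy_def norm_mult power_mult_distrib)
  also have "\<dots> = (\<Sum>(a, b)\<in>{(a, b). a + b < M}. (norm (x a))\<^sup>2 * (norm (y b))\<^sup>2)"
    by (rule sum.triangle_reindex[symmetric])
  also have "\<dots> \<le> (\<Sum>(a, b)\<in>{..<M} \<times> {..<M}. (norm (x a))\<^sup>2 * (norm (y b))\<^sup>2)"
    by (rule sum_mono2) auto
  also have "\<dots> = (\<Sum>a<M. (norm (x a))\<^sup>2) * (\<Sum>b<M. (norm (y b))\<^sup>2)"
    by (simp add: sum_product sum.cartesian_product)
  also have "\<dots> \<le> X\<^sup>2 * Y\<^sup>2"
    using assms by (intro mult_mono) (auto simp: ell2_def sum_nonneg)
  finally show ?thesis .
qed

text \<open>The resonant interactions a + b = n + c. The cutoff R acts on the conjugated index,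
  which already makes the whole sum finite for arbitrary sequences.\<close>

definition cubic :: "nat \<Rightarrow> (nat \<Rightarrow> complex) \<Rightarrow> (nat \<Rightarrow> complex) \<Rightarrow> (nat \<Rightarrow> complex) \<Rightarrow> nat \<Rightarrow> complex" where
  "cubic R x y z n = (\<Sum>c<R. \<Sum>a\<le>n + c. x a * y (n + c - a) * cnj (z c) * of_real (quartic a (n + c - a) c n))"

definition cubic_high :: "nat \<Rightarrow> nat \<Rightarrow> (nat \<Rightarrow> complex) \<Rightarrow> (nat \<Rightarrow> complex) \<Rightarrow> (nat \<Rightarrow> complex) \<Rightarrow> nat \<Rightarrow> complex" where
  "cubic_high K R x y z n = (if n < K then 0 else cubic R x y z n)"

lemma pair_prod_integral:
  "(LINT t|lborel. pair_prod N x y t * pair_prod N z w t) =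
    (\<Sum>c\<le>N. \<Sum>a\<le>N. x a * y (N - a) * z c * w (N - c) * of_real (quartic a (N - a) c (N - c)))"
proof -
  have int: "integrable lborel (\<lambda>t. complex_of_real (hh a t * hh b t * (hh c t * hh d t)))" for a b c d
    using integrable_hh4[of a b c d] by (rule integrable_of_real)
  have "(\<lambda>t. pair_prod N x y t * pair_prod N z w t) =
     (\<lambda>t. \<Sum>c\<le>N. \<Sum>a\<le>N. x a * y (N - a) * z c * w (N - c) *
         complex_of_real (hh a t * hh (N - a) t * (hh c t * hh (N - c) t)))"
  proof
    fix t
    have "pair_prod N x y t * pair_prod N z w t = pair_prod N z w t * pair_prod N x y t"
      by (rule mult.commute)
    then show "pair_prod N x y t * pair_prod N z w t = (\<Sum>c\<le>N. \<Sum>a\<le>N. x a * y (N - a) * z c * w (N - c) *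
         complex_of_real (hh a t * hh (N - a) t * (hh c t * hh (N - c) t)))"
      unfolding pair_prod_def expand_def sum_product by (simp add: mult_ac)
  qed
  then have "(LINT t|lborel. pair_prod N x y t * pair_prod N z w t) =
    (\<Sum>c\<le>N. \<Sum>a\<le>N. x a * y (N - a) * z c * w (N - c) *
         (LINT t|lborel. complex_of_real (hh a t * hh (N - a) t * (hh c t * hh (N - c) t))))"
    using int by (simp only: Bochner_Integration.integral_sum Bochner_Integration.integrable_sum
        integrable_mult_right integral_mult_right_zero)
  then show ?thesis by (simp only: integral_complex_of_real quartic_def)
qed

text \<open>Paired with w, the resonance a + b = c + n says that both pairs have the same degree N.
  The quadrilinear form is therefore a sum over N of integrals of two products of equal degree, open
  to Cauchy-Schwarz.\<close>

lemma cubic_dual: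
  assumes w: "\<And>n. R' \<le> n \<Longrightarrow> w n = 0"
  shows "(\<Sum>n<R'. cubic R x y z n * w n) =
    (\<Sum>N<R + R'. LINT t|lborel. pair_prod N x y t * pair_prod N (\<lambda>c. if c < R then cnj (z c) else 0) w t)"
proof -
  define z' where "z' = (\<lambda>c. if c < R then cnj (z c) else 0)"
  define F where "F = (\<lambda>c n. \<Sum>a\<le>c + n. x a * y (c + n - a) * z' c * w n * of_real (quartic a (c + n - a) c n))"
  have "(\<Sum>N<R + R'. LINT t|lborel. pair_prod N x y t * pair_prod N z' w t) =
      (\<Sum>N<R + R'. \<Sum>c\<le>N. F c (N - c))"
    unfolding pair_prod_integral F_def by (intro sum.cong refl) auto
  also have "\<dots> = (\<Sum>c<R. \<Sum>n<R'. F c n)"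
    by (rule sum_triangle_rectangle) (auto simp: F_def z'_def w)
  also have "\<dots> = (\<Sum>n<R'. \<Sum>c<R. F c n)" by (rule sum.swap)
  also have "\<dots> = (\<Sum>n<R'. cubic R x y z n * w n)"
    by (intro sum.cong refl) (simp add: F_def z'_def cubic_def sum_distrib_left sum_distrib_right add.commute mult_ac)
  finally show ?thesis unfolding z'_def ..
qed

text \<open>Duality with the truncated conjugate of the output itself: its square sum S satisfies S
  \<le> const * sqrt S. Cauchy-Schwarz is applied first in the integral at fixed degree, where the
  two \<open>pair_bound\<close> hypotheses enter, and then in the sum over degrees.\<close>

lemma cubic_high_bound:
  assumes X: "ell2 X x" and Y: "ell2 Y y" and Z: "ell2 Z z"
    and k: "0 \<le> \<kappa>1" "0 \<le> \<kappa>2" and xy: "pair_bound \<kappa>1 K x y"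
    and zw: "\<And>w. pair_bound \<kappa>2 K (\<lambda>c. if c < R then cnj (z c) else 0) w"
  shows "ell2 (sqrt (\<kappa>1 * \<kappa>2) * (X * Y * Z)) (cubic_high K R x y z)"
  unfolding ell2_def
proof (intro conjI allI)
  have nn: "0 \<le> X" "0 \<le> Y" "0 \<le> Z" using X Y Z by (auto simp: ell2_def)
  then show "0 \<le> sqrt (\<kappa>1 * \<kappa>2) * (X * Y * Z)" using k by simp
  fix R'
  define z' where "z' = (\<lambda>c. if c < R then cnj (z c) else 0)"
  define w where "w = (\<lambda>n. if n < R' then cnj (cubic_high K R x y z n) else 0)"
  define S where "S = (\<Sum>n<R'. (norm (cubic_high K R x y z n))\<^sup>2)"
  define I where "I = (\<lambda>N. LINT t|lborel. pair_prod N x y t * pair_prod N z' w t)"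
  have S0: "0 \<le> S" unfolding S_def by (simp add: sum_nonneg)
  have Z': "ell2 Z z'" using Z by (rule ell2_mono) (auto simp: z'_def)
  have W: "ell2 (sqrt S) w"
    unfolding ell2_def
  proof (intro conjI allI)
    fix M
    have "(\<Sum>n<M. (norm (w n))\<^sup>2) = (\<Sum>n\<in>{..<M} \<inter> {..<R'}. (norm (cubic_high K R x y z n))\<^sup>2)"
      by (rule sum.mono_neutral_cong_right) (auto simp: w_def)
    also have "\<dots> \<le> S" unfolding S_def by (rule sum_mono2) auto
    finally show "(\<Sum>n<M. (norm (w n))\<^sup>2) \<le> (sqrt S)\<^sup>2" using S0 by simp
  qed (use S0 in simp)
  have "of_real S = (\<Sum>n<R'. cubic R x y z n * w n)"
    unfolding S_def of_real_sum
    by (intro sum.cong refl) (simp add: w_def cubic_high_def complex_norm_square del: of_real_power)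
  also have "\<dots> = (\<Sum>N<R + R'. I N)"
    unfolding I_def z'_def by (rule cubic_dual) (simp add: w_def)
  finally have "S = norm (\<Sum>N<R + R'. I N)" using S0 by (metis norm_of_real abs_of_nonneg)
  also have "\<dots> \<le> (\<Sum>N<R + R'. norm (I N))" by (rule norm_sum)
  also have "\<dots> \<le> (\<Sum>N<R + R'. sqrt (\<kappa>1 * \<kappa>2) * (sqrt (pair_mass N x y) * sqrt (pair_mass N z' w)))"
  proof (rule sum_mono)
    fix N
    show "norm (I N) \<le> sqrt (\<kappa>1 * \<kappa>2) * (sqrt (pair_mass N x y) * sqrt (pair_mass N z' w))"
    proof (cases "K \<le> N")
      case True
      have "norm (I N) \<le> sqrt (LINT t|lborel. (norm (pair_prod N x y t))\<^sup>2) *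
          sqrt (LINT t|lborel. (norm (pair_prod N z' w t))\<^sup>2)"
        unfolding I_def by (rule integral_Cauchy_Schwarz) (simp_all add: pair_prod_sq_integrable)
      also have "\<dots> \<le> sqrt (\<kappa>1 * pair_mass N x y) * sqrt (\<kappa>2 * pair_mass N z' w)"
        using xy zw[folded z'_def] True k pair_mass_nonneg unfolding pair_bound_def
        by (intro mult_mono real_sqrt_le_mono) auto
      finally show ?thesis by (simp add: real_sqrt_mult mult_ac)
    next
      case False
      \<comment> \<open>The test sequence lives on indices at least K, so degrees below K do not
        contribute; this is why \<open>pair_bound\<close> is only required from degree K on.\<close>
      have "w (N - a) = 0" for a using False by (auto simp: w_def cubic_high_def)
      then have "I N = 0" by (simp add: I_def pair_prod_def expand_def)
      then show ?thesis using k by (simp add: pair_mass_nonneg)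
    qed
  qed
  also have "\<dots> = sqrt (\<kappa>1 * \<kappa>2) * (\<Sum>N<R + R'. sqrt (pair_mass N x y) * sqrt (pair_mass N z' w))"
    by (simp add: sum_distrib_left)
  also have "\<dots> \<le> sqrt (\<kappa>1 * \<kappa>2) * ((X * Y) * (Z * sqrt S))"
  proof (intro mult_left_mono)
    have "(\<Sum>N<R + R'. sqrt (pair_mass N x y) * sqrt (pair_mass N z' w))\<^sup>2 \<le>
        (\<Sum>N<R + R'. (sqrt (pair_mass N x y))\<^sup>2) * (\<Sum>N<R + R'. (sqrt (pair_mass N z' w))\<^sup>2)"
      by (rule Cauchy_Schwarz_ineq_sum)
    also have "\<dots> = (\<Sum>N<R + R'. pair_mass N x y) * (\<Sum>N<R + R'. pair_mass N z' w)"
      by (simp add: pair_mass_nonneg)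
    also have "\<dots> \<le> (X\<^sup>2 * Y\<^sup>2) * (Z\<^sup>2 * (sqrt S)\<^sup>2)"
      by (intro mult_mono sum_pair_mass_le X Y Z' W) (simp_all add: sum_nonneg pair_mass_nonneg)
    finally have "(\<Sum>N<R + R'. sqrt (pair_mass N x y) * sqrt (pair_mass N z' w))\<^sup>2 \<le> ((X * Y) * (Z * sqrt S))\<^sup>2"
      by (simp add: power_mult_distrib)
    then show "(\<Sum>N<R + R'. sqrt (pair_mass N x y) * sqrt (pair_mass N z' w)) \<le> (X * Y) * (Z * sqrt S)"
      by (rule power2_le_imp_le) (use nn S0 in simp)
  qed (use k in simp)
  finally have le: "S \<le> (sqrt (\<kappa>1 * \<kappa>2) * (X * Y * Z)) * sqrt S" by (simp add: mult_ac)
  have "sqrt S \<le> sqrt (\<kappa>1 * \<kappa>2) * (X * Y * Z)"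
  proof (cases "S = 0")
    case False
    then have "sqrt S > 0" using S0 by simp
    moreover have "sqrt S * sqrt S \<le> (sqrt (\<kappa>1 * \<kappa>2) * (X * Y * Z)) * sqrt S" using le S0 by simp
    ultimately show ?thesis by (simp only: mult_le_cancel_right_pos)
  qed (use k nn in simp)
  then have "(sqrt S)\<^sup>2 \<le> (sqrt (\<kappa>1 * \<kappa>2) * (X * Y * Z))\<^sup>2" by (intro power_mono) (use S0 in auto)
  then show "(\<Sum>n<R'. (norm (cubic_high K R x y z n))\<^sup>2) \<le> (sqrt (\<kappa>1 * \<kappa>2) * (X * Y * Z))\<^sup>2"
    using S0 by (simp add: S_def)
qed

text \<open>If x is supported below L, a product of high degree N contains only terms h_a h_(N-a)
  with a < L and N - a large, whose squares have small overlap. Cauchy-Schwarz over the L terms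
  costs a factor L, hence the threshold e / (L + 1).\<close>

lemma pair_bound_low:
  assumes "0 < e"
  obtains K0 where "\<And>K x y. K0 \<le> K \<Longrightarrow> (\<And>a. L \<le> a \<Longrightarrow> x a = 0) \<Longrightarrow> pair_bound e K x y"
proof -
  have "\<forall>\<^sub>F n in sequentially. \<forall>l\<in>{..<L}. (LINT t|lborel. (hh l t)\<^sup>2 * (hh n t)\<^sup>2) < e / (L + 1)"
    by (intro eventually_ball_finite ballI order_tendstoD(2)[OF hh_sq_overlap_tendsto]) (use assms in auto)
  then obtain n0 where "\<forall>n\<ge>n0. \<forall>l\<in>{..<L}. (LINT t|lborel. (hh l t)\<^sup>2 * (hh n t)\<^sup>2) < e / (L + 1)"
    unfolding eventually_sequentially by blast
  then have n0: "\<And>l n. l < L \<Longrightarrow> n0 \<le> n \<Longrightarrow> (LINT t|lborel. (hh l t)\<^sup>2 * (hh n t)\<^sup>2) < e / (L + 1)"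
    by blast
  show thesis
  \<comment> \<open>From degree n0 + L on, every partner index N - a with a < L is at least
    n0.\<close>
  proof (rule that[of "n0 + L"])
    fix K and x y :: "nat \<Rightarrow> complex"
    assume K: "n0 + L \<le> K" and x: "\<And>a. L \<le> a \<Longrightarrow> x a = 0"
    show "pair_bound e K x y"
      unfolding pair_bound_def
    proof (intro allI impI)
      fix N assume N: "K \<le> N"
      define v where "v = (\<lambda>a. (norm (x a * y (N - a)))\<^sup>2)"
      have sub: "{..<L} \<subseteq> {..N}" using N K by auto
      have pp: "pair_prod N x y t = (\<Sum>a<L. 1 * (x a * y (N - a) * of_real (hh a t) * of_real (hh (N - a) t)))" for t
        unfolding pair_prod_def expand_def mult_1
        by (rule sum.mono_neutral_right[OF _ sub]) (auto simp: x)
      have pt: "(norm (pair_prod N x y t))\<^sup>2 \<le> real L * (\<Sum>a<L. v a * ((hh a t)\<^sup>2 * (hh (N - a) t)\<^sup>2))" for t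
        unfolding pp
        by (rule order_trans[OF norm_sum_mult_sq_le]) (simp add: v_def norm_mult power_mult_distrib mult_ac)
      have int: "integrable lborel (\<lambda>t. (hh a t)\<^sup>2 * (hh b t)\<^sup>2)" for a b
        using integrable_hh4[of a a b b] by (simp add: power2_eq_square)
      have "(LINT t|lborel. (norm (pair_prod N x y t))\<^sup>2) \<le>
          (LINT t|lborel. real L * (\<Sum>a<L. v a * ((hh a t)\<^sup>2 * (hh (N - a) t)\<^sup>2)))"
      proof (rule integral_mono[OF pair_prod_sq_integrable _ pt])
        show "integrable lborel (\<lambda>t. real L * (\<Sum>a<L. v a * ((hh a t)\<^sup>2 * (hh (N - a) t)\<^sup>2)))"
          by (intro integrable_mult_right Bochner_Integration.integrable_sum int)
      qed
      also have "\<dots> = real L * (\<Sum>a<L. v a * (LINT t|lborel. (hh a t)\<^sup>2 * (hh (N - a) t)\<^sup>2))"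
        by (simp only: integral_mult_right_zero Bochner_Integration.integral_sum[OF integrable_mult_right[OF int]])
      also have "\<dots> \<le> real L * (\<Sum>a<L. v a * (e / (L + 1)))"
      proof (intro mult_left_mono sum_mono)
        fix a assume "a \<in> {..<L}"
        then have "a < L" "n0 \<le> N - a" using N K by auto
        then show "(LINT t|lborel. (hh a t)\<^sup>2 * (hh (N - a) t)\<^sup>2) \<le> e / (L + 1)"
          by (rule less_imp_le[OF n0])
      qed (simp_all add: v_def)
      also have "\<dots> = (L * (e / (L + 1))) * (\<Sum>a<L. v a)"
        by (simp only: sum_distrib_right[symmetric] mult_ac)
      also have "\<dots> \<le> e * (\<Sum>a<L. v a)"
      proof (intro mult_right_mono)
        show "L * (e / (L + 1)) \<le> e" using assms by (simp add: field_simps)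
      qed (simp add: v_def sum_nonneg)
      also have "\<dots> \<le> e * (\<Sum>a\<le>N. v a)"
        using assms by (intro mult_left_mono sum_mono2 sub) (simp_all add: v_def)
      also have "(\<Sum>a\<le>N. v a) = pair_mass N x y"
        by (simp add: v_def pair_mass_def degree_energy_def)
      finally show "(LINT t|lborel. (norm (pair_prod N x y t))\<^sup>2) \<le> e * pair_mass N x y" .
    qed
  qed
qed

section \<open>Multilinearity, weights, truncation and smallness of the cubic form\<close>

lemma cubic_add:
  "cubic R (\<lambda>n. x n + x' n) y z n = cubic R x y z n + cubic R x' y z n"
  "cubic R x (\<lambda>n. y n + y' n) z n = cubic R x y z n + cubic R x y' z n"
  "cubic R x y (\<lambda>n. z n + z' n) n = cubic R x y z n + cubic R x y z' n"
  by (simp_all add: cubic_def algebra_simps sum.distrib)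

lemma cubic_high_add:
  "cubic_high K R (\<lambda>n. x n + x' n) y z n = cubic_high K R x y z n + cubic_high K R x' y z n"
  "cubic_high K R x (\<lambda>n. y n + y' n) z n = cubic_high K R x y z n + cubic_high K R x y' z n"
  "cubic_high K R x y (\<lambda>n. z n + z' n) n = cubic_high K R x y z n + cubic_high K R x y z' n"
  by (simp_all add: cubic_high_def cubic_add)

text \<open>Because n = a + b - c, the weight distributes over the arguments with the inverse power
  on the conjugated one.\<close>

lemma cubic_weighted:
  assumes "\<theta> \<noteq> 0"
  shows "of_real (\<theta> ^ n) * cubic R x y z n =
    cubic R (\<lambda>a. of_real (\<theta> ^ a) * x a) (\<lambda>a. of_real (\<theta> ^ a) * y a) (\<lambda>a. of_real (inverse (\<theta> ^ a)) * z a) n"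
proof -
  have "of_real (\<theta> ^ n) * (x a * y (n + c - a) * cnj (z c) * of_real q) =
      of_real (\<theta> ^ a) * x a * (of_real (\<theta> ^ (n + c - a)) * y (n + c - a)) *
        cnj (of_real (inverse (\<theta> ^ c)) * z c) * complex_of_real q" if "a \<le> n + c" for a c q
  proof -
    have "\<theta> ^ a * \<theta> ^ (n + c - a) * inverse (\<theta> ^ c) = \<theta> ^ n"
      using that assms by (simp add: power_add field_simps flip: power_add)
    then have "complex_of_real (\<theta> ^ n) = of_real (\<theta> ^ a) * of_real (\<theta> ^ (n + c - a)) * of_real (inverse (\<theta> ^ c))"
      by (metis of_real_mult)
    then show ?thesis by (simp only: complex_cnj_mult complex_cnj_complex_of_real mult_ac)
  qed
  then show ?thesis
    unfolding cubic_def sum_distrib_left by (intro sum.cong refl) auto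
qed

lemma cubic_truncate:
  assumes "\<And>n. S \<le> n \<Longrightarrow> z n = 0" "S \<le> R"
  shows "cubic R x y z n = cubic S x y z n"
  unfolding cubic_def by (rule sum.mono_neutral_right) (use assms in auto)

text \<open>If n \<ge> 2 S then a + b = n + c \<ge> 2 S, so a or b is at least S. Hence an iteration
  of the cubic form at most doubles the support.\<close>

lemma cubic_support:
  assumes "\<And>n. S \<le> n \<Longrightarrow> x n = 0" "\<And>n. S \<le> n \<Longrightarrow> y n = 0" "2 * S \<le> n"
  shows "cubic R x y z n = 0"
  unfolding cubic_def
proof (intro sum.neutral ballI)
  fix c a assume "a \<in> {..n + c}"
  then have "S \<le> a \<or> S \<le> n + c - a" using assms(3) by auto
  then show "x a * y (n + c - a) * cnj (z c) * of_real (quartic a (n + c - a) c n) = 0"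
    using assms(1)[of a] assms(2)[of "n + c - a"] by auto
qed

lemma cubic_high_basic:
  assumes "ell2 X x" "ell2 Y y" "ell2 Z z"
  shows "ell2 (X * Y * Z) (cubic_high K R x y z)"
  using cubic_high_bound[OF assms, of 1 1 K R] pair_bound_1 by simp

lemma cubic_high_low:
  assumes "0 < e"
  obtains K0 where "\<And>K R x y z X Y Z. K0 \<le> K \<Longrightarrow> ell2 X x \<Longrightarrow> ell2 Y y \<Longrightarrow> ell2 Z z \<Longrightarrow>
    (\<forall>a\<ge>L. x a = 0) \<or> (\<forall>a\<ge>L. y a = 0) \<or> (\<forall>a\<ge>L. z a = 0) \<Longrightarrow>
    ell2 (e * (X * Y * Z)) (cubic_high K R x y z)"
proof -
  \<comment> \<open>The square compensates for the square root under which the pair constant enters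
    \<open>cubic_high_bound\<close>.\<close>
  have "0 < e\<^sup>2" using assms by simp
  then obtain K0 where K0: "\<And>K x y. K0 \<le> K \<Longrightarrow> (\<And>a. L \<le> a \<Longrightarrow> x a = 0) \<Longrightarrow> pair_bound (e\<^sup>2) K x y"
    using pair_bound_low[of "e\<^sup>2" L] by blast
  show thesis
  proof (rule that[of K0])
    fix K R X Y Z and x y z :: "nat \<Rightarrow> complex"
    assume K: "K0 \<le> K" and xyz: "ell2 X x" "ell2 Y y" "ell2 Z z"
      and low: "(\<forall>a\<ge>L. x a = 0) \<or> (\<forall>a\<ge>L. y a = 0) \<or> (\<forall>a\<ge>L. z a = 0)"
    from low consider "\<forall>a\<ge>L. x a = 0" | "\<forall>a\<ge>L. y a = 0" | "\<forall>a\<ge>L. z a = 0" by blast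
    then show "ell2 (e * (X * Y * Z)) (cubic_high K R x y z)"
    proof cases
      case 1
      then have "pair_bound (e\<^sup>2) K x y" using K0[OF K] by blast
      then show ?thesis
        using cubic_high_bound[OF xyz, of "e\<^sup>2" 1 K R] pair_bound_1 assms by simp
    next
      case 2
      then have "pair_bound (e\<^sup>2) K x y" using K0[OF K] pair_bound_swap by blast
      then show ?thesis
        using cubic_high_bound[OF xyz, of "e\<^sup>2" 1 K R] pair_bound_1 assms by simp
    next
      case 3
      then have "pair_bound (e\<^sup>2) K (\<lambda>c. if c < R then cnj (z c) else 0) w" for w
        using K0[OF K, of "\<lambda>c. if c < R then cnj (z c) else 0"] by simp
      then show ?thesis
        using cubic_high_bound[OF xyz, of 1 "e\<^sup>2" K R] pair_bound_1 assms by simp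
    qed
  qed
qed

lemma ell2_tail:
  assumes "ell2 C c" "0 < d"
  obtains L where "ell2 d (\<lambda>n. if n < L then 0 else c n)"
proof -
  define f where "f = (\<lambda>n. (norm (c n))\<^sup>2)"
  have bdd: "summable f"
    by (rule summableI_nonneg_bounded[of _ "C\<^sup>2"]) (use assms in \<open>auto simp: f_def ell2_def\<close>)
  have "(\<lambda>L. (\<Sum>n. f (n + L))) \<longlonglongrightarrow> 0" by (rule suminf_exist_split2[OF bdd])
  then have "\<forall>\<^sub>F L in sequentially. (\<Sum>n. f (n + L)) < d\<^sup>2"
    by (rule order_tendstoD(2)) (use assms in simp)
  then obtain L where L: "(\<Sum>n. f (n + L)) < d\<^sup>2"
    unfolding eventually_sequentially by blast
  have "ell2 d (\<lambda>n. if n < L then 0 else c n)"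
    unfolding ell2_def
  proof (intro conjI allI)
    fix R
    have "(\<Sum>n<R. (norm (if n < L then 0 else c n))\<^sup>2) \<le> (\<Sum>n<L + R. (norm (if n < L then 0 else c n))\<^sup>2)"
      by (rule sum_mono2) auto
    also have "\<dots> = (\<Sum>n<R. f (n + L))"
      by (induction R) (simp_all add: f_def add.commute)
    also have "\<dots> \<le> (\<Sum>n. f (n + L))"
      by (intro sum_le_suminf) (use summable_ignore_initial_segment[OF bdd, of L] in \<open>auto simp: f_def\<close>)
    finally show "(\<Sum>n<R. (norm (if n < L then 0 else c n))\<^sup>2) \<le> d\<^sup>2" using L by simp
  qed (use assms in simp)
  then show thesis by (rule that)
qed

text \<open>Here v is supported below K, the very index above which the output is kept, so
  \<open>cubic_high_low\<close> with its fixed support does not apply directly. Domination by 2 |c|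
  repairs this: cut v at a fixed L; the part below L gains from the high output, and the rest is a
  tail of c, small uniformly in K. The factor 2 leaves room for the weights in
  \<open>resonant_decay\<close>.\<close>

lemma cubic_high_cutoff:
  assumes c: "ell2 C c" and "0 < e"
  obtains K0 where "\<And>K R x y v X Y. K0 \<le> K \<Longrightarrow> ell2 X x \<Longrightarrow> ell2 Y y \<Longrightarrow>
    (\<And>n. norm (v n) \<le> (if n < K then 2 * norm (c n) else 0)) \<Longrightarrow>
    ell2 (e * (X * Y)) (cubic_high K R v x y) \<and> ell2 (e * (X * Y)) (cubic_high K R x v y) \<and>
    ell2 (e * (X * Y)) (cubic_high K R x y v)"
proof -
  have C: "0 \<le> C" using c by (simp add: ell2_def)
  \<comment> \<open>With the factor 2 the tail contributes e / 2, and the low part contributes 2 C e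
    / (4 (C + 1)) \<le> e / 2; C + 1 avoids dividing by C = 0.\<close>
  obtain L where L: "ell2 (e / 4) (\<lambda>n. if n < L then 0 else c n)"
    using ell2_tail[OF c, of "e / 4"] assms by auto
  obtain K0 where K0: "\<And>K R x y z X Y Z. K0 \<le> K \<Longrightarrow> ell2 X x \<Longrightarrow> ell2 Y y \<Longrightarrow> ell2 Z z \<Longrightarrow>
    (\<forall>a\<ge>L. x a = 0) \<or> (\<forall>a\<ge>L. y a = 0) \<or> (\<forall>a\<ge>L. z a = 0) \<Longrightarrow>
    ell2 (e / (4 * (C + 1)) * (X * Y * Z)) (cubic_high K R x y z)"
    using cubic_high_low[of "e / (4 * (C + 1))" L] assms C by (auto simp: divide_pos_pos add_nonneg_pos)
  show thesis
  proof (rule that[of K0])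
    fix K R x y X Y and v :: "nat \<Rightarrow> complex"
    assume K: "K0 \<le> K" and x: "ell2 X x" and y: "ell2 Y y"
      and v: "\<And>n. norm (v n) \<le> (if n < K then 2 * norm (c n) else 0)"
    define p q where "p = (\<lambda>n. if n < L then v n else 0)" and "q = (\<lambda>n. if n < L then 0 else v n)"
    have vpq: "v = (\<lambda>n. p n + q n)" by (auto simp: p_def q_def)
    have v2: "norm (v n) \<le> norm (2 * c n)" for n
      using v[of n] by (auto simp: norm_mult split: if_splits intro: order_trans)
    have "ell2 (norm (2::complex) * C) (\<lambda>n. 2 * c n)" by (rule ell2_scale[OF c])
    then have p: "ell2 (2 * C) p" by (rule ell2_mono) (use v2 in \<open>auto simp: p_def\<close>)
    have "ell2 (norm (2::complex) * (e / 4)) (\<lambda>n. 2 * (if n < L then 0 else c n))" by (rule ell2_scale[OF L])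
    then have q: "ell2 (e / 2) q" by (rule ell2_mono) (use v2 in \<open>auto simp: q_def\<close>)
    have p0: "\<forall>a\<ge>L. p a = 0" by (simp add: p_def)
    have nn: "0 \<le> X" "0 \<le> Y" using x y by (auto simp: ell2_def)
    have le: "e / (4 * (C + 1)) * (2 * C * (X * Y)) + e / 2 * (X * Y) \<le> e * (X * Y)"
    proof -
      have "e / (4 * (C + 1)) * (2 * C) \<le> e / 2" using C assms by (simp add: field_simps)
      then have "e / (4 * (C + 1)) * (2 * C) * (X * Y) \<le> e / 2 * (X * Y)"
        using nn by (intro mult_right_mono) auto
      moreover have "e / (4 * (C + 1)) * (2 * C * (X * Y)) = e / (4 * (C + 1)) * (2 * C) * (X * Y)"
        by (simp only: mult.assoc)
      moreover have "e / 2 * (X * Y) + e / 2 * (X * Y) = e * (X * Y)" by simp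
      ultimately show ?thesis by linarith
    qed
    have "ell2 (e / (4 * (C + 1)) * (2 * C * X * Y) + e / 2 * X * Y) (cubic_high K R v x y)"
      unfolding vpq cubic_high_add
      by (intro ell2_add K0[OF K p x y] cubic_high_basic q x y) (use p0 in blast)
    then have 1: "ell2 (e * (X * Y)) (cubic_high K R v x y)"
      by (rule ell2_mono) (use le in \<open>simp_all add: mult_ac\<close>)
    have "ell2 (e / (4 * (C + 1)) * (X * (2 * C) * Y) + X * (e / 2) * Y) (cubic_high K R x v y)"
      unfolding vpq cubic_high_add
      by (intro ell2_add K0[OF K x p y] cubic_high_basic q x y) (use p0 in blast)
    then have 2: "ell2 (e * (X * Y)) (cubic_high K R x v y)"
      by (rule ell2_mono) (use le in \<open>simp_all add: mult_ac\<close>)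
    have "ell2 (e / (4 * (C + 1)) * (X * Y * (2 * C)) + X * Y * (e / 2)) (cubic_high K R x y v)"
      unfolding vpq cubic_high_add
      by (intro ell2_add K0[OF K x y p] cubic_high_basic q x y) (use p0 in blast)
    then have 3: "ell2 (e * (X * Y)) (cubic_high K R x y v)"
      by (rule ell2_mono) (use le in \<open>simp_all add: mult_ac\<close>)
    show "ell2 (e * (X * Y)) (cubic_high K R v x y) \<and> ell2 (e * (X * Y)) (cubic_high K R x v y) \<and>
      ell2 (e * (X * Y)) (cubic_high K R x y v)" using 1 2 3 by blast
  qed
qed

lemma ell2_le: "ell2 M x \<Longrightarrow> M \<le> M' \<Longrightarrow> ell2 M' x"
  by (rule ell2_mono) auto

text \<open>The high modes of a solution are the fixed point of a contraction. The resonance condition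
  makes the cubic term commute exactly with the weights \<open>\<theta>\<^sup>n\<close>, so the iterates stay bounded in the
  weighted norm while they converge to the solution in the unweighted one.\<close>

lemma resonant_decay:
  fixes c :: "nat \<Rightarrow> complex" and lam :: complex and m :: "nat \<Rightarrow> nat"
  defines "tr \<equiv> (\<lambda>M n. if n < M then c n else 0)"
  assumes c: "ell2 C c" and m: "filterlim m at_top sequentially"
    and eq: "\<And>n. (\<lambda>j. lam * cubic (m j) (tr (m j)) (tr (m j)) (tr (m j)) n) \<longlonglongrightarrow> c n"
  shows "\<exists>A r. 0 < r \<and> r < 1 \<and> (\<forall>n. norm (c n) \<le> A * r ^ n)"
proof -
  have C: "0 \<le> C" using c by (simp add: ell2_def)
  \<comment> \<open>Adding 1 keeps the constant positive when lam = 0.\<close>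
  define la where "la = norm lam + 1"
  have la: "0 < la" "norm lam \<le> la" by (simp_all add: la_def add_nonneg_pos)
  \<comment> \<open>Chosen so that la \<rho>^2 = 1 / 16: the term with three high factors costs
    \<rho> / 16 in \<open>invariance\<close>, and the three terms without a low factor cost 3 / 16
    of the error in \<open>contraction\<close>.\<close>
  define \<rho> where "\<rho> = 1 / (4 * sqrt la)"
  have \<rho>: "0 < \<rho>" using la by (simp add: \<rho>_def)
  have \<rho>2: "la * (\<rho> * \<rho>) = 1 / 16" using la by (simp add: \<rho>_def)
  define B where "B = 2 * C + \<rho>"
  have B: "0 < B" using C \<rho> by (simp add: B_def)
  define D where "D = B * B + \<rho> * B + \<rho> * \<rho>"
  have D: "0 < D" using B \<rho> by (simp add: D_def add_pos_pos)
  \<comment> \<open>Size of the gain for terms with a low factor. B bounds low plus high part in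
    ell2 and D collects the bounds of these terms in \<open>invariance\<close>; the two entries of
    the minimum limit them to \<rho> / 2 there and to a quarter of the error in
    \<open>contraction\<close>.\<close>
  define \<eta> where "\<eta> = min (\<rho> / (2 * la * D)) (1 / (12 * la * (B + \<rho>)))"
  have \<eta>: "0 < \<eta>" using \<rho> la D B by (simp add: \<eta>_def)
  have \<eta>1: "la * (\<eta> * D) \<le> \<rho> / 2"
  proof -
    have "la * (\<eta> * D) \<le> la * ((\<rho> / (2 * la * D)) * D)"
      using la D by (intro mult_left_mono mult_right_mono) (auto simp: \<eta>_def)
    also have "\<dots> = \<rho> / 2" using la D by simp
    finally show ?thesis .
  qed
  have \<eta>2: "la * (3 * (\<eta> * (B + \<rho>))) \<le> 1 / 4"
  proof -
    have "la * (3 * (\<eta> * (B + \<rho>))) \<le> la * (3 * ((1 / (12 * la * (B + \<rho>))) * (B + \<rho>)))"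
      using la B \<rho> by (intro mult_left_mono mult_right_mono) (auto simp: \<eta>_def)
    also have "\<dots> = 1 / 4"
    proof -
      have "B + \<rho> \<noteq> 0" using B \<rho> by simp
      then show ?thesis using la by simp
    qed
    finally show ?thesis .
  qed
  obtain K0 where K0: "\<And>K R x y v X Y. K0 \<le> K \<Longrightarrow> ell2 X x \<Longrightarrow> ell2 Y y \<Longrightarrow>
    (\<And>n. norm (v n) \<le> (if n < K then 2 * norm (c n) else 0)) \<Longrightarrow>
    ell2 (\<eta> * (X * Y)) (cubic_high K R v x y) \<and> ell2 (\<eta> * (X * Y)) (cubic_high K R x v y) \<and>
    ell2 (\<eta> * (X * Y)) (cubic_high K R x y v)"
    using cubic_high_cutoff[OF c \<eta>] by blast
  obtain K1 where K1: "ell2 \<rho> (\<lambda>n. if n < K1 then 0 else c n)"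
    using ell2_tail[OF c \<rho>] by blast
  define K where "K = max K0 K1"
  have tail: "ell2 \<rho> (\<lambda>n. if n < K then 0 else c n)"
    using K1 by (rule ell2_mono) (auto simp: K_def)
  have KK: "K0 \<le> K" by (simp add: K_def)
  note low = K0[OF KK]
  have pB: "ell2 (2 * C) p" if "\<And>n. norm (p n) \<le> (if n < K then 2 * norm (c n) else 0)" for p
  proof -
    have "ell2 (norm (2::complex) * C) (\<lambda>n. 2 * c n)" by (rule ell2_scale[OF c])
    then show ?thesis
    proof (rule ell2_mono)
      fix n show "norm (p n) \<le> norm (2 * c n)"
        using that[of n] by (cases "n < K") (simp_all add: norm_mult)
    qed simp
  qed
  \<comment> \<open>The arguments are expanded one at a time, until each term has a low factor p or
    p' in some slot or consists of three high factors. The third argument has its own parts p' and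
    q' because it carries the inverse weight.\<close>
  have invariance: "ell2 \<rho> (\<lambda>n. lam * cubic_high K R (\<lambda>n. p n + q n) (\<lambda>n. p n + q n) (\<lambda>n. p' n + q' n) n)"
    if p: "\<And>n. norm (p n) \<le> (if n < K then 2 * norm (c n) else 0)"
      and p': "\<And>n. norm (p' n) \<le> (if n < K then 2 * norm (c n) else 0)"
      and q: "ell2 \<rho> q" and q': "ell2 \<rho> q'" for R p q p' q'
  proof -
    have u: "ell2 B (\<lambda>n. p n + q n)" "ell2 B (\<lambda>n. p' n + q' n)"
      unfolding B_def by (intro ell2_add pB p p' q q')+
    define u' where "u' = (\<lambda>n. p' n + q' n)"
    define u where "u = (\<lambda>n. p n + q n)"
    have split: "cubic_high K R u u u' n =
      cubic_high K R p u u' n + (cubic_high K R q p u' n + (cubic_high K R q q p' n + cubic_high K R q q q' n))" for n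
    proof -
      have "cubic_high K R u u u' n = cubic_high K R p u u' n + cubic_high K R q u u' n"
        by (subst u_def) (simp only: cubic_high_add)
      moreover have "cubic_high K R q u u' n = cubic_high K R q p u' n + cubic_high K R q q u' n"
        unfolding u_def by (simp only: cubic_high_add)
      moreover have "cubic_high K R q q u' n = cubic_high K R q q p' n + cubic_high K R q q q' n"
        unfolding u'_def by (simp only: cubic_high_add)
      ultimately show ?thesis by simp
    qed
    have "ell2 (\<eta> * (B * B) + (\<eta> * (\<rho> * B) + (\<eta> * (\<rho> * \<rho>) + \<rho> * \<rho> * \<rho>))) (cubic_high K R u u u')"
      unfolding split[abs_def]
    proof (intro ell2_add)
      show "ell2 (\<eta> * (B * B)) (cubic_high K R p u u')" using low[OF u p] unfolding u_def u'_def by blast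
      show "ell2 (\<eta> * (\<rho> * B)) (cubic_high K R q p u')" using low[OF q u(2) p] unfolding u'_def by blast
      show "ell2 (\<eta> * (\<rho> * \<rho>)) (cubic_high K R q q p')" using low[OF q q p'] by blast
      show "ell2 (\<rho> * \<rho> * \<rho>) (cubic_high K R q q q')" by (rule cubic_high_basic[OF q q q'])
    qed
    then have "ell2 (norm lam * (\<eta> * (B * B) + (\<eta> * (\<rho> * B) + (\<eta> * (\<rho> * \<rho>) + \<rho> * \<rho> * \<rho>)))) (\<lambda>n. lam * cubic_high K R u u u' n)"
      by (rule ell2_scale)
    moreover have "norm lam * (\<eta> * (B * B) + (\<eta> * (\<rho> * B) + (\<eta> * (\<rho> * \<rho>) + \<rho> * \<rho> * \<rho>))) \<le> \<rho>"
    proof -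
      have "norm lam * (\<eta> * (B * B) + (\<eta> * (\<rho> * B) + (\<eta> * (\<rho> * \<rho>) + \<rho> * \<rho> * \<rho>))) \<le>
          la * (\<eta> * (B * B) + (\<eta> * (\<rho> * B) + (\<eta> * (\<rho> * \<rho>) + \<rho> * \<rho> * \<rho>)))"
        using la \<eta> B \<rho> by (intro mult_right_mono) auto
      also have "\<dots> = la * (\<eta> * D) + la * (\<rho> * \<rho>) * \<rho>" by (simp add: D_def algebra_simps)
      also have "\<dots> \<le> \<rho> / 2 + 1 / 16 * \<rho>" unfolding \<rho>2 using \<eta>1 by linarith
      also have "\<dots> \<le> \<rho>" using \<rho> by simp
      finally show ?thesis .
    qed
    ultimately show ?thesis unfolding u_def u'_def by (rule ell2_le)
  qed
  \<comment> \<open>u and v share the low part p and differ by e. Slots are exchanged one at a time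
    and the other arguments expanded until each term contains e together with a low factor or with
    two high ones. The total is (1/4 + 3/16) E, below E / 2.\<close>
  have contraction: "ell2 (E / 2) (\<lambda>n. lam * (cubic_high K R u u u n - cubic_high K R v v v n))"
    if p: "\<And>n. norm (p n) \<le> (if n < K then 2 * norm (c n) else 0)"
      and q: "ell2 \<rho> q" and q': "ell2 \<rho> q'" and E: "ell2 E (\<lambda>n. u n - v n)"
      and uv: "u = (\<lambda>n. p n + q n)" "v = (\<lambda>n. p n + q' n)" for R E p q q' u v
  proof -
    have u: "ell2 B u" "ell2 B v" unfolding uv B_def by (intro ell2_add pB p q q')+
    define e where "e = (\<lambda>n. u n - v n)"
    have ue: "u = (\<lambda>n. v n + e n)" by (simp add: e_def)
    have E0: "0 \<le> E" using E by (simp add: ell2_def)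
    note E = E[folded e_def]
    have s1: "cubic_high K R u u u n - cubic_high K R v v v n =
        cubic_high K R e u u n + (cubic_high K R v e u n + cubic_high K R v v e n)" for n
    proof -
      have "cubic_high K R u u u n = cubic_high K R v u u n + cubic_high K R e u u n"
        by (subst ue) (simp only: cubic_high_add)
      moreover have "cubic_high K R v u u n = cubic_high K R v v u n + cubic_high K R v e u n"
        by (subst ue) (simp only: cubic_high_add)
      moreover have "cubic_high K R v v u n = cubic_high K R v v v n + cubic_high K R v v e n"
        by (subst ue) (simp only: cubic_high_add)
      ultimately show ?thesis by simp
    qed
    have s2: "cubic_high K R e u u n = cubic_high K R e p u n + (cubic_high K R e q p n + cubic_high K R e q q n)" for n
    proof -
      have "cubic_high K R e u w n = cubic_high K R e p w n + cubic_high K R e q w n" for w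
        unfolding uv by (simp only: cubic_high_add)
      moreover have "cubic_high K R e q u n = cubic_high K R e q p n + cubic_high K R e q q n"
        unfolding uv by (simp only: cubic_high_add)
      ultimately show ?thesis by simp
    qed
    have s3: "cubic_high K R v e u n = cubic_high K R p e u n + (cubic_high K R q' e p n + cubic_high K R q' e q n)" for n
    proof -
      have "cubic_high K R v e w n = cubic_high K R p e w n + cubic_high K R q' e w n" for w
        unfolding uv by (simp only: cubic_high_add)
      moreover have "cubic_high K R q' e u n = cubic_high K R q' e p n + cubic_high K R q' e q n"
        unfolding uv by (simp only: cubic_high_add)
      ultimately show ?thesis by simp
    qed
    have s4: "cubic_high K R v v e n = cubic_high K R p v e n + (cubic_high K R q' p e n + cubic_high K R q' q' e n)" for n
    proof -
      have "cubic_high K R v w e n = cubic_high K R p w e n + cubic_high K R q' w e n" for w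
        unfolding uv by (simp only: cubic_high_add)
      moreover have "cubic_high K R q' v e n = cubic_high K R q' p e n + cubic_high K R q' q' e n"
        unfolding uv by (simp only: cubic_high_add)
      ultimately show ?thesis by simp
    qed
    define T where "T = E * (\<eta> * (B + \<rho>) + \<rho> * \<rho>)"
    have t2: "ell2 T (cubic_high K R e u u)"
    proof -
      have "ell2 (\<eta> * (E * B) + (\<eta> * (E * \<rho>) + E * \<rho> * \<rho>)) (cubic_high K R e u u)"
        unfolding s2[abs_def] using low[OF E u(1) p] low[OF E q p] cubic_high_basic[OF E q q]
        by (intro ell2_add) blast+
      then show ?thesis by (simp add: T_def algebra_simps)
    qed
    have t3: "ell2 T (cubic_high K R v e u)"
    proof -
      have "ell2 (\<eta> * (E * B) + (\<eta> * (\<rho> * E) + \<rho> * E * \<rho>)) (cubic_high K R v e u)"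
        unfolding s3[abs_def] using low[OF E u(1) p] low[OF q' E p] cubic_high_basic[OF q' E q]
        by (intro ell2_add) blast+
      then show ?thesis by (simp add: T_def algebra_simps)
    qed
    have t4: "ell2 T (cubic_high K R v v e)"
    proof -
      have "ell2 (\<eta> * (B * E) + (\<eta> * (\<rho> * E) + \<rho> * \<rho> * E)) (cubic_high K R v v e)"
        unfolding s4[abs_def] using low[OF u(2) E p] low[OF q' E p] cubic_high_basic[OF q' q' E]
        by (intro ell2_add) blast+
      then show ?thesis by (simp add: T_def algebra_simps)
    qed
    have "ell2 (norm lam * (T + (T + T))) (\<lambda>n. lam * (cubic_high K R u u u n - cubic_high K R v v v n))"
      unfolding s1 by (intro ell2_scale ell2_add t2 t3 t4)
    moreover have "norm lam * (T + (T + T)) \<le> E / 2"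
    proof -
      have "0 \<le> T" unfolding T_def using E0 \<eta> B \<rho> by simp
      then have "norm lam * (T + (T + T)) \<le> la * (T + (T + T))"
        using la by (intro mult_right_mono) auto
      also have "\<dots> = E * (la * (3 * (\<eta> * (B + \<rho>))) + 3 * (la * (\<rho> * \<rho>)))"
        by (simp add: T_def algebra_simps)
      also have "\<dots> \<le> E * (1 / 4 + 3 * (1 / 16))"
        unfolding \<rho>2 by (rule mult_left_mono[OF add_right_mono[OF \<eta>2] E0])
      also have "\<dots> \<le> E / 2" using E0 by simp
      finally show ?thesis .
    qed
    ultimately show ?thesis by (rule ell2_le)
  qed
  define \<theta> where "\<theta> = root (Suc K) 2"
  have \<theta>1: "1 < \<theta>" by (simp add: \<theta>_def)
  have \<theta>0: "\<theta> \<noteq> 0" "0 < \<theta>" using \<theta>1 by auto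
  have \<theta>ge: "1 \<le> \<theta> ^ n" for n using \<theta>1 by (simp add: one_le_power)
  have \<theta>K: "\<theta> ^ n \<le> 2" if "n < K" for n
  proof -
    have "\<theta> ^ n \<le> \<theta> ^ Suc K" using \<theta>1 that by (intro power_increasing) auto
    also have "\<dots> = 2" unfolding \<theta>_def by (rule real_root_pow_pos2) auto
    finally show ?thesis .
  qed
  define lo where "lo = (\<lambda>n. if n < K then c n else 0)"
  \<comment> \<open>Supports at most double in each step by \<open>cubic_support\<close>, so S k
    serves both as support bound for the iterate u k and as cutoff of the sum that produces the next
    one.\<close>
  define S where "S = (\<lambda>k. 2 ^ k * Suc K)"
  define u where "u = rec_nat lo (\<lambda>k v n. if n < K then c n else lam * cubic (S k) v v v n)"
  have u0: "u 0 = lo" and uS: "u (Suc k) = (\<lambda>n. if n < K then c n else lam * cubic (S k) (u k) (u k) (u k) n)" for k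
    unfolding u_def by simp_all
  have SK: "K < S k" for k
  proof -
    have "1 * Suc K \<le> 2 ^ k * Suc K" by (intro mult_right_mono) auto
    then show ?thesis by (simp add: S_def)
  qed
  have supp: "u k n = 0" if "S k \<le> n" for k n
    using that
  proof (induction k arbitrary: n)
    case 0
    then show ?case using SK[of 0] by (simp add: u0 lo_def)
  next
    case (Suc k)
    have "2 * S k \<le> n" using Suc.prems by (simp add: S_def)
    then have "cubic (S k) (u k) (u k) (u k) n = 0" by (intro cubic_support[of "S k"] Suc.IH)
    then show ?case using SK[of "Suc k"] Suc.prems by (simp add: uS)
  qed
  have ulo: "u k n = c n" if "n < K" for k n
    using that by (cases k) (simp_all add: u0 uS lo_def)
  define z where "z = (\<lambda>k n. if n < K then 0 else u k n)"
  have uz: "u k = (\<lambda>n. lo n + z k n)" for k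
    by (auto simp: z_def lo_def ulo)
  have weighted: "ell2 \<rho> (\<lambda>n. of_real (\<theta> ^ n) * z k n)" for k
  proof (induction k)
    case 0
    have "ell2 \<rho> (\<lambda>n. 0)" using \<rho> by (simp add: ell2_def)
    moreover have "(\<lambda>n. of_real (\<theta> ^ n) * z 0 n) = (\<lambda>n. 0)" by (simp add: z_def u0 lo_def fun_eq_iff)
    ultimately show ?case by simp
  next
    case (Suc k)
    define p where "p = (\<lambda>n. of_real (\<theta> ^ n) * lo n)"
    define p' where "p' = (\<lambda>n. of_real (inverse (\<theta> ^ n)) * lo n)"
    define q where "q = (\<lambda>n. of_real (\<theta> ^ n) * z k n)"
    define q' where "q' = (\<lambda>n. of_real (inverse (\<theta> ^ n)) * z k n)"
    have inv: "inverse (\<theta> ^ n) \<le> 1" for n using \<theta>ge[of n] by (simp add: inverse_le_1_iff)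
    have p: "norm (p n) \<le> (if n < K then 2 * norm (c n) else 0)" for n
      using \<theta>K[of n] \<theta>0 by (auto simp: p_def lo_def norm_mult norm_power intro!: mult_right_mono)
    have p': "norm (p' n) \<le> (if n < K then 2 * norm (c n) else 0)" for n
    proof -
      have "inverse (\<theta> ^ n) * norm (c n) \<le> 2 * norm (c n)" using inv[of n] by (intro mult_right_mono) auto
      then show ?thesis using \<theta>0 by (simp add: p'_def lo_def norm_mult norm_power norm_inverse)
    qed
    have q: "ell2 \<rho> q" unfolding q_def by (rule Suc.IH)
    \<comment> \<open>Since \<theta> > 1, the inverse weight is dominated by the weight, so the
      conjugated slot inherits the bound of the induction hypothesis.\<close>
    have q': "ell2 \<rho> q'"
    proof (rule ell2_mono[OF q])
      fix n
      have "inverse (\<theta> ^ n) \<le> \<theta> ^ n" using inv[of n] \<theta>ge[of n] by linarith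
      then have "inverse (\<theta> ^ n) * norm (z k n) \<le> \<theta> ^ n * norm (z k n)" by (intro mult_right_mono) auto
      then show "norm (q' n) \<le> norm (q n)"
        using \<theta>0 by (simp add: q_def q'_def norm_mult norm_power norm_inverse)
    qed simp
    have pq: "(\<lambda>n. of_real (\<theta> ^ n) * u k n) = (\<lambda>n. p n + q n)"
      "(\<lambda>n. of_real (inverse (\<theta> ^ n)) * u k n) = (\<lambda>n. p' n + q' n)"
      unfolding p_def q_def p'_def q'_def uz by (simp_all add: distrib_left)
    have "of_real (\<theta> ^ n) * z (Suc k) n =
        lam * cubic_high K (S k) (\<lambda>n. p n + q n) (\<lambda>n. p n + q n) (\<lambda>n. p' n + q' n) n" for n
    proof (cases "n < K")
      case False
      have "of_real (\<theta> ^ n) * z (Suc k) n = lam * (of_real (\<theta> ^ n) * cubic (S k) (u k) (u k) (u k) n)"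
        using False by (simp add: z_def uS)
      then show ?thesis
        using False by (simp only: cubic_weighted[OF \<theta>0(1)] pq cubic_high_def if_False)
    qed (simp add: z_def cubic_high_def)
    then show ?case using invariance[OF p p' q q', of "S k"] by simp
  qed
  have zb: "ell2 \<rho> (z k)" for k
  proof (rule ell2_mono[OF weighted[of k]])
    fix n
    have "1 * norm (z k n) \<le> \<theta> ^ n * norm (z k n)" using \<theta>ge[of n] by (intro mult_right_mono) auto
    then show "norm (z k n) \<le> norm (of_real (\<theta> ^ n) * z k n)"
      using \<theta>0 by (simp add: norm_mult norm_power)
  qed simp
  have lop: "norm (lo n) \<le> (if n < K then 2 * norm (c n) else 0)" for n
    by (simp add: lo_def)
  have error: "ell2 (\<rho> / 2 ^ k) (\<lambda>n. u k n - c n)" for k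
  proof (induction k)
    case 0
    have "ell2 \<rho> (\<lambda>n. u 0 n - c n)" using tail by (rule ell2_mono) (auto simp: u0 lo_def)
    then show ?case by simp
  next
    case (Suc k)
    \<comment> \<open>The sequence c satisfies only a limiting equation. The new error is thus the
      pointwise limit of differences x j formed with truncations of c; once m j \<ge> S k, the sums
      cut at S k and at m j agree on u k, and \<open>contraction\<close> bounds x j uniformly in
      j.\<close>
    define x where "x = (\<lambda>j n. if n < K then 0 else lam * cubic (S k) (u k) (u k) (u k) n -
        lam * cubic (m j) (tr (m j)) (tr (m j)) (tr (m j)) n)"
    show ?case
    proof (rule ell2_limit)
      fix n
      show "(\<lambda>j. x j n) \<longlonglongrightarrow> u (Suc k) n - c n"
        by (cases "n < K") (auto simp: x_def uS intro!: tendsto_diff eq)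
    next
      have "\<forall>\<^sub>F j in sequentially. S k \<le> m j"
        using m unfolding filterlim_at_top by blast
      then show "\<forall>\<^sub>F j in sequentially. ell2 (\<rho> / 2 ^ Suc k) (x j)"
      proof (rule eventually_mono)
        fix j assume mj: "S k \<le> m j"
        define q' where "q' = (\<lambda>n. if n < K then 0 else tr (m j) n)"
        have q': "ell2 \<rho> q'" using tail by (rule ell2_mono) (auto simp: q'_def tr_def)
        have v: "tr (m j) = (\<lambda>n. lo n + q' n)"
          using mj SK[of k] by (auto simp: q'_def lo_def tr_def)
        have E: "ell2 (\<rho> / 2 ^ k) (\<lambda>n. u k n - tr (m j) n)"
          using Suc.IH by (rule ell2_mono) (use mj supp in \<open>auto simp: tr_def\<close>)
        have "ell2 (\<rho> / 2 ^ k / 2) (\<lambda>n. lam * (cubic_high K (m j) (u k) (u k) (u k) n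
            - cubic_high K (m j) (tr (m j)) (tr (m j)) (tr (m j)) n))"
          by (rule contraction[OF lop zb q' E uz v])
        moreover have "x j = (\<lambda>n. lam * (cubic_high K (m j) (u k) (u k) (u k) n
            - cubic_high K (m j) (tr (m j)) (tr (m j)) (tr (m j)) n))"
          using cubic_truncate[OF supp mj]
          by (simp add: x_def cubic_high_def fun_eq_iff right_diff_distrib)
        ultimately show "ell2 (\<rho> / 2 ^ Suc k) (x j)" by (simp add: mult.commute)
      qed
    qed
  qed
  have lim: "(\<lambda>k. u k n) \<longlonglongrightarrow> c n" for n
  proof -
    have "(\<lambda>k. \<rho> * (1 / 2) ^ k) \<longlonglongrightarrow> \<rho> * 0"
      by (intro tendsto_mult_left LIMSEQ_realpow_zero) auto
    then have "(\<lambda>k. \<rho> / 2 ^ k) \<longlonglongrightarrow> 0" by (simp add: power_divide)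
    then have "(\<lambda>k. u k n - c n) \<longlonglongrightarrow> 0"
      by (rule Lim_null_comparison[rotated]) (use ell2_component[OF error] in simp)
    then show ?thesis by (simp add: LIM_zero_iff)
  qed
  \<comment> \<open>The part 2 C serves n < K, where the weight is at most 2; the part \<rho> serves
    n \<ge> K, where the weighted bound passes to the limit of the iterates.\<close>
  have "norm (c n) \<le> (2 * C + \<rho>) * (1 / \<theta>) ^ n" for n
  proof (cases "n < K")
    case True
    have "norm (c n) * \<theta> ^ n \<le> C * 2"
      using ell2_component[OF c] \<theta>K[OF True] C \<theta>0 by (intro mult_mono) auto
    then have "norm (c n) * \<theta> ^ n \<le> 2 * C + \<rho>" using \<rho> by simp
    then show ?thesis using \<theta>0 by (simp add: power_divide field_simps)
  next
    case False
    have "(\<lambda>k. norm (of_real (\<theta> ^ n) * u k n)) \<longlonglongrightarrow> norm (of_real (\<theta> ^ n) * c n)"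
      by (intro tendsto_norm tendsto_mult_left lim)
    moreover have "norm (of_real (\<theta> ^ n) * u k n) \<le> \<rho>" for k
      using ell2_component[OF weighted[of k], of n] False by (simp add: z_def)
    ultimately have "norm (of_real (\<theta> ^ n) * c n) \<le> \<rho>"
      by (intro LIMSEQ_le_const2) auto
    then have "norm (c n) * \<theta> ^ n \<le> 2 * C + \<rho>"
      using C \<theta>0 by (simp add: norm_mult norm_power mult.commute)
    then show ?thesis using \<theta>0 by (simp add: power_divide field_simps)
  qed
  then show ?thesis
    using \<theta>1 by (intro exI[of _ "2 * C + \<rho>"] exI[of _ "1 / \<theta>"]) auto
qed

section \<open>Hermite series with geometric coefficients\<close>

lemma integrable_Cauchy_weight: "integrable lborel (\<lambda>x::real. inverse (1 + x\<^sup>2))"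
  and integral_Cauchy_weight: "(LINT x|lborel. inverse (1 + x\<^sup>2)) = pi"
  using integrable_inverse_1_plus_square LBINT_inverse_1_plus_square
  by (simp_all add: set_integrable_def interval_lebesgue_integral_def set_lebesgue_integral_def einterval_eq_UNIV)

lemma hh_second_moment:
  "integrable lborel (\<lambda>x. x\<^sup>2 * (hh n x)\<^sup>2)" "(LINT x|lborel. x\<^sup>2 * (hh n x)\<^sup>2) \<le> real n + 1"
proof -
  have ne: "n - Suc 0 \<noteq> Suc n" by arith
  have e: "x\<^sup>2 * (hh n x)\<^sup>2 = (\<Sum>j\<in>{n - 1, Suc n}. (if j = Suc n then sqrt ((n + 1) / 2) else sqrt (n / 2)) * hh j x)\<^sup>2" for x
  proof -
    have "sqrt 2 * (x * hh n x) = sqrt (n + 1) * hh (Suc n) x + sqrt n * hh (n - 1) x"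
      using hh_rec[of n x] by (simp add: add.commute)
    then have "x * hh n x = sqrt ((n + 1) / 2) * hh (Suc n) x + sqrt (n / 2) * hh (n - 1) x"
      by (simp add: real_sqrt_divide field_simps)
    then show ?thesis by (simp add: power_mult_distrib[symmetric] add.commute ne)
  qed
  show "integrable lborel (\<lambda>x. x\<^sup>2 * (hh n x)\<^sup>2)"
    unfolding e by (rule integral_hh_sum_sq_real) simp
  have "(LINT x|lborel. x\<^sup>2 * (hh n x)\<^sup>2) = (\<Sum>j\<in>{n - 1, Suc n}. (if j = Suc n then sqrt ((n + 1) / 2) else sqrt (n / 2))\<^sup>2)"
    unfolding e by (rule integral_hh_sum_sq_real) simp
  also have "\<dots> \<le> real n + 1" by (simp add: ne field_simps)
  finally show "(LINT x|lborel. x\<^sup>2 * (hh n x)\<^sup>2) \<le> real n + 1" .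
qed

text \<open>Arithmetic-geometric mean against the Cauchy weight: 2 |h| \<le> (1 + x^2) h^2 + 1 / (1
  + x^2), where the second moment grows linearly in n and the last term has integral pi.\<close>

lemma hh_L1_bound: "(LINT x|lborel. \<bar>hh n x\<bar>) \<le> real n + 3"
proof -
  have i2: "integrable lborel (\<lambda>x. (hh n x)\<^sup>2)" "(LINT x|lborel. (hh n x)\<^sup>2) = 1"
    using integrable_hh2[of n n] hh_orthonormal[of n n] by (simp_all add: power2_eq_square)
  have "(LINT x|lborel. \<bar>hh n x\<bar>) \<le>
      (LINT x|lborel. 1 / 2 * ((hh n x)\<^sup>2 + x\<^sup>2 * (hh n x)\<^sup>2 + inverse (1 + x\<^sup>2)))"
  proof (intro integral_mono integrable_mult_right Bochner_Integration.integrable_add i2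
      hh_second_moment integrable_Cauchy_weight integrable_abs integrable_hh)
    fix x :: real
    define w where "w = 1 + x\<^sup>2"
    have w: "0 < w" by (simp add: w_def add_pos_nonneg)
    have "2 * (sqrt w * \<bar>hh n x\<bar>) * (1 / sqrt w) \<le> (sqrt w * \<bar>hh n x\<bar>)\<^sup>2 + (1 / sqrt w)\<^sup>2"
      by (rule sum_squares_bound)
    then have "2 * \<bar>hh n x\<bar> \<le> w * (hh n x)\<^sup>2 + inverse w"
      using w by (simp add: power_mult_distrib power_divide inverse_eq_divide)
    then show "\<bar>hh n x\<bar> \<le> 1 / 2 * ((hh n x)\<^sup>2 + x\<^sup>2 * (hh n x)\<^sup>2 + inverse (1 + x\<^sup>2))"
      by (simp add: w_def algebra_simps)
  qed
  also have "\<dots> = 1 / 2 * (1 + (LINT x|lborel. x\<^sup>2 * (hh n x)\<^sup>2) + pi)"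
    using i2 hh_second_moment(1)[of n] integrable_Cauchy_weight integral_Cauchy_weight by simp
  also have "\<dots> \<le> 1 / 2 * (1 + (real n + 1) + 4)"
    using hh_second_moment(2)[of n] pi_less_4 by simp
  also have "\<dots> \<le> real n + 3" by simp
  finally show ?thesis .
qed

text \<open>Up to a unimodular factor h_n is its own Fourier transform, so its supremum is at most
  its L1 norm.\<close>

lemma hh_sup_bound: "\<bar>hh n x\<bar> \<le> real n + 3"
proof -
  have "\<bar>hh n x\<bar> = norm (fourier_transform (hermite_fun n) x)"
    by (simp add: fourier_hermite_fun hermite_fun_hh norm_mult norm_power)
  also have "\<dots> = 1 / sqrt (2 * pi) * norm (LINT y|lborel. exp (- \<i> * of_real (y * x)) * complex_of_real (hh n y))"
    by (simp add: fourier_transform_def norm_mult norm_divide hermite_fun_hh)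
  also have "\<dots> \<le> 1 * norm (LINT y|lborel. exp (- \<i> * of_real (y * x)) * complex_of_real (hh n y))"
  proof (intro mult_right_mono)
    have "1 \<le> sqrt (2 * pi)" using pi_ge_two by simp
    then show "1 / sqrt (2 * pi) \<le> 1" by simp
  qed simp
  also have "\<dots> \<le> (LINT y|lborel. norm (exp (- \<i> * of_real (y * x)) * complex_of_real (hh n y)))"
    using integral_norm_bound by simp
  also have "\<dots> = (LINT y|lborel. \<bar>hh n y\<bar>)" by (simp add: norm_mult)
  also have "\<dots> \<le> real n + 3" by (rule hh_L1_bound)
  finally show ?thesis .
qed

text \<open>The recurrence trades each factor x for the two neighbouring Hermite functions. Both
  contributions are bounded by the same quantity Q, and 2 Q divided by the sqrt 2 of the recurrence
  is the next bound.\<close>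

lemma hh_power_bound:
  "\<bar>x\<bar> ^ j * \<bar>hh n x\<bar> \<le> sqrt 2 ^ j * sqrt (fact (n + j) / fact n) * (real n + real j + 3)"
proof (induction j arbitrary: n)
  case 0
  then show ?case using hh_sup_bound[of n x] by simp
next
  case (Suc j)
  define Q where "Q = sqrt 2 ^ j * sqrt (fact (n + Suc j) / fact n) * (real n + real (Suc j) + 3)"
  have rec: "sqrt 2 * (\<bar>x\<bar> * \<bar>hh n x\<bar>) \<le> sqrt (Suc n) * \<bar>hh (Suc n) x\<bar> + sqrt n * \<bar>hh (n - 1) x\<bar>"
  proof -
    have "sqrt 2 * (\<bar>x\<bar> * \<bar>hh n x\<bar>) = \<bar>sqrt 2 * x * hh n x\<bar>" by (simp add: abs_mult)
    also have "sqrt 2 * x * hh n x = sqrt (Suc n) * hh (Suc n) x + sqrt n * hh (n - 1) x"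
      using hh_rec[of n x] by simp
    also have "\<bar>\<dots>\<bar> \<le> \<bar>sqrt (Suc n) * hh (Suc n) x\<bar> + \<bar>sqrt n * hh (n - 1) x\<bar>" by (rule abs_triangle_ineq)
    finally show ?thesis by (simp add: abs_mult)
  qed
  have up: "sqrt (Suc n) * (\<bar>x\<bar> ^ j * \<bar>hh (Suc n) x\<bar>) \<le> Q"
  proof -
    have "sqrt (Suc n) * (\<bar>x\<bar> ^ j * \<bar>hh (Suc n) x\<bar>) \<le>
        sqrt (Suc n) * (sqrt 2 ^ j * sqrt (fact (Suc n + j) / fact (Suc n)) * (real (Suc n) + real j + 3))"
      by (intro mult_left_mono Suc.IH) auto
    also have "\<dots> = sqrt 2 ^ j * (sqrt (Suc n) * sqrt (fact (Suc n + j) / fact (Suc n))) * (real (Suc n) + real j + 3)"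
      by (simp only: mult_ac)
    also have "sqrt (Suc n) * sqrt (fact (Suc n + j) / fact (Suc n)) = sqrt (fact (n + Suc j) / fact n)"
    proof -
      have f: "fact (Suc n) = real (Suc n) * fact n" by (rule fact_Suc)
      have "real (Suc n) * (fact (Suc n + j) / fact (Suc n)) = fact (n + Suc j) / fact n"
        unfolding f by (simp del: fact_Suc of_nat_Suc)
      then show ?thesis unfolding real_sqrt_mult[symmetric] by (rule arg_cong)
    qed
    finally show ?thesis unfolding Q_def by (simp add: add_ac)
  qed
  have down: "sqrt n * (\<bar>x\<bar> ^ j * \<bar>hh (n - 1) x\<bar>) \<le> Q"
  proof (cases n)
    case 0
    then show ?thesis by (simp add: Q_def)
  next
    case (Suc k)
    have "sqrt n * (\<bar>x\<bar> ^ j * \<bar>hh k x\<bar>) \<le>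
        sqrt n * (sqrt 2 ^ j * sqrt (fact (k + j) / fact k) * (real k + real j + 3))"
      by (intro mult_left_mono Suc.IH) auto
    also have "\<dots> = sqrt 2 ^ j * (sqrt n * sqrt (fact (k + j) / fact k)) * (real k + real j + 3)"
      by (simp only: mult_ac)
    also have "\<dots> \<le> Q" unfolding Q_def
    proof (intro mult_mono)
      have "real n * real n \<le> real (n + j) * real (n + Suc j)" by (intro mult_mono) auto
      moreover have "N * (F / f) \<le> (P * F) / (N * f)" if "N * N \<le> P" "0 < N" "0 < F" "0 < f" for N P F f :: real
      proof -
        have "(N * N) * (F / (N * f)) \<le> P * (F / (N * f))" using that by (intro mult_right_mono) auto
        then show ?thesis using that by simp
      qed
      moreover have "fact (n + Suc j) = (real (n + j) * real (n + Suc j)) * fact (k + j)"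
      proof -
        have "fact (n + Suc j) = real (n + Suc j) * fact (n + j)" by (simp only: add_Suc_right fact_Suc)
        also have "fact (n + j) = real (n + j) * fact (k + j)" by (simp only: Suc add_Suc fact_Suc)
        finally show ?thesis by simp
      qed
      moreover have "fact n = real n * fact k" by (simp only: Suc fact_Suc)
      ultimately have "real n * (fact (k + j) / fact k) \<le> fact (n + Suc j) / fact n"
        using Suc by (simp only:) simp
      then have "sqrt (real n * (fact (k + j) / fact k)) \<le> sqrt (fact (n + Suc j) / fact n)"
        by (rule real_sqrt_le_mono)
      then show "sqrt n * sqrt (fact (k + j) / fact k) \<le> sqrt (fact (n + Suc j) / fact n)"
        by (simp only: real_sqrt_mult)
    qed (auto simp: Suc)
    finally show ?thesis using Suc by simp
  qed
  have "sqrt 2 * (\<bar>x\<bar> ^ Suc j * \<bar>hh n x\<bar>) = \<bar>x\<bar> ^ j * (sqrt 2 * (\<bar>x\<bar> * \<bar>hh n x\<bar>))" by simp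
  also have "\<dots> \<le> \<bar>x\<bar> ^ j * (sqrt (Suc n) * \<bar>hh (Suc n) x\<bar> + sqrt n * \<bar>hh (n - 1) x\<bar>)"
    by (intro mult_left_mono rec) auto
  also have "\<dots> = sqrt (Suc n) * (\<bar>x\<bar> ^ j * \<bar>hh (Suc n) x\<bar>) + sqrt n * (\<bar>x\<bar> ^ j * \<bar>hh (n - 1) x\<bar>)"
    by (simp only: distrib_left mult_ac)
  also have "\<dots> \<le> Q + Q" by (intro add_mono up down)
  also have "\<dots> = sqrt 2 * (sqrt 2 * Q)" by simp
  finally have "\<bar>x\<bar> ^ Suc j * \<bar>hh n x\<bar> \<le> sqrt 2 * Q" by (subst (asm) mult_le_cancel_left_pos) auto
  then show ?case by (simp add: Q_def mult_ac)
qed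

text \<open>The quotient is C(n + 2i, n) C(2i, i) (i!)^2. A single term of the expansion of (p + (1
  - p))^(n + 2i) bounds the first factor and 4^i the second. With p close to 1 the growth in n
  becomes as slow as desired, at the expense of the geometric factor in i.\<close>

lemma trinomial_bound:
  fixes p :: real
  assumes "0 < p" "p < 1"
  shows "fact (n + 2 * i) / fact n \<le> (1 / p) ^ n * ((2 / (1 - p)) ^ i * fact i)\<^sup>2"
proof -
  have A: "real ((n + 2 * i) choose n) * p ^ n * (1 - p) ^ (2 * i) \<le> 1"
  proof -
    have "real ((n + 2 * i) choose n) * p ^ n * (1 - p) ^ (n + 2 * i - n) \<le>
      (\<Sum>k\<le>n + 2 * i. real ((n + 2 * i) choose k) * p ^ k * (1 - p) ^ (n + 2 * i - k))"
      using assms by (intro member_le_sum) auto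
    also have "\<dots> = (p + (1 - p)) ^ (n + 2 * i)" by (rule binomial_ring[symmetric])
    finally show ?thesis by simp
  qed
  have B: "real ((2 * i) choose i) \<le> 4 ^ i"
  proof -
    have "((2 * i) choose i) \<le> (\<Sum>k\<le>2 * i. (2 * i) choose k)" by (intro member_le_sum) auto
    also have "\<dots> = 2 ^ (2 * i)" by (rule choose_row_sum)
    finally have "real ((2 * i) choose i) \<le> real (2 ^ (2 * i))" by (simp only: of_nat_le_iff)
    then show ?thesis by (simp add: power_mult)
  qed
  have f: "fact (n + 2 * i) / fact n = real ((n + 2 * i) choose n) * (real ((2 * i) choose i) * (fact i)\<^sup>2)"
    using binomial_fact[of n "n + 2 * i", where 'a = real] binomial_fact[of i "2 * i", where 'a = real]
    by (simp add: power2_eq_square field_simps)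
  have "real ((n + 2 * i) choose n) \<le> (1 / p) ^ n * (1 / (1 - p)) ^ (2 * i)"
    using A assms by (simp add: power_divide field_simps)
  then have "fact (n + 2 * i) / fact n \<le> ((1 / p) ^ n * (1 / (1 - p)) ^ (2 * i)) * (4 ^ i * (fact i)\<^sup>2)"
    unfolding f using B assms by (intro mult_mono) auto
  also have "\<dots> = (1 / p) ^ n * ((2 / (1 - p)) ^ i * fact i)\<^sup>2"
  proof -
    have "((2 / (1 - p)) ^ i)\<^sup>2 = ((2 / (1 - p))\<^sup>2) ^ i" by (simp only: power_mult[symmetric] mult.commute)
    also have "(2 / (1 - p))\<^sup>2 = 4 * (1 / (1 - p))\<^sup>2" by (simp add: power_divide)
    finally have "((2 / (1 - p)) ^ i)\<^sup>2 = 4 ^ i * (1 / (1 - p)) ^ (2 * i)"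
      by (simp only: power_mult_distrib power_mult)
    then show ?thesis by (simp only: power_mult_distrib mult_ac)
  qed
  finally show ?thesis .
qed

lemma linear_le_exponential:
  fixes w :: real
  assumes "1 < w"
  shows "real n + 3 \<le> (3 + 1 / (w - 1)) * w ^ n"
proof -
  have b: "1 + real n * (w - 1) \<le> w ^ n"
    using Bernoulli_inequality[of "w - 1" n] assms by simp
  have "real n * (w - 1) \<le> w ^ n" using b by simp
  then have "real n \<le> w ^ n / (w - 1)" using assms by (simp add: field_simps)
  moreover have "3 * 1 \<le> 3 * w ^ n" using assms by (intro mult_left_mono one_le_power) auto
  ultimately show ?thesis by (simp add: algebra_simps)
qed

text \<open>Expand exp(\<alpha> x^2) and use \<open>hh_power_bound\<close> with exponent 2 i: up to
  geometric factors the square root of (n + 2i)! / n! grows like i!, which the factorial of the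
  exponential series cancels.\<close>

lemma hh_gaussian_bound:
  fixes q :: real
  assumes "1 < q"
  shows "\<exists>\<alpha>>0. \<exists>C. \<forall>n x. exp (\<alpha> * x\<^sup>2) * \<bar>hh n x\<bar> \<le> C * q ^ n"
proof -
  \<comment> \<open>One factor w^n pays for the factorials, through p = 1 / w^2; the other absorbs
    the linear term n + 3.\<close>
  define w where "w = sqrt q"
  have w: "1 < w" "w * w = q" using assms by (simp_all add: w_def)
  define p where "p = 1 / w\<^sup>2"
  have "1 < w\<^sup>2" using w(1) by (simp add: one_less_power)
  moreover have "w \<noteq> 0" using w(1) by simp
  ultimately have p: "0 < p" "p < 1" by (simp_all add: p_def divide_less_eq)
  \<comment> \<open>Makes the ratio 8 \<alpha> / (1 - p) of the majorizing series in i equal to 1 /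
    2.\<close>
  define \<alpha> where "\<alpha> = (1 - p) / 16"
  have \<alpha>: "0 < \<alpha>" using p by (simp add: \<alpha>_def)
  have tb: "(\<alpha> * x\<^sup>2) ^ i / fact i * \<bar>hh n x\<bar> \<le> w ^ n * (real n + 3) * (1 / 2) ^ i" for i n x
  proof -
    have "(\<alpha> * x\<^sup>2) ^ i / fact i * \<bar>hh n x\<bar> = \<alpha> ^ i / fact i * (\<bar>x\<bar> ^ (2 * i) * \<bar>hh n x\<bar>)"
      by (simp add: power_mult_distrib power_mult)
    also have "\<dots> \<le> \<alpha> ^ i / fact i * (sqrt 2 ^ (2 * i) * sqrt (fact (n + 2 * i) / fact n) * (real n + real (2 * i) + 3))"
      using \<alpha> by (intro mult_left_mono hh_power_bound) auto
    also have "\<dots> \<le> \<alpha> ^ i / fact i * (2 ^ i * (w ^ n * ((2 / (1 - p)) ^ i * fact i)) * ((real n + 3) * 2 ^ i))"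
    proof (intro mult_left_mono mult_mono)
      show "sqrt 2 ^ (2 * i) \<le> (2::real) ^ i" by (simp add: power_mult)
      have "sqrt (fact (n + 2 * i) / fact n) \<le> sqrt ((1 / p) ^ n * ((2 / (1 - p)) ^ i * fact i)\<^sup>2)"
        by (intro real_sqrt_le_mono trinomial_bound p)
      also have "\<dots> = w ^ n * ((2 / (1 - p)) ^ i * fact i)"
      proof -
        have "(1 / p) ^ n * ((2 / (1 - p)) ^ i * fact i)\<^sup>2 = (w ^ n * ((2 / (1 - p)) ^ i * fact i))\<^sup>2"
          using w by (simp add: p_def power_mult_distrib power_mult[symmetric] mult.commute)
        then show ?thesis using w p by simp
      qed
      finally show "sqrt (fact (n + 2 * i) / fact n) \<le> w ^ n * ((2 / (1 - p)) ^ i * fact i)" .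
      have "1 + real i * 1 \<le> 2 ^ i" using Bernoulli_inequality[of 1 i] by simp
      then have "(real n + 3) * (1 + real i) \<le> (real n + 3) * 2 ^ i" by (intro mult_left_mono) auto
      moreover have "real n + real (2 * i) + 3 \<le> (real n + 3) * (1 + real i)" by (simp add: algebra_simps)
      ultimately show "real n + real (2 * i) + 3 \<le> (real n + 3) * 2 ^ i" by linarith
    qed (use \<alpha> w p in auto)
    also have "\<dots> = w ^ n * (real n + 3) * (\<alpha> * 2 * (2 / (1 - p)) * 2) ^ i"
      unfolding power_mult_distrib by (simp add: mult_ac)
    also have "\<alpha> * 2 * (2 / (1 - p)) * 2 = 1 / 2" using p by (simp add: \<alpha>_def)
    finally show ?thesis .
  qed
  have bound: "exp (\<alpha> * x\<^sup>2) * \<bar>hh n x\<bar> \<le> 2 * (w ^ n * (real n + 3))" for n x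
  proof -
    have "(\<lambda>i. (\<alpha> * x\<^sup>2) ^ i / fact i * \<bar>hh n x\<bar>) sums (exp (\<alpha> * x\<^sup>2) * \<bar>hh n x\<bar>)"
      using exp_converges[of "\<alpha> * x\<^sup>2"] by (intro sums_mult2) (simp add: divide_inverse mult.commute)
    moreover have "(\<lambda>i. w ^ n * (real n + 3) * (1 / 2) ^ i) sums (w ^ n * (real n + 3) * (1 / (1 - 1 / 2)))"
      by (intro sums_mult geometric_sums) simp
    ultimately have "exp (\<alpha> * x\<^sup>2) * \<bar>hh n x\<bar> \<le> w ^ n * (real n + 3) * (1 / (1 - 1 / 2))"
      by (intro sums_le[OF tb])
    then show ?thesis by simp
  qed
  have "exp (\<alpha> * x\<^sup>2) * \<bar>hh n x\<bar> \<le> (2 * (3 + 1 / (w - 1))) * q ^ n" for n x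
  proof -
    have "2 * (w ^ n * (real n + 3)) \<le> 2 * (w ^ n * ((3 + 1 / (w - 1)) * w ^ n))"
      using w by (intro mult_left_mono linear_le_exponential) auto
    also have "\<dots> = (2 * (3 + 1 / (w - 1))) * (w * w) ^ n" by (simp add: power_mult_distrib)
    finally show ?thesis using bound[of x n] w by simp
  qed
  then show ?thesis using \<alpha> by blast
qed

text \<open>The entire extension of h_n. Defining it by the recurrence lets holomorphy and growth in
  n be proved by induction.\<close>

fun hz :: "nat \<Rightarrow> complex \<Rightarrow> complex" where
  "hz 0 z = exp (- z\<^sup>2 / 2) / of_real (sqrt (sqrt pi))"
| "hz (Suc n) z = (of_real (sqrt 2) * z * hz n z - of_real (sqrt n) * hz (n - 1) z) / of_real (sqrt (Suc n))"

declare hz.simps(2) [simp del]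

lemma hz_of_real: "hz n (of_real x) = of_real (hh n x)"
proof (induction n rule: less_induct)
  case (less n)
  show ?case
  proof (cases n)
    case 0
    have "exp (- (complex_of_real x)\<^sup>2 / 2) = of_real (exp (- x\<^sup>2 / 2))"
      by (simp flip: exp_of_real)
    then show ?thesis using 0 by (simp add: hh_0)
  next
    case (Suc m)
    have "hz (Suc m) (of_real x) = of_real ((sqrt 2 * x * hh m x - sqrt m * hh (m - 1) x) / sqrt (Suc m))"
      using less.IH[of m] less.IH[of "m - 1"] Suc by (simp add: hz.simps(2) del: of_nat_Suc)
    also have "(sqrt 2 * x * hh m x - sqrt m * hh (m - 1) x) / sqrt (Suc m) = hh (Suc m) x"
      unfolding hh_rec[symmetric] by (simp del: of_nat_Suc)
    finally show ?thesis using Suc by simp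
  qed
qed

lemma hz_holomorphic: "hz n holomorphic_on UNIV"
proof (induction n rule: less_induct)
  case (less n)
  show ?case
  proof (cases n)
    case 0
    have "(\<lambda>z. exp (- z\<^sup>2 / 2) / of_real (sqrt (sqrt pi))) holomorphic_on UNIV"
      by (intro holomorphic_intros) auto
    then show ?thesis using 0 by (simp add: hz.simps(1)[abs_def])
  next
    case (Suc m)
    have "hz m holomorphic_on UNIV" "hz (m - 1) holomorphic_on UNIV"
      using less.IH[of m] less.IH[of "m - 1"] Suc by auto
    then have "(\<lambda>z. (of_real (sqrt 2) * z * hz m z - of_real (sqrt m) * hz (m - 1) z) / of_real (sqrt (Suc m)))
        holomorphic_on UNIV"
      by (intro holomorphic_intros) auto
    then show ?thesis using Suc by (simp add: hz.simps(2)[abs_def] del: of_nat_Suc)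
  qed
qed

text \<open>For |z| \<le> R a step of the recurrence enlarges the bound by at most 1 + sqrt 2 R /
  sqrt (k + 1), which does not exceed q once k \<ge> n0; the finitely many earlier functions are
  bounded on the disc by compactness.\<close>

lemma hz_growth:
  fixes q R :: real
  assumes "1 < q" "0 \<le> R"
  shows "\<exists>C. \<forall>n z. norm z \<le> R \<longrightarrow> norm (hz n z) \<le> C * q ^ n"
proof -
  obtain n0 :: nat where n0: "(sqrt 2 * R / (q - 1))\<^sup>2 \<le> real n0" using real_arch_simple by blast
  have "\<exists>B. \<forall>z\<in>cball 0 R. norm (hz k z) \<le> B" for k
  proof -
    have "continuous_on (cball 0 R) (hz k)"
      using holomorphic_on_imp_continuous_on[OF hz_holomorphic] continuous_on_subset by blast
    then have "bounded (hz k ` cball 0 R)" by (intro compact_imp_bounded compact_continuous_image) auto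
    then show ?thesis unfolding bounded_iff by auto
  qed
  then have "\<exists>b. \<forall>k. \<forall>z\<in>cball 0 R. norm (hz k z) \<le> b k" by (intro choice allI)
  then obtain b where "\<forall>k. \<forall>z\<in>cball 0 R. norm (hz k z) \<le> b k" by blast
  then have b: "norm z \<le> R \<Longrightarrow> norm (hz k z) \<le> b k" for k z by simp
  define C where "C = (\<Sum>k\<le>n0. \<bar>b k\<bar>)"
  have C0: "0 \<le> C" by (simp add: C_def sum_nonneg)
  have "norm (hz n z) \<le> C * q ^ n" if z: "norm z \<le> R" for n z
  proof (induction n rule: less_induct)
    case (less n)
    show ?case
    proof (cases "n \<le> n0")
      case True
      have "norm (hz n z) \<le> \<bar>b n\<bar>" using b[OF z, of n] by linarith
      also have "\<bar>b n\<bar> \<le> C" unfolding C_def using True by (intro member_le_sum) auto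
      also have "C * 1 \<le> C * q ^ n" using assms C0 by (intro mult_left_mono one_le_power) auto
      finally show ?thesis by simp
    next
      case False
      then obtain k where k: "n = Suc k" "n0 \<le> k" by (cases n) auto
      have s: "0 < sqrt (Suc k)" by simp
      have "sqrt 2 * R / (q - 1) \<le> sqrt (Suc k)"
        using n0 k by (intro real_le_rsqrt) simp
      then have r: "sqrt 2 * R / sqrt (Suc k) \<le> q - 1"
        using assms s by (simp add: field_simps)
      have i1: "norm (hz k z) \<le> C * q ^ k" using less.IH[of k] k by simp
      have i2: "sqrt k * norm (hz (k - 1) z) \<le> sqrt (Suc k) * (C * q ^ k)"
      proof (intro mult_mono)
        have "norm (hz (k - 1) z) \<le> C * q ^ (k - 1)" using less.IH[of "k - 1"] k by simp
        also have "\<dots> \<le> C * q ^ k" using assms C0 by (intro mult_left_mono power_increasing) auto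
        finally show "norm (hz (k - 1) z) \<le> C * q ^ k" .
      qed auto
      have "norm (hz n z) = norm (of_real (sqrt 2) * z * hz k z - of_real (sqrt k) * hz (k - 1) z) / sqrt (Suc k)"
        unfolding k(1) hz.simps(2) by (simp add: norm_divide del: of_nat_Suc)
      also have "\<dots> \<le> (sqrt 2 * norm z * norm (hz k z) + sqrt k * norm (hz (k - 1) z)) / sqrt (Suc k)"
        by (intro divide_right_mono order_trans[OF norm_triangle_ineq4]) (simp_all add: norm_mult)
      also have "\<dots> \<le> (sqrt 2 * R * (C * q ^ k) + sqrt (Suc k) * (C * q ^ k)) / sqrt (Suc k)"
        using z assms by (intro divide_right_mono add_mono mult_mono i1 i2) auto
      also have "\<dots> = (sqrt 2 * R / sqrt (Suc k) + 1) * (C * q ^ k)"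
        using s by (simp add: add_divide_distrib distrib_right del: of_nat_Suc)
      also have "\<dots> \<le> q * (C * q ^ k)"
        using r C0 assms by (intro mult_right_mono) auto
      finally show ?thesis by (simp add: k mult_ac)
    qed
  qed
  then show ?thesis by blast
qed

text \<open>The first claim is uniform over all d with the given modulus bound, so that one \<alpha>
  serves a function and its Fourier transform, whose coefficients differ by unimodular
  factors.\<close>

lemma geometric_hermite_series:
  fixes c :: "nat \<Rightarrow> complex" and A r :: real
  assumes r: "0 < r" "r < 1" and c: "\<And>n. norm (c n) \<le> A * r ^ n"
  shows "\<exists>\<alpha>>0. \<exists>B. \<forall>(d :: nat \<Rightarrow> complex) x. (\<forall>n. norm (d n) \<le> A * r ^ n) \<longrightarrow>
      summable (\<lambda>n. norm (d n * of_real (hh n x))) \<and>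
      norm (\<Sum>n. d n * of_real (hh n x)) * exp (\<alpha> * x\<^sup>2) \<le> B"
    and "\<exists>\<Phi>. \<Phi> holomorphic_on UNIV \<and> (\<forall>x. \<Phi> (of_real x) = (\<Sum>n. c n * of_real (hh n x)))"
proof -
  \<comment> \<open>Splits the decay in two: one factor sqrt r pays for the growth of the Hermite
    functions, and r q = sqrt r < 1 still sums.\<close>
  define q where "q = 1 / sqrt r"
  have q: "1 < q" using r by (simp add: q_def)
  define s where "s = r * q"
  have "s = sqrt r" unfolding s_def q_def using r by (simp add: real_div_sqrt)
  then have s: "0 < s" "s < 1" using r by simp_all
  have A0: "0 \<le> A" using order_trans[OF norm_ge_zero c[of 0]] by simp
  obtain \<alpha> C where \<alpha>: "\<alpha> > 0" and C: "\<And>n x. exp (\<alpha> * x\<^sup>2) * \<bar>hh n x\<bar> \<le> C * q ^ n"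
    using hh_gaussian_bound[OF q] by blast
  have sm: "summable (\<lambda>n. A * C' * s ^ n)" for C'
    using s by (intro summable_mult summable_geometric) simp
  show "\<exists>\<alpha>>0. \<exists>B. \<forall>(d :: nat \<Rightarrow> complex) x. (\<forall>n. norm (d n) \<le> A * r ^ n) \<longrightarrow>
      summable (\<lambda>n. norm (d n * of_real (hh n x))) \<and>
      norm (\<Sum>n. d n * of_real (hh n x)) * exp (\<alpha> * x\<^sup>2) \<le> B"
  proof (rule exI[of _ \<alpha>], rule conjI[OF \<alpha>], rule exI[of _ "\<Sum>n. A * C * s ^ n"], intro allI impI conjI)
    fix d :: "nat \<Rightarrow> complex" and x :: real
    assume d: "\<forall>n. norm (d n) \<le> A * r ^ n"
    have le: "norm (d n * of_real (hh n x)) * exp (\<alpha> * x\<^sup>2) \<le> A * C * s ^ n" for n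
    proof -
      have "norm (d n * of_real (hh n x)) * exp (\<alpha> * x\<^sup>2) = norm (d n) * (exp (\<alpha> * x\<^sup>2) * \<bar>hh n x\<bar>)"
        by (simp add: norm_mult mult_ac)
      also have "\<dots> \<le> (A * r ^ n) * (C * q ^ n)"
        using d A0 r by (intro mult_mono C) auto
      finally show ?thesis by (simp add: s_def power_mult_distrib mult_ac)
    qed
    have le1: "norm (d n * of_real (hh n x)) \<le> A * C * s ^ n" for n
    proof -
      have "1 \<le> exp (\<alpha> * x\<^sup>2)" using \<alpha> by simp
      then have "norm (d n * of_real (hh n x)) * 1 \<le> norm (d n * of_real (hh n x)) * exp (\<alpha> * x\<^sup>2)"
        by (intro mult_left_mono) auto
      then show ?thesis using le[of n] by linarith
    qed
    show sum: "summable (\<lambda>n. norm (d n * of_real (hh n x)))"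
      by (rule summable_comparison_test'[OF sm[of C], of 0]) (use le1 in simp)
    have "norm (\<Sum>n. d n * of_real (hh n x)) * exp (\<alpha> * x\<^sup>2) \<le>
        (\<Sum>n. norm (d n * of_real (hh n x))) * exp (\<alpha> * x\<^sup>2)"
      by (intro mult_right_mono summable_norm sum) auto
    also have "\<dots> = (\<Sum>n. norm (d n * of_real (hh n x)) * exp (\<alpha> * x\<^sup>2))"
      by (rule suminf_mult2[OF sum])
    also have "\<dots> \<le> (\<Sum>n. A * C * s ^ n)"
      by (rule suminf_le[OF le summable_mult2[OF sum] sm])
    finally show "norm (\<Sum>n. d n * of_real (hh n x)) * exp (\<alpha> * x\<^sup>2) \<le> (\<Sum>n. A * C * s ^ n)" .
  qed
  define \<Phi> where "\<Phi> = (\<lambda>z. \<Sum>n. c n * hz n z)"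
  have "\<Phi> holomorphic_on UNIV"
  proof (rule holomorphic_uniform_sequence[of _ "\<lambda>N z. \<Sum>n<N. c n * hz n z"])
    show "(\<lambda>z. \<Sum>n<N. c n * hz n z) holomorphic_on UNIV" for N
      by (intro holomorphic_intros hz_holomorphic)
    fix z :: complex
    obtain C where C: "\<And>n w. norm w \<le> norm z + 1 \<Longrightarrow> norm (hz n w) \<le> C * q ^ n"
      using hz_growth[OF q, of "norm z + 1"] by auto
    have "uniform_limit (cball z 1) (\<lambda>N z. \<Sum>n<N. c n * hz n z) \<Phi> sequentially"
      unfolding \<Phi>_def
    proof (rule Weierstrass_m_test[OF _ sm[of C]])
      fix n w assume "w \<in> cball z 1"
      then have w: "norm w \<le> norm z + 1"
        using norm_triangle_sub[of w z] by (simp add: dist_norm norm_minus_commute)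
      have "norm (c n * hz n w) \<le> (A * r ^ n) * (C * q ^ n)"
        unfolding norm_mult using A0 r by (intro mult_mono c C w) auto
      then show "norm (c n * hz n w) \<le> A * C * s ^ n" by (simp add: s_def power_mult_distrib mult_ac)
    qed
    then show "\<exists>d>0. cball z d \<subseteq> UNIV \<and> uniform_limit (cball z d) (\<lambda>N z. \<Sum>n<N. c n * hz n z) \<Phi> sequentially"
      by (intro exI[of _ 1]) auto
  qed simp
  then show "\<exists>\<Phi>. \<Phi> holomorphic_on UNIV \<and> (\<forall>x. \<Phi> (of_real x) = (\<Sum>n. c n * of_real (hh n x)))"
    by (intro exI[of _ \<Phi>]) (simp add: \<Phi>_def hz_of_real)
qed

lemma fourier_hermite_series:
  fixes c :: "nat \<Rightarrow> complex" and A r :: real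
  assumes r: "0 < r" "r < 1" and c: "\<And>n. norm (c n) \<le> A * r ^ n"
  shows "fourier_transform (\<lambda>x. \<Sum>n. c n * of_real (hh n x)) \<xi> =
    (\<Sum>n. (c n * (- \<i>) ^ n) * of_real (hh n \<xi>))"
proof -
  define E where "E = (\<lambda>n x. exp (- \<i> * of_real (x * \<xi>)) * (c n * complex_of_real (hh n x)))"
  have A0: "0 \<le> A" using order_trans[OF norm_ge_zero c[of 0]] by simp
  have nE: "norm (E n x) = norm (c n) * \<bar>hh n x\<bar>" for n x by (simp add: E_def norm_mult)
  have int: "integrable lborel (E n)" for n
  proof (rule Bochner_Integration.integrable_bound)
    show "integrable lborel (\<lambda>x. norm (c n) * \<bar>hh n x\<bar>)"
      by (intro integrable_mult_right integrable_abs integrable_hh)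
    show "AE x in lborel. norm (E n x) \<le> norm (norm (c n) * \<bar>hh n x\<bar>)" by (simp add: nE)
    have "continuous_on UNIV (E n)" unfolding E_def by (intro continuous_intros isCont_hh)
    then show "E n \<in> borel_measurable lborel" by (simp add: borel_measurable_continuous_onI)
  qed
  obtain \<alpha> B where ser: "\<forall>(d :: nat \<Rightarrow> complex) x. (\<forall>n. norm (d n) \<le> A * r ^ n) \<longrightarrow>
      summable (\<lambda>n. norm (d n * complex_of_real (hh n x))) \<and>
      norm (\<Sum>n. d n * complex_of_real (hh n x)) * exp (\<alpha> * x\<^sup>2) \<le> B"
    using geometric_hermite_series(1)[OF r c] by blast
  have sum: "summable (\<lambda>n. norm (c n * complex_of_real (hh n x)))" for x
    using ser c by blast
  \<comment> \<open>The same split: \<open>w ^ n\<close> absorbs the linear growth of the L1 norms,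
    so these are summable and sum and integral may be exchanged.\<close>
  define w where "w = 1 / sqrt r"
  have w: "1 < w" using r by (simp add: w_def)
  have rw: "r * w = sqrt r" unfolding w_def using r by (simp add: real_div_sqrt)
  have L1: "norm (LINT x|lborel. norm (E n x)) \<le> A * (3 + 1 / (w - 1)) * sqrt r ^ n" for n
  proof -
    have "norm (LINT x|lborel. norm (E n x)) = norm (c n) * (LINT x|lborel. \<bar>hh n x\<bar>)"
      unfolding nE by (simp add: abs_mult)
    also have "\<dots> \<le> (A * r ^ n) * ((3 + 1 / (w - 1)) * w ^ n)"
      using A0 r by (intro mult_mono c order_trans[OF hh_L1_bound linear_le_exponential[OF w]]) auto
    also have "\<dots> = A * (3 + 1 / (w - 1)) * (r * w) ^ n" by (simp add: power_mult_distrib)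
    finally show ?thesis unfolding rw .
  qed
  have L1sum: "summable (\<lambda>n. LINT x|lborel. norm (E n x))"
  proof (rule summable_comparison_test'[of "\<lambda>n. A * (3 + 1 / (w - 1)) * sqrt r ^ n" 0])
    show "summable (\<lambda>n. A * (3 + 1 / (w - 1)) * sqrt r ^ n)"
      using r by (intro summable_mult summable_geometric) simp
  qed (rule L1)
  have AE: "AE x in lborel. summable (\<lambda>n. norm (E n x))"
    using sum by (simp add: nE norm_mult)
  have "(LINT x|lborel. exp (- \<i> * of_real (x * \<xi>)) * (\<Sum>n. c n * of_real (hh n x))) = (LINT x|lborel. (\<Sum>n. E n x))"
    unfolding E_def by (simp only: suminf_mult[OF summable_norm_cancel[OF sum]])
  also have "\<dots> = (\<Sum>n. LINT x|lborel. E n x)"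
    by (rule integral_suminf[OF int AE L1sum])
  finally have e: "fourier_transform (\<lambda>x. \<Sum>n. c n * of_real (hh n x)) \<xi> =
      of_real (1 / sqrt (2 * pi)) * (\<Sum>n. LINT x|lborel. E n x)"
    unfolding fourier_transform_def by simp
  also have "\<dots> = (\<Sum>n. of_real (1 / sqrt (2 * pi)) * (LINT x|lborel. E n x))"
    by (rule suminf_mult[symmetric, OF summable_integral[OF int AE L1sum]])
  also have "\<dots> = (\<Sum>n. (c n * (- \<i>) ^ n) * of_real (hh n \<xi>))"
  proof (rule suminf_cong)
    fix n
    have "of_real (1 / sqrt (2 * pi)) * (LINT x|lborel. E n x) =
      c n * (of_real (1 / sqrt (2 * pi)) * (LINT x|lborel. exp (- \<i> * of_real (x * \<xi>)) * complex_of_real (hh n x)))"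
    proof -
      have "E n x = c n * (exp (- \<i> * of_real (x * \<xi>)) * complex_of_real (hh n x))" for x
        by (simp only: E_def mult_ac)
      then have "(LINT x|lborel. E n x) = c n * (LINT x|lborel. exp (- \<i> * of_real (x * \<xi>)) * complex_of_real (hh n x))"
        by (simp only: integral_mult_right_zero)
      then show ?thesis by (simp only: mult_ac)
    qed
    also have "\<dots> = c n * fourier_transform (hermite_fun n) \<xi>"
      by (simp only: fourier_transform_def hermite_fun_hh)
    finally show "of_real (1 / sqrt (2 * pi)) * (LINT x|lborel. E n x) = (c n * (- \<i>) ^ n) * of_real (hh n \<xi>)"
      by (simp only: fourier_hermite_fun hermite_fun_hh mult.assoc)
  qed
  finally show ?thesis .
qed

section \<open>Hermite expansions and the propagator\<close>

lemma L2_measurable: "f \<in> L2 \<Longrightarrow> f \<in> borel_measurable borel"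
  by (simp add: L2_def)

lemma L2_integrable_sq: "f \<in> L2 \<Longrightarrow> integrable lborel (\<lambda>x. (norm (f x))\<^sup>2)"
  by (simp add: L2_def)

lemma L2_add:
  assumes "f \<in> L2" "g \<in> L2"
  shows "(\<lambda>x. f x + g x) \<in> L2"
proof -
  have [measurable]: "f \<in> borel_measurable borel" "g \<in> borel_measurable borel"
    using assms by (simp_all add: L2_measurable)
  have "integrable lborel (\<lambda>x. (norm (f x + g x))\<^sup>2)"
  proof (rule Bochner_Integration.integrable_bound)
    show "integrable lborel (\<lambda>x. 2 * (norm (f x))\<^sup>2 + 2 * (norm (g x))\<^sup>2)"
      using assms by (intro Bochner_Integration.integrable_add integrable_mult_right L2_integrable_sq)
    show "AE x in lborel. norm ((norm (f x + g x))\<^sup>2) \<le> norm (2 * (norm (f x))\<^sup>2 + 2 * (norm (g x))\<^sup>2)"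
    proof (rule AE_I2)
      fix x
      have "(norm (f x + g x))\<^sup>2 \<le> (norm (f x) + norm (g x))\<^sup>2" by (intro power_mono norm_triangle_ineq) auto
      also have "\<dots> \<le> 2 * (norm (f x))\<^sup>2 + 2 * (norm (g x))\<^sup>2"
        using sum_squares_bound[of "norm (f x)" "norm (g x)"] by (simp add: power2_sum)
      finally show "norm ((norm (f x + g x))\<^sup>2) \<le> norm (2 * (norm (f x))\<^sup>2 + 2 * (norm (g x))\<^sup>2)" by simp
    qed
  qed measurable
  then show ?thesis by (simp add: L2_def)
qed

lemma L2_scale:
  assumes "f \<in> L2"
  shows "(\<lambda>x. u * f x) \<in> L2"
proof -
  have [measurable]: "f \<in> borel_measurable borel" using assms by (rule L2_measurable)
  have "(\<lambda>x. u * f x) \<in> borel_measurable borel" by measurable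
  then show ?thesis using assms by (simp add: L2_def norm_mult power_mult_distrib)
qed

lemma L2_cnj:
  assumes "f \<in> L2"
  shows "(\<lambda>x. cnj (f x)) \<in> L2"
proof -
  have [measurable]: "f \<in> borel_measurable borel" using assms by (rule L2_measurable)
  have "cnj \<in> borel_measurable borel" by (intro borel_measurable_continuous_onI continuous_intros)
  then have "(\<lambda>x. cnj (f x)) \<in> borel_measurable borel" by measurable
  then show ?thesis using assms by (simp add: L2_def)
qed

lemma L2_diff:
  assumes "f \<in> L2" "g \<in> L2"
  shows "(\<lambda>x. f x - g x) \<in> L2"
  using L2_add[OF assms(1) L2_scale[OF assms(2), of "- 1"]] by simp

lemma L2_norm_nonneg: "0 \<le> L2_norm f"
  by (simp add: L2_norm_def)

lemma L2_norm_sq: "(L2_norm f)\<^sup>2 = (LINT x|lborel. (norm (f x))\<^sup>2)"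
  unfolding L2_norm_def by (simp add: integral_nonneg_AE)

lemma L2_inner_integrable:
  assumes "f \<in> L2" "g \<in> L2"
  shows "integrable lborel (\<lambda>x. f x * cnj (g x))"
  using integral_Cauchy_Schwarz(1)[of f lborel "\<lambda>x. cnj (g x)"] assms(1) L2_cnj[OF assms(2)]
  by (simp add: L2_def)

lemma L2_inner_le:
  assumes "f \<in> L2" "g \<in> L2"
  shows "norm (L2_inner f g) \<le> L2_norm f * L2_norm g"
  using integral_Cauchy_Schwarz(3)[of f lborel "\<lambda>x. cnj (g x)"] assms(1) L2_cnj[OF assms(2)]
  by (simp add: L2_def L2_inner_def L2_norm_def)

lemma L2_inner_cnj: "cnj (L2_inner f g) = L2_inner g f"
  unfolding L2_inner_def by (subst Bochner_Integration.integral_cnj[symmetric]) (simp add: mult.commute)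

lemma L2_inner_diff_left:
  assumes "f \<in> L2" "f' \<in> L2" "g \<in> L2"
  shows "L2_inner (\<lambda>x. f x - f' x) g = L2_inner f g - L2_inner f' g"
  unfolding L2_inner_def using assms by (simp add: left_diff_distrib L2_inner_integrable)

lemma L2_inner_add_left:
  assumes "f \<in> L2" "f' \<in> L2" "g \<in> L2"
  shows "L2_inner (\<lambda>x. f x + f' x) g = L2_inner f g + L2_inner f' g"
  unfolding L2_inner_def using assms by (simp add: distrib_right L2_inner_integrable)

lemma L2_inner_scale_left: "L2_inner (\<lambda>x. u * f x) g = u * L2_inner f g"
  unfolding L2_inner_def by (simp add: mult.assoc)

lemma L2_inner_self: "L2_inner f f = of_real ((L2_norm f)\<^sup>2)"
  unfolding L2_inner_def L2_norm_sq integral_complex_of_real[symmetric]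
  by (simp add: complex_norm_square del: of_real_power)

lemma L2_inner_cong_AE:
  assumes "AE x in lborel. f x = f' x" "f \<in> L2" "f' \<in> L2" "g \<in> L2"
  shows "L2_inner f g = L2_inner f' g"
  unfolding L2_inner_def using assms
  by (intro integral_cong_AE borel_measurable_integrable L2_inner_integrable) auto

lemma L2_norm_cong_AE:
  assumes "AE x in lborel. f x = f' x" "f \<in> L2" "f' \<in> L2"
  shows "L2_norm f = L2_norm f'"
  unfolding L2_norm_def using assms
  by (intro arg_cong[of _ _ sqrt] integral_cong_AE borel_measurable_integrable L2_integrable_sq) auto

lemma L2_norm_triangle:
  assumes "f \<in> L2" "g \<in> L2"
  shows "L2_norm (\<lambda>x. f x + g x) \<le> L2_norm f + L2_norm g"
proof -
  define h where "h = (\<lambda>x. f x + g x)"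
  have h: "h \<in> L2" unfolding h_def by (intro L2_add assms)
  have "(L2_norm h)\<^sup>2 = norm (L2_inner h h)" by (simp add: L2_inner_self norm_power)
  also have "L2_inner h h = L2_inner f h + L2_inner g h"
    unfolding h_def using assms h[unfolded h_def] by (rule L2_inner_add_left)
  also have "norm \<dots> \<le> norm (L2_inner f h) + norm (L2_inner g h)" by (rule norm_triangle_ineq)
  also have "\<dots> \<le> L2_norm f * L2_norm h + L2_norm g * L2_norm h"
    by (intro add_mono L2_inner_le assms h)
  finally have "L2_norm h * L2_norm h \<le> (L2_norm f + L2_norm g) * L2_norm h"
    by (simp add: power2_eq_square distrib_right)
  then have "L2_norm h \<le> L2_norm f + L2_norm g"
    using L2_norm_nonneg[of h] L2_norm_nonneg[of f] L2_norm_nonneg[of g]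
    by (cases "L2_norm h = 0") auto
  then show ?thesis by (simp add: h_def)
qed

lemma L2_norm_minus_commute: "L2_norm (\<lambda>x. f x - g x) = L2_norm (\<lambda>x. g x - f x)"
  by (simp add: L2_norm_def norm_minus_commute)

lemma L2_norm_triangle_diff:
  assumes "f \<in> L2" "g \<in> L2" "h \<in> L2"
  shows "L2_norm (\<lambda>x. f x - h x) \<le> L2_norm (\<lambda>x. f x - g x) + L2_norm (\<lambda>x. g x - h x)"
  using L2_norm_triangle[OF L2_diff[OF assms(1,2)] L2_diff[OF assms(2,3)]] by simp

lemma L2_norm_eq_0:
  assumes "f \<in> L2" "L2_norm f = 0"
  shows "AE x in lborel. f x = 0"
proof -
  have "(LINT x|lborel. (norm (f x))\<^sup>2) = 0" using L2_norm_sq[of f] assms(2) by simp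
  then have "AE x in lborel. (norm (f x))\<^sup>2 = 0"
    using integral_nonneg_eq_0_iff_AE[OF L2_integrable_sq[OF assms(1)]] by simp
  then show ?thesis by eventually_elim simp
qed

lemma hermite_fun_L2: "hermite_fun n \<in> L2"
  using integrable_hh2[of n n] by (simp add: L2_def hermite_fun_hh[abs_def] power2_eq_square)

section \<open>Hermite coefficients, partial sums and their L2 limits\<close>

definition herm_sum :: "(nat \<Rightarrow> complex) \<Rightarrow> nat \<Rightarrow> real \<Rightarrow> complex" where
  "herm_sum e N x = (\<Sum>n<N. e n * hermite_fun n x)"

definition coef :: "(real \<Rightarrow> complex) \<Rightarrow> nat \<Rightarrow> complex" where
  "coef f n = L2_inner f (hermite_fun n)"

definition phase :: "real \<Rightarrow> (nat \<Rightarrow> complex) \<Rightarrow> nat \<Rightarrow> complex" where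
  "phase t c n = exp (\<i> * of_real t * of_nat (2 * n + 1)) * c n"

lemma norm_phase: "norm (phase t c n) = norm (c n)"
proof -
  have "norm (exp (\<i> * of_real t * of_nat (2 * n + 1))) = 1"
    using norm_exp_i_times[of "t * real (2 * n + 1)"] by (simp add: mult.assoc)
  then show ?thesis by (simp add: phase_def norm_mult)
qed

lemma herm_sum_L2: "herm_sum e N \<in> L2"
proof (induction N)
  case 0
  then show ?case by (simp add: L2_def herm_sum_def[abs_def])
next
  case (Suc N)
  then show ?case
    using L2_add[OF Suc L2_scale[OF hermite_fun_L2[of N], of "e N"]] by (simp add: herm_sum_def[abs_def])
qed

lemma herm_sum_diff_norm:
  assumes "M \<le> N"
  shows "(L2_norm (\<lambda>x. herm_sum e N x - herm_sum e M x))\<^sup>2 = (\<Sum>n\<in>{M..<N}. (norm (e n))\<^sup>2)"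
proof -
  have "herm_sum e N x - herm_sum e M x = (\<Sum>n\<in>{M..<N}. e n * of_real (hh n x))" for x
    unfolding herm_sum_def hermite_fun_hh lessThan_atLeast0 by (rule sum_diff_nat_ivl) (use assms in auto)
  then show ?thesis unfolding L2_norm_sq by (simp add: integral_hh_sum_sq)
qed

lemma herm_sum_norm: "(L2_norm (herm_sum e N))\<^sup>2 = (\<Sum>n<N. (norm (e n))\<^sup>2)"
  using herm_sum_diff_norm[of 0 N e] by (simp add: herm_sum_def[of e 0] lessThan_atLeast0)

lemma L2_inner_herm_sum:
  assumes "g \<in> L2"
  shows "L2_inner (herm_sum e N) g = (\<Sum>n<N. e n * cnj (coef g n))"
proof (induction N)
  case 0
  then show ?case by (simp add: L2_inner_def herm_sum_def)
next
  case (Suc N)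
  have "L2_inner (herm_sum e (Suc N)) g = L2_inner (\<lambda>x. herm_sum e N x + e N * hermite_fun N x) g"
    by (simp add: herm_sum_def[abs_def])
  also have "\<dots> = L2_inner (herm_sum e N) g + e N * L2_inner (hermite_fun N) g"
    by (simp add: L2_inner_add_left herm_sum_L2 L2_scale hermite_fun_L2 assms L2_inner_scale_left)
  finally show ?case using Suc by (simp add: coef_def L2_inner_cnj)
qed

lemma Bessel:
  assumes "f \<in> L2"
  shows "ell2 (L2_norm f) (coef f)"
  unfolding ell2_def
proof (intro conjI allI L2_norm_nonneg)
  fix N
  define s where "s = (\<Sum>n<N. (norm (coef f n))\<^sup>2)"
  have s0: "0 \<le> s" by (simp add: s_def sum_nonneg)
  have "L2_inner (herm_sum (coef f) N) f = of_real s"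
    unfolding L2_inner_herm_sum[OF assms] s_def of_real_sum
    by (simp add: complex_norm_square del: of_real_power)
  then have "s \<le> L2_norm (herm_sum (coef f) N) * L2_norm f"
    using L2_inner_le[OF herm_sum_L2[of "coef f" N] assms] s0 by simp
  also have "L2_norm (herm_sum (coef f) N) = sqrt s"
    using herm_sum_norm[of "coef f" N] L2_norm_nonneg by (simp add: s_def real_sqrt_unique)
  finally have "sqrt s * sqrt s \<le> L2_norm f * sqrt s" using s0 by (simp add: mult.commute)
  then have "sqrt s \<le> L2_norm f"
    using s0 L2_norm_nonneg[of f] mult_le_cancel_right_pos[of "sqrt s" "sqrt s" "L2_norm f"]
    by (cases "s = 0") (simp_all del: real_sqrt_mult_self)
  then have "(sqrt s)\<^sup>2 \<le> (L2_norm f)\<^sup>2" by (intro power_mono) (use s0 in auto)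
  then show "(\<Sum>n<N. (norm (coef f n))\<^sup>2) \<le> (L2_norm f)\<^sup>2" using s0 by (simp add: s_def)
qed

definition tail :: "(nat \<Rightarrow> complex) \<Rightarrow> nat \<Rightarrow> real" where
  "tail c N = (\<Sum>n. (norm (c (n + N)))\<^sup>2)"

lemma ell2_summable: "ell2 C c \<Longrightarrow> summable (\<lambda>n. (norm (c n))\<^sup>2)"
  by (rule summableI_nonneg_bounded[of _ "C\<^sup>2"]) (auto simp: ell2_def)

lemma tail_tendsto: "ell2 C c \<Longrightarrow> tail c \<longlonglongrightarrow> 0"
  unfolding tail_def[abs_def] by (rule suminf_exist_split2[OF ell2_summable])

lemma tail_nonneg: "ell2 C c \<Longrightarrow> 0 \<le> tail c N"
  unfolding tail_def by (intro suminf_nonneg summable_ignore_initial_segment ell2_summable) auto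

lemma sum_le_tail:
  assumes "ell2 C c" "\<And>n. norm (e n) \<le> norm (c n)"
  shows "(\<Sum>n\<in>{M..<N}. (norm (e n))\<^sup>2) \<le> tail c M"
proof -
  have "(\<Sum>n\<in>{M..<N}. (norm (e n))\<^sup>2) \<le> (\<Sum>n\<in>{M..<N}. (norm (c n))\<^sup>2)"
    by (intro sum_mono power_mono assms) auto
  also have "\<dots> = (\<Sum>n<N - M. (norm (c (n + M)))\<^sup>2)"
    by (rule sum.reindex_bij_witness[where i = "\<lambda>n. n + M" and j = "\<lambda>n. n - M"]) auto
  also have "\<dots> \<le> tail c M"
    unfolding tail_def
    by (intro sum_le_suminf summable_ignore_initial_segment ell2_summable[OF assms(1)]) auto
  finally show ?thesis .
qed

lemma herm_sum_nn_integral: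
  assumes "M \<le> N"
  shows "(\<integral>\<^sup>+x. ennreal ((norm (herm_sum e N x - herm_sum e M x))\<^sup>2) \<partial>lborel) =
    ennreal (\<Sum>n\<in>{M..<N}. (norm (e n))\<^sup>2)"
  unfolding herm_sum_diff_norm[OF assms, symmetric] L2_norm_sq
  by (intro nn_integral_eq_integral L2_integrable_sq L2_diff herm_sum_L2) auto

text \<open>The subsequence depends on the moduli of the coefficients only; this makes the limit jointly
  measurable in time and space when the coefficients rotate.\<close>

lemma Riesz_Fischer_Hermite:
  assumes c: "ell2 C c"
  obtains \<kappa> :: "nat \<Rightarrow> nat" where "strict_mono \<kappa>"
    and "\<And>e. (\<And>n. norm (e n) \<le> norm (c n)) \<Longrightarrow>
      AE x in lborel. (\<lambda>k. herm_sum e (\<kappa> k) x) \<longlonglongrightarrow> lim (\<lambda>k. herm_sum e (\<kappa> k) x)"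
    and "\<And>e. (\<And>n. norm (e n) \<le> norm (c n)) \<Longrightarrow> (\<lambda>x. lim (\<lambda>k. herm_sum e (\<kappa> k) x)) \<in> L2"
    and "\<And>e N. (\<And>n. norm (e n) \<le> norm (c n)) \<Longrightarrow>
      (L2_norm (\<lambda>x. lim (\<lambda>k. herm_sum e (\<kappa> k) x) - herm_sum e N x))\<^sup>2 \<le> tail c N"
proof -
  have "\<exists>n. tail c n \<le> (1 / 8) ^ k \<and> m < n" for k m :: nat
  proof -
    have "\<forall>\<^sub>F n in sequentially. tail c n < (1 / 8) ^ k"
      using tail_tendsto[OF c] by (rule order_tendstoD(2)) simp
    then have "\<forall>\<^sub>F n in sequentially. tail c n < (1 / 8) ^ k \<and> m < n"
      using eventually_gt_at_top by (rule eventually_conj)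
    then obtain n where "tail c n < (1 / 8) ^ k \<and> m < n"
      unfolding eventually_sequentially by blast
    then show ?thesis by (intro exI[of _ n]) auto
  qed
  then have "\<exists>\<kappa>. \<forall>k. tail c (\<kappa> k) \<le> (1 / 8) ^ k \<and> \<kappa> k < \<kappa> (Suc k)"
    using dependent_nat_choice[of "\<lambda>k n. tail c n \<le> (1 / 8) ^ k" "\<lambda>k m n. m < n"] by blast
  then obtain \<kappa> where \<kappa>: "\<And>k. tail c (\<kappa> k) \<le> (1 / 8) ^ k" "\<And>k. \<kappa> k < \<kappa> (Suc k)" by blast
  have mono: "strict_mono \<kappa>" using \<kappa>(2) by (simp add: strict_mono_Suc_iff)
  have conv: "AE x in lborel. (\<lambda>k. herm_sum e (\<kappa> k) x) \<longlonglongrightarrow> lim (\<lambda>k. herm_sum e (\<kappa> k) x)"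
    if e: "\<And>n. norm (e n) \<le> norm (c n)" for e
  proof -
    \<comment> \<open>Along \<open>\<kappa>\<close> the squared tails are at most 8^(-k). With
      weights 2^k the squared increments have total integral at most the sum of 4^(-k), so for
      almost every x the increments are bounded by a multiple of 2^(-k/2) and the partial sums
      converge.\<close>
    define D where "D = (\<lambda>k x. herm_sum e (\<kappa> (Suc k)) x - herm_sum e (\<kappa> k) x)"
    have [measurable]: "herm_sum e N \<in> borel_measurable borel" for N
      using herm_sum_L2 by (rule L2_measurable)
    have [measurable]: "D k \<in> borel_measurable borel" for k unfolding D_def by measurable
    have "(\<integral>\<^sup>+x. (\<Sum>k. ennreal (2 ^ k * (norm (D k x))\<^sup>2)) \<partial>lborel) =
        (\<Sum>k. \<integral>\<^sup>+x. ennreal (2 ^ k * (norm (D k x))\<^sup>2) \<partial>lborel)"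
      by (rule nn_integral_suminf) measurable
    also have "\<dots> \<le> (\<Sum>k. ennreal ((1 / 4) ^ k))"
    proof (rule suminf_le)
      fix k
      have "(\<integral>\<^sup>+x. ennreal (2 ^ k * (norm (D k x))\<^sup>2) \<partial>lborel) =
          ennreal (2 ^ k) * (\<integral>\<^sup>+x. ennreal ((norm (D k x))\<^sup>2) \<partial>lborel)"
        by (simp add: ennreal_mult nn_integral_cmult)
      also have "(\<integral>\<^sup>+x. ennreal ((norm (D k x))\<^sup>2) \<partial>lborel) = ennreal (\<Sum>n\<in>{\<kappa> k..<\<kappa> (Suc k)}. (norm (e n))\<^sup>2)"
        unfolding D_def using \<kappa>(2) by (intro herm_sum_nn_integral) (simp add: less_imp_le)
      also have "ennreal (2 ^ k) * \<dots> \<le> ennreal (2 ^ k) * ennreal ((1 / 8) ^ k)"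
        by (intro mult_left_mono ennreal_leI order_trans[OF sum_le_tail[OF c e] \<kappa>(1)]) auto
      also have "\<dots> = ennreal ((1 / 4) ^ k)"
        by (simp add: ennreal_mult[symmetric] power_mult_distrib[symmetric])
      finally show "(\<integral>\<^sup>+x. ennreal (2 ^ k * (norm (D k x))\<^sup>2) \<partial>lborel) \<le> ennreal ((1 / 4) ^ k)" .
    qed auto
    also have "\<dots> < \<infinity>"
      by (subst suminf_ennreal2) (auto intro!: summable_geometric)
    finally have "(\<integral>\<^sup>+x. (\<Sum>k. ennreal (2 ^ k * (norm (D k x))\<^sup>2)) \<partial>lborel) \<noteq> \<infinity>" by simp
    then have "AE x in lborel. (\<Sum>k. ennreal (2 ^ k * (norm (D k x))\<^sup>2)) \<noteq> \<infinity>"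
      by (intro nn_integral_PInf_AE) auto
    then show ?thesis
    proof eventually_elim
      case (elim x)
      define B where "B = enn2real (\<Sum>k. ennreal (2 ^ k * (norm (D k x))\<^sup>2))"
      have B0: "0 \<le> B" unfolding B_def by (rule enn2real_nonneg)
      have le: "norm (D k x) \<le> sqrt B * (1 / sqrt 2) ^ k" for k
      proof -
        have "ennreal (2 ^ k * (norm (D k x))\<^sup>2) \<le> (\<Sum>k. ennreal (2 ^ k * (norm (D k x))\<^sup>2))"
        proof -
          have "(\<Sum>k\<in>{k}. ennreal (2 ^ k * (norm (D k x))\<^sup>2)) \<le> (\<Sum>k. ennreal (2 ^ k * (norm (D k x))\<^sup>2))"
            by (rule sum_le_suminf) auto
          then show ?thesis by (simp only: sum.insert[OF finite.emptyI] sum.empty empty_iff not_False_eq_True add_0_right)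
        qed
        also have "\<dots> = ennreal B" unfolding B_def
          by (rule ennreal_enn2real[symmetric]) (use elim in \<open>simp only: less_top infinity_ennreal_def\<close>)
        finally have "2 ^ k * (norm (D k x))\<^sup>2 \<le> B" using B0 by (simp add: ennreal_le_iff)
        then have "(norm (D k x))\<^sup>2 \<le> B * (1 / 2) ^ k" by (simp add: power_divide field_simps)
        also have "\<dots> = (sqrt B * (1 / sqrt 2) ^ k)\<^sup>2"
        proof -
          have "((1 / sqrt 2) ^ k)\<^sup>2 = ((1 / sqrt (2::real))\<^sup>2) ^ k"
            by (simp only: power_mult[symmetric] mult.commute)
          also have "(1 / sqrt (2::real))\<^sup>2 = 1 / 2" by (simp add: power_divide)
          finally show ?thesis using B0 by (simp only: power_mult_distrib real_sqrt_pow2)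
        qed
        finally show ?thesis by (rule power2_le_imp_le) (use B0 in simp)
      qed
      have "summable (\<lambda>k. sqrt B * (1 / sqrt 2) ^ k)" by (intro summable_mult summable_geometric) simp
      then have "summable (\<lambda>k. D k x)" by (rule summable_comparison_test'[of _ 0]) (rule le)
      then have "(\<lambda>k. \<Sum>j<k. D j x) \<longlonglongrightarrow> (\<Sum>j. D j x)" by (rule summable_LIMSEQ)
      then have "(\<lambda>k. herm_sum e (\<kappa> 0) x + (\<Sum>j<k. D j x)) \<longlonglongrightarrow> herm_sum e (\<kappa> 0) x + (\<Sum>j. D j x)"
        by (intro tendsto_add tendsto_const)
      moreover have "herm_sum e (\<kappa> 0) x + (\<Sum>j<k. D j x) = herm_sum e (\<kappa> k) x" for k
        unfolding D_def using sum_lessThan_telescope[of "\<lambda>j. herm_sum e (\<kappa> j) x" k] by simp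
      ultimately show "(\<lambda>k. herm_sum e (\<kappa> k) x) \<longlonglongrightarrow> lim (\<lambda>k. herm_sum e (\<kappa> k) x)"
        by (simp add: limI)
    qed
  qed
  have diff: "(\<lambda>x. lim (\<lambda>k. herm_sum e (\<kappa> k) x) - herm_sum e N x) \<in> L2 \<and>
      (L2_norm (\<lambda>x. lim (\<lambda>k. herm_sum e (\<kappa> k) x) - herm_sum e N x))\<^sup>2 \<le> tail c N"
    if e: "\<And>n. norm (e n) \<le> norm (c n)" for e N
  proof -
    define V where "V = (\<lambda>x. lim (\<lambda>k. herm_sum e (\<kappa> k) x))"
    have [measurable]: "herm_sum e N \<in> borel_measurable borel" for N
      using herm_sum_L2 by (rule L2_measurable)
    have [measurable]: "V \<in> borel_measurable borel"
      unfolding V_def by (rule borel_measurable_lim_metric) measurable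
    have "AE x in lborel. ennreal ((norm (V x - herm_sum e N x))\<^sup>2) =
        liminf (\<lambda>k. ennreal ((norm (herm_sum e (\<kappa> k) x - herm_sum e N x))\<^sup>2))"
      using conv[OF e]
    proof eventually_elim
      case (elim x)
      have "(\<lambda>k. ennreal ((norm (herm_sum e (\<kappa> k) x - herm_sum e N x))\<^sup>2)) \<longlonglongrightarrow>
          ennreal ((norm (V x - herm_sum e N x))\<^sup>2)"
        unfolding V_def using elim
        by (intro tendsto_ennrealI tendsto_power tendsto_norm tendsto_diff tendsto_const)
      then show ?case by (intro lim_imp_Liminf[symmetric]) auto
    qed
    then have "(\<integral>\<^sup>+x. ennreal ((norm (V x - herm_sum e N x))\<^sup>2) \<partial>lborel) =
        (\<integral>\<^sup>+x. liminf (\<lambda>k. ennreal ((norm (herm_sum e (\<kappa> k) x - herm_sum e N x))\<^sup>2)) \<partial>lborel)"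
      by (rule nn_integral_cong_AE)
    also have "\<dots> \<le> liminf (\<lambda>k. \<integral>\<^sup>+x. ennreal ((norm (herm_sum e (\<kappa> k) x - herm_sum e N x))\<^sup>2) \<partial>lborel)"
      by (rule nn_integral_liminf) measurable
    also have "\<dots> \<le> ennreal (tail c N)"
    proof (rule Liminf_le)
      have "\<forall>\<^sub>F k in sequentially. N \<le> \<kappa> k"
        using filterlim_subseq[OF mono] unfolding filterlim_at_top by blast
      then show "\<forall>\<^sub>F k in sequentially.
          (\<integral>\<^sup>+x. ennreal ((norm (herm_sum e (\<kappa> k) x - herm_sum e N x))\<^sup>2) \<partial>lborel) \<le> ennreal (tail c N)"
      proof (rule eventually_mono)
        fix k assume "N \<le> \<kappa> k"
        then show "(\<integral>\<^sup>+x. ennreal ((norm (herm_sum e (\<kappa> k) x - herm_sum e N x))\<^sup>2) \<partial>lborel) \<le> ennreal (tail c N)"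
          unfolding herm_sum_nn_integral[OF \<open>N \<le> \<kappa> k\<close>] by (intro ennreal_leI sum_le_tail[OF c e])
      qed
    qed simp
    finally have le: "(\<integral>\<^sup>+x. ennreal ((norm (V x - herm_sum e N x))\<^sup>2) \<partial>lborel) \<le> ennreal (tail c N)" .
    have int: "integrable lborel (\<lambda>x. (norm (V x - herm_sum e N x))\<^sup>2)"
      by (rule integrableI_bounded) (use le in \<open>auto intro: le_less_trans\<close>)
    then have L2: "(\<lambda>x. V x - herm_sum e N x) \<in> L2" by (simp add: L2_def)
    have "ennreal (LINT x|lborel. (norm (V x - herm_sum e N x))\<^sup>2) \<le> ennreal (tail c N)"
      using le nn_integral_eq_integral[OF int] by simp
    then have "(L2_norm (\<lambda>x. V x - herm_sum e N x))\<^sup>2 \<le> tail c N"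
      unfolding L2_norm_sq using tail_nonneg[OF c] by (simp add: ennreal_le_iff)
    with L2 show ?thesis by (simp add: V_def)
  qed
  have "(\<lambda>x. lim (\<lambda>k. herm_sum e (\<kappa> k) x)) \<in> L2" if "\<And>n. norm (e n) \<le> norm (c n)" for e
    using L2_add[OF conjunct1[OF diff[OF that, where N = 0]] herm_sum_L2[of e 0]] by simp
  then show thesis using mono conv diff by (intro that[of \<kappa>]) auto
qed

lemma L2_limit_unique:
  assumes "f \<in> L2" "g \<in> L2" "\<And>N. h N \<in> L2"
    and "(\<lambda>N. L2_norm (\<lambda>x. f x - h N x)) \<longlonglongrightarrow> 0" "(\<lambda>N. L2_norm (\<lambda>x. g x - h N x)) \<longlonglongrightarrow> 0"
  shows "AE x in lborel. f x = g x"
proof -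
  have "L2_norm (\<lambda>x. f x - g x) \<le> 0"
  proof (rule tendsto_lowerbound)
    show "(\<lambda>N. L2_norm (\<lambda>x. f x - h N x) + L2_norm (\<lambda>x. g x - h N x)) \<longlonglongrightarrow> 0"
      using tendsto_add[OF assms(4,5)] by simp
    show "\<forall>\<^sub>F N in sequentially. L2_norm (\<lambda>x. f x - g x) \<le> L2_norm (\<lambda>x. f x - h N x) + L2_norm (\<lambda>x. g x - h N x)"
    proof (rule always_eventually, rule allI)
      fix N
      show "L2_norm (\<lambda>x. f x - g x) \<le> L2_norm (\<lambda>x. f x - h N x) + L2_norm (\<lambda>x. g x - h N x)"
        using L2_norm_triangle_diff[OF assms(1) assms(3)[of N] assms(2)]
        by (simp add: L2_norm_minus_commute[of "h N"])
    qed
  qed simp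
  then have "L2_norm (\<lambda>x. f x - g x) = 0" using L2_norm_nonneg[of "\<lambda>x. f x - g x"] by linarith
  from L2_norm_eq_0[OF L2_diff[OF assms(1,2)] this] show ?thesis by eventually_elim simp
qed

lemma tail_norm_tendsto:
  assumes "ell2 C c" "\<And>N. (L2_norm (\<lambda>x. f x - h N x))\<^sup>2 \<le> tail c N"
  shows "(\<lambda>N. L2_norm (\<lambda>x. f x - h N x)) \<longlonglongrightarrow> 0"
proof (rule tendsto_sandwich[OF _ _ tendsto_const])
  show "\<forall>\<^sub>F N in sequentially. L2_norm (\<lambda>x. f x - h N x) \<le> sqrt (tail c N)"
    by (intro always_eventually allI real_le_rsqrt assms(2))
  show "(\<lambda>N. sqrt (tail c N)) \<longlonglongrightarrow> 0"
    using tendsto_real_sqrt[OF tail_tendsto[OF assms(1)]] by simp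
qed (simp add: L2_norm_nonneg)

text \<open>Riesz-Fischer supplies an instance, so the choice in \<open>propagator\<close> has the
  property it describes. Everything later about the propagator is derived from these two
  facts.\<close>

lemma propagator_L2:
  assumes "f \<in> L2"
  shows "propagator t f \<in> L2"
    and "(\<lambda>N. L2_norm (\<lambda>x. propagator t f x - herm_sum (phase t (coef f)) N x)) \<longlonglongrightarrow> 0"
proof -
  have c: "ell2 (L2_norm f) (coef f)" by (rule Bessel[OF assms])
  define Q where "Q = (\<lambda>g. g \<in> L2 \<and> (\<lambda>N. L2_norm (\<lambda>x. g x - herm_sum (phase t (coef f)) N x)) \<longlonglongrightarrow> 0)"
  have e: "propagator t f = (SOME g. Q g)"
    unfolding propagator_def Q_def herm_sum_def phase_def coef_def ..
  have "\<exists>g. Q g"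
  proof (rule Riesz_Fischer_Hermite[OF c])
    fix \<kappa> :: "nat \<Rightarrow> nat"
    define V where "V = (\<lambda>x. lim (\<lambda>k. herm_sum (phase t (coef f)) (\<kappa> k) x))"
    assume L2: "\<And>e. (\<And>n. norm (e n) \<le> norm (coef f n)) \<Longrightarrow> (\<lambda>x. lim (\<lambda>k. herm_sum e (\<kappa> k) x)) \<in> L2"
      and t: "\<And>e N. (\<And>n. norm (e n) \<le> norm (coef f n)) \<Longrightarrow>
        (L2_norm (\<lambda>x. lim (\<lambda>k. herm_sum e (\<kappa> k) x) - herm_sum e N x))\<^sup>2 \<le> tail (coef f) N"
    have "V \<in> L2" unfolding V_def by (rule L2) (simp add: norm_phase)
    moreover have "(\<lambda>N. L2_norm (\<lambda>x. V x - herm_sum (phase t (coef f)) N x)) \<longlonglongrightarrow> 0"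
      by (rule tail_norm_tendsto[OF c]) (unfold V_def, rule t, simp add: norm_phase)
    ultimately show ?thesis unfolding Q_def by blast
  qed
  then have "Q (propagator t f)" unfolding e by (rule someI_ex)
  then show "propagator t f \<in> L2"
    "(\<lambda>N. L2_norm (\<lambda>x. propagator t f x - herm_sum (phase t (coef f)) N x)) \<longlonglongrightarrow> 0"
    by (simp_all add: Q_def)
qed

lemma L2_inner_tendsto:
  assumes "f \<in> L2" "g \<in> L2" "\<And>N. h N \<in> L2" "(\<lambda>N. L2_norm (\<lambda>x. f x - h N x)) \<longlonglongrightarrow> 0"
  shows "(\<lambda>N. L2_inner (h N) g) \<longlonglongrightarrow> L2_inner f g"
proof -
  have "(\<lambda>N. L2_inner f g - L2_inner (h N) g) \<longlonglongrightarrow> 0"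
  proof (rule Lim_null_comparison)
    show "\<forall>\<^sub>F N in sequentially. norm (L2_inner f g - L2_inner (h N) g) \<le> L2_norm (\<lambda>x. f x - h N x) * L2_norm g"
      using L2_inner_le[OF L2_diff[OF assms(1) assms(3)] assms(2)] L2_inner_diff_left[OF assms(1) assms(3) assms(2)]
      by (intro always_eventually allI) simp
    show "(\<lambda>N. L2_norm (\<lambda>x. f x - h N x) * L2_norm g) \<longlonglongrightarrow> 0"
      using tendsto_mult_right[OF assms(4), of "L2_norm g"] by simp
  qed
  from tendsto_diff[OF tendsto_const[of "L2_inner f g"] this] show ?thesis by simp
qed

lemma propagator_inner:
  assumes "f \<in> L2" "g \<in> L2"
  shows "(\<lambda>N. \<Sum>n<N. phase t (coef f) n * cnj (coef g n)) \<longlonglongrightarrow> L2_inner (propagator t f) g"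
  using L2_inner_tendsto[OF propagator_L2(1)[OF assms(1)] assms(2) herm_sum_L2 propagator_L2(2)[OF assms(1)]]
  by (simp add: L2_inner_herm_sum[OF assms(2)])

lemma propagator_adjoint:
  assumes "f \<in> L2" "g \<in> L2"
  shows "L2_inner (propagator (- t) f) g = L2_inner f (propagator t g)"
proof -
  have "(\<lambda>N. cnj (\<Sum>n<N. phase t (coef g) n * cnj (coef f n))) \<longlonglongrightarrow> cnj (L2_inner (propagator t g) f)"
    by (intro tendsto_cnj propagator_inner assms)
  moreover have "cnj (\<Sum>n<N. phase t (coef g) n * cnj (coef f n)) = (\<Sum>n<N. phase (- t) (coef f) n * cnj (coef g n))" for N
    unfolding phase_def by (simp add: exp_cnj mult_ac)
  ultimately show ?thesis
    using LIMSEQ_unique[OF propagator_inner[OF assms, of "- t"]] by (simp add: L2_inner_cnj)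
qed

lemma propagator_norm_le:
  assumes "f \<in> L2"
  shows "L2_norm (propagator t f) \<le> L2_norm f"
proof -
  define P where "P = propagator t f"
  define S where "S = herm_sum (phase t (coef f))"
  have P: "P \<in> L2" "(\<lambda>N. L2_norm (\<lambda>x. P x - S N x)) \<longlonglongrightarrow> 0"
    unfolding P_def S_def by (intro propagator_L2 assms)+
  have S: "L2_norm (S N) \<le> L2_norm f" for N
  proof (rule power2_le_imp_le[OF _ L2_norm_nonneg])
    show "(L2_norm (S N))\<^sup>2 \<le> (L2_norm f)\<^sup>2"
      using Bessel[OF assms] unfolding S_def herm_sum_norm norm_phase ell2_def by blast
  qed
  have "L2_norm P - L2_norm f \<le> 0"
  proof (rule tendsto_lowerbound[OF P(2)])
    show "\<forall>\<^sub>F N in sequentially. L2_norm P - L2_norm f \<le> L2_norm (\<lambda>x. P x - S N x)"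
    proof (rule always_eventually, rule allI)
      fix N
      have "L2_norm P \<le> L2_norm (\<lambda>x. P x - S N x) + L2_norm (S N)"
        using L2_norm_triangle[OF L2_diff[OF P(1) herm_sum_L2[of "phase t (coef f)" N]] herm_sum_L2[of "phase t (coef f)" N]]
        by (simp add: S_def)
      then show "L2_norm P - L2_norm f \<le> L2_norm (\<lambda>x. P x - S N x)" using S[of N] by linarith
    qed
  qed simp
  then show ?thesis by (simp add: P_def)
qed

section \<open>Strichartz estimate\<close>

text \<open>The sine condition covers both windows in use: for T = pi / 2 it holds for every k, for
  T = pi / 4 exactly for even k.\<close>

lemma integral_exp_period:
  assumes "0 \<le> T"
  shows "integrable lborel (\<lambda>s. indicator {- T..T} s *\<^sub>R exp (\<i> * of_real (2 * of_int k * s)))"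
    and "sin (2 * of_int k * T) = 0 \<Longrightarrow>
      (LINT s|lborel. indicator {- T..T} s *\<^sub>R exp (\<i> * of_real (2 * of_int k * s))) =
        (if k = 0 then of_real (2 * T) else 0)"
proof -
  have cont: "continuous_on {- T..T} (\<lambda>s. exp (\<i> * of_real (2 * of_int k * s)))"
    by (intro continuous_intros)
  show "integrable lborel (\<lambda>s. indicator {- T..T} s *\<^sub>R exp (\<i> * of_real (2 * of_int k * s)))"
    by (rule borel_integrable_compact[OF compact_Icc cont])
  assume sin: "sin (2 * of_int k * T) = 0"
  show "(LINT s|lborel. indicator {- T..T} s *\<^sub>R exp (\<i> * of_real (2 * of_int k * s))) =
        (if k = 0 then of_real (2 * T) else 0)"
  proof (cases "k = 0")
    case True
    then show ?thesis using assms by (simp add: scaleR_conv_of_real)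
  next
    case False
    define w where "w = \<i> * of_real (2 * of_int k)"
    have w: "w \<noteq> 0" using False by (simp add: w_def)
    have eq: "exp (\<i> * of_real (2 * of_int k * s)) = exp (w * of_real s)" for s :: real
      by (simp add: w_def mult.assoc)
    have d: "((\<lambda>s. exp (w * of_real s) / w) has_vector_derivative exp (w * of_real s)) (at s within {- T..T})" for s :: real
    proof -
      have "((\<lambda>z. exp (w * z) / w) has_field_derivative exp (w * of_real s)) (at (of_real s))"
        using w by (auto intro!: derivative_eq_intros)
      then show ?thesis by (rule has_vector_derivative_real_field)
    qed
    have "(LINT s|lborel. indicator {- T..T} s *\<^sub>R exp (w * of_real s)) = exp (w * of_real T) / w - exp (w * of_real (- T)) / w"
      by (rule integral_FTC_Icc) (use assms d cont[unfolded eq] in auto)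
    also have "\<dots> = (exp (w * of_real T) - exp (w * of_real (- T))) / w" by (simp add: diff_divide_distrib)
    also have "exp (w * of_real T) - exp (w * of_real (- T)) = 0"
    proof -
      have "exp (w * of_real T) = cis (2 * of_int k * T)" "exp (w * of_real (- T)) = cis (- (2 * of_int k * T))"
        by (simp_all add: w_def cis_conv_exp mult.assoc)
      then show ?thesis using sin by (simp add: complex_eq_iff)
    qed
    finally show ?thesis using False by (simp only: eq div_0 if_False)
  qed
qed

lemma Parseval_period:
  fixes z :: "nat \<Rightarrow> complex"
  shows "integrable lborel (\<lambda>s. indicator {- pi / 2..pi / 2} s * (norm (\<Sum>n<M. exp (\<i> * of_real (2 * of_int (int n) * s)) * z n))\<^sup>2)"
    and "(LINT s|lborel. indicator {- pi / 2..pi / 2} s * (norm (\<Sum>n<M. exp (\<i> * of_real (2 * of_int (int n) * s)) * z n))\<^sup>2)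
      = pi * (\<Sum>n<M. (norm (z n))\<^sup>2)"
proof -
  define E where "E = (\<lambda>k s. indicator {- (pi / 2)..pi / 2} s *\<^sub>R exp (\<i> * of_real (2 * of_int k * s)))"
  have sin0: "sin (2 * of_int k * (pi / 2)) = 0" for k :: int
    using sin_zero_iff_int2[of "2 * of_int k * (pi / 2)"] by auto
  have E: "integrable lborel (E k)" "(LINT s|lborel. E k s) = (if k = 0 then of_real pi else 0)" for k
    unfolding E_def using integral_exp_period[of "pi / 2" k] sin0 by simp_all
  have e: "complex_of_real (indicator {- pi / 2..pi / 2} s * (norm (\<Sum>n<M. exp (\<i> * of_real (2 * of_int (int n) * s)) * z n))\<^sup>2)
     = (\<Sum>a<M. \<Sum>b<M. z a * cnj (z b) * E (int a - int b) s)" for s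
  proof -
    have ab: "exp (\<i> * of_real (2 * of_int (int a) * s)) * cnj (exp (\<i> * of_real (2 * of_int (int b) * s))) =
        exp (\<i> * of_real (2 * of_int (int a - int b) * s))" for a b
      by (simp add: exp_cnj mult_exp_exp algebra_simps)
    have "complex_of_real ((norm (\<Sum>n<M. exp (\<i> * of_real (2 * of_int (int n) * s)) * z n))\<^sup>2) =
      (\<Sum>a<M. exp (\<i> * of_real (2 * of_int (int a) * s)) * z a) *
      (\<Sum>b<M. cnj (exp (\<i> * of_real (2 * of_int (int b) * s)) * z b))"
      by (simp only: complex_norm_square cnj_sum)
    also have "\<dots> = (\<Sum>a<M. \<Sum>b<M. z a * cnj (z b) * exp (\<i> * of_real (2 * of_int (int a - int b) * s)))"
      unfolding sum_product ab[symmetric] by (simp only: complex_cnj_mult mult_ac)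
    finally show ?thesis
      by (simp only: of_real_mult E_def scaleR_conv_of_real sum_distrib_left mult_ac minus_divide_left)
  qed
  have int: "integrable lborel (\<lambda>s. complex_of_real (indicator {- pi / 2..pi / 2} s * (norm (\<Sum>n<M. exp (\<i> * of_real (2 * of_int (int n) * s)) * z n))\<^sup>2))"
    unfolding e by (intro Bochner_Integration.integrable_sum integrable_mult_right E)
  then show I: "integrable lborel (\<lambda>s. indicator {- pi / 2..pi / 2} s * (norm (\<Sum>n<M. exp (\<i> * of_real (2 * of_int (int n) * s)) * z n))\<^sup>2)"
    by (simp only: complex_of_real_integrable_eq)
  have "complex_of_real (LINT s|lborel. indicator {- pi / 2..pi / 2} s * (norm (\<Sum>n<M. exp (\<i> * of_real (2 * of_int (int n) * s)) * z n))\<^sup>2)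
     = (\<Sum>a<M. \<Sum>b<M. z a * cnj (z b) * (if int a - int b = 0 then of_real pi else 0))"
    unfolding integral_complex_of_real[symmetric] e
    by (simp only: Bochner_Integration.integral_sum Bochner_Integration.integrable_sum
        integrable_mult_right E integral_mult_right_zero)
  also have "\<dots> = (\<Sum>a<M. of_real pi * (z a * cnj (z a)))"
    by (intro sum.cong refl) (simp add: if_distrib[of "\<lambda>x. _ * x"] mult_ac cong: if_cong)
  also have "\<dots> = of_real (pi * (\<Sum>n<M. (norm (z n))\<^sup>2))"
    by (simp only: of_real_mult of_real_sum complex_norm_square sum_distrib_left)
  finally show "(LINT s|lborel. indicator {- pi / 2..pi / 2} s * (norm (\<Sum>n<M. exp (\<i> * of_real (2 * of_int (int n) * s)) * z n))\<^sup>2)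
      = pi * (\<Sum>n<M. (norm (z n))\<^sup>2)"
    by (simp only: of_real_eq_iff)
qed

lemma sum_triangle_le:
  fixes f g :: "nat \<Rightarrow> real"
  assumes "\<And>k. 0 \<le> f k" "\<And>k. 0 \<le> g k"
  shows "(\<Sum>L<M. \<Sum>k\<le>L. f k * g (L - k)) \<le> (\<Sum>k<M. f k) * (\<Sum>j<M. g j)"
proof -
  have "(\<Sum>L<M. \<Sum>k\<le>L. f k * g (L - k)) = (\<Sum>(a, b)\<in>{(a, b). a + b < M}. f a * g b)"
    by (rule sum.triangle_reindex[symmetric])
  also have "\<dots> \<le> (\<Sum>(a, b)\<in>{..<M} \<times> {..<M}. f a * g b)"
    using assms by (intro sum_mono2) auto
  finally show ?thesis by (simp add: sum_product sum.cartesian_product)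
qed

text \<open>The part of total degree L in the cube of the Hermite series with coefficients
  c.\<close>

definition triple :: "(nat \<Rightarrow> complex) \<Rightarrow> nat \<Rightarrow> real \<Rightarrow> complex" where
  "triple c L t = (\<Sum>k\<le>L. expand (L - k) (\<lambda>a b. c a * c b * c k) (hhc t) (hhc t) * hhc t k)"

lemma triple_sum_bound:
  assumes "ell2 C c"
  shows "(\<Sum>L<M. LINT t|lborel. (norm (triple c L t))\<^sup>2) \<le> C ^ 6"
proof -
  have C: "0 \<le> C" using assms by (simp add: ell2_def)
  have "(\<Sum>L<M. LINT t|lborel. (norm (triple c L t))\<^sup>2) \<le>
      (\<Sum>L<M. \<Sum>k\<le>L. degree_energy (L - k) (\<lambda>a b. c a * c b * c k))"
    unfolding triple_def by (intro sum_mono trilinear_bound)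
  also have "\<dots> = (\<Sum>L<M. \<Sum>k\<le>L. (norm (c k))\<^sup>2 * pair_mass (L - k) c c)"
    by (intro sum.cong refl)
      (simp add: degree_energy_def pair_mass_def norm_mult power_mult_distrib sum_distrib_left mult_ac)
  also have "\<dots> \<le> (\<Sum>k<M. (norm (c k))\<^sup>2) * (\<Sum>j<M. pair_mass j c c)"
    by (intro sum_triangle_le pair_mass_nonneg) auto
  also have "\<dots> \<le> C\<^sup>2 * (C\<^sup>2 * C\<^sup>2)"
    using assms by (intro mult_mono sum_pair_mass_le) (auto simp: ell2_def sum_nonneg pair_mass_nonneg)
  also have "\<dots> = C ^ 6" by (simp add: power_add[symmetric])
  finally show ?thesis .
qed

text \<open>The three phases multiply to exp(i s (2 L + 3)), which depends on the total degree L
  only. Thus the cube is, up to a unimodular factor, a trigonometric polynomial in s to which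
  Parseval applies at fixed x.\<close>

lemma herm_sum_cube:
  assumes c: "\<And>n. N \<le> n \<Longrightarrow> c n = 0"
  shows "(herm_sum (phase s c) N x) ^ 3 =
    exp (\<i> * of_real (3 * s)) * (\<Sum>L<3 * N. exp (\<i> * of_real (2 * of_int (int L) * s)) * triple c L x)"
proof -
  define y where "y = (\<lambda>n. phase s c n * hhc x n)"
  have y0: "y n = 0" if "N \<le> n" for n using c[OF that] by (simp add: y_def phase_def)
  define p where "p = (\<lambda>M. \<Sum>a\<le>M. y a * y (M - a))"
  have p0: "p M = 0" if "2 * N \<le> M" for M
    unfolding p_def
  proof (rule sum.neutral, rule ballI)
    fix a assume "a \<in> {..M}"
    then have "N \<le> a \<or> N \<le> M - a" using that by auto
    then show "y a * y (M - a) = 0" using y0 by auto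
  qed
  have u: "herm_sum (phase s c) N x = (\<Sum>n<N. y n)" by (simp add: herm_sum_def y_def hermite_fun_hh)
  have "(\<Sum>n<N. y n) * (\<Sum>n<N. y n) = (\<Sum>a<N. \<Sum>b<N. y a * y b)" by (rule sum_product)
  also have "\<dots> = (\<Sum>M<2 * N. p M)"
    unfolding p_def by (rule sum_triangle_rectangle[symmetric]) (use y0 in auto)
  finally have sq: "(\<Sum>n<N. y n) * (\<Sum>n<N. y n) = (\<Sum>M<2 * N. p M)" .
  have "(\<Sum>n<N. y n) * (\<Sum>M<2 * N. p M) = (\<Sum>k<N. \<Sum>M<2 * N. y k * p M)" by (rule sum_product)
  also have "\<dots> = (\<Sum>L<3 * N. \<Sum>k\<le>L. y k * p (L - k))"
    by (rule sum_triangle_rectangle[symmetric]) (use y0 p0 in auto)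
  also have "\<dots> = (\<Sum>L<3 * N. exp (\<i> * of_real (3 * s)) * (exp (\<i> * of_real (2 * of_int (int L) * s)) * triple c L x))"
  proof (intro sum.cong refl)
    fix L
    have "y k * p (L - k) = exp (\<i> * of_real (3 * s)) * (exp (\<i> * of_real (2 * of_int (int L) * s)) *
        (expand (L - k) (\<lambda>a b. c a * c b * c k) (hhc x) (hhc x) * hhc x k))" if "k \<le> L" for k
    proof -
      have ph: "exp (\<i> * of_real s * of_nat (2 * k + 1)) * (exp (\<i> * of_real s * of_nat (2 * a + 1)) *
          exp (\<i> * of_real s * of_nat (2 * (L - k - a) + 1))) =
          exp (\<i> * of_real (3 * s)) * exp (\<i> * of_real (2 * of_int (int L) * s))" if "a \<le> L - k" for a
      proof -
        have "(2 * k + 1) + ((2 * a + 1) + (2 * (L - k - a) + 1)) = 3 + 2 * L"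
          using that \<open>k \<le> L\<close> by arith
        then have "complex_of_nat (2 * k + 1) + (of_nat (2 * a + 1) + of_nat (2 * (L - k - a) + 1)) = of_nat (3 + 2 * L)"
          by (simp only: of_nat_add[symmetric])
        then have "complex_of_nat (2 * k + 1) + (of_nat (2 * a + 1) + of_nat (2 * (L - k - a) + 1)) = 3 + 2 * of_nat L"
          by (simp only: of_nat_add of_nat_mult of_nat_numeral)
        then have "\<i> * of_real s * of_nat (2 * k + 1) + (\<i> * of_real s * of_nat (2 * a + 1) + \<i> * of_real s * of_nat (2 * (L - k - a) + 1)) = \<i> * of_real s * (3 + 2 * of_nat L)"
          by (simp only: distrib_left[symmetric])
        also have "\<dots> = \<i> * of_real (3 * s) + \<i> * of_real (2 * of_int (int L) * s)"
          by (simp add: algebra_simps)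
        finally show ?thesis by (simp only: mult_exp_exp)
      qed
      have "y k * p (L - k) = (\<Sum>a\<le>L - k. (exp (\<i> * of_real s * of_nat (2 * k + 1)) * (exp (\<i> * of_real s * of_nat (2 * a + 1)) *
          exp (\<i> * of_real s * of_nat (2 * (L - k - a) + 1)))) * (c a * c (L - k - a) * c k * hhc x a * hhc x (L - k - a) * hhc x k))"
        unfolding p_def y_def phase_def sum_distrib_left by (intro sum.cong refl) (simp only: mult_ac)
      also have "\<dots> = (\<Sum>a\<le>L - k. (exp (\<i> * of_real (3 * s)) * exp (\<i> * of_real (2 * of_int (int L) * s))) * (c a * c (L - k - a) * c k * hhc x a * hhc x (L - k - a) * hhc x k))"
        by (intro sum.cong refl) (simp only: atMost_iff ph)
      also have "\<dots> = exp (\<i> * of_real (3 * s)) * (exp (\<i> * of_real (2 * of_int (int L) * s)) *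
        (expand (L - k) (\<lambda>a b. c a * c b * c k) (hhc x) (hhc x) * hhc x k))"
        unfolding expand_def sum_distrib_left sum_distrib_right by (intro sum.cong refl) (simp only: mult_ac)
      finally show ?thesis .
    qed
    then show "(\<Sum>k\<le>L. y k * p (L - k)) = exp (\<i> * of_real (3 * s)) * (exp (\<i> * of_real (2 * of_int (int L) * s)) * triple c L x)"
      unfolding triple_def sum_distrib_left by (intro sum.cong refl) (simp only: atMost_iff)
  qed
  finally have "(\<Sum>n<N. y n) * ((\<Sum>n<N. y n) * (\<Sum>n<N. y n)) =
      exp (\<i> * of_real (3 * s)) * (\<Sum>L<3 * N. exp (\<i> * of_real (2 * of_int (int L) * s)) * triple c L x)"
    unfolding sq sum_distrib_left[symmetric] .
  then show ?thesis
    unfolding u by (simp only: power3_eq_cube mult.assoc)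
qed

lemma herm_sum_joint_continuous: "continuous_on UNIV (\<lambda>p. herm_sum (phase (fst p) c) N (snd p))"
proof -
  have "continuous_on UNIV (\<lambda>p::real \<times> real. hh n (snd p))" for n
    by (rule continuous_on_compose2[OF isCont_hh(1)[of UNIV n]]) (auto intro!: continuous_intros)
  then show ?thesis unfolding herm_sum_def phase_def hermite_fun_hh by (intro continuous_intros)
qed

lemma herm_sum_joint_measurable [measurable]:
  "(\<lambda>(s, x). herm_sum (phase s c) N x) \<in> borel_measurable (borel \<Otimes>\<^sub>M borel)"
  using borel_measurable_continuous_onI[OF herm_sum_joint_continuous[of c N]]
  by (simp add: borel_prod case_prod_unfold)

text \<open>Write |u|^6 as |u^3|^2 and integrate in s first: Parseval over a full period separates
  the degrees, and the trilinear estimate handles each of them. The factor pi is the period.\<close>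

lemma Strichartz_finite:
  assumes "ell2 C c"
  shows "(\<integral>\<^sup>+s. \<integral>\<^sup>+x. ennreal (indicator {- pi / 2..pi / 2} s * norm (herm_sum (phase s c) N x) ^ 6) \<partial>lborel \<partial>lborel)
    \<le> ennreal (pi * C ^ 6)"
proof -
  define c' where "c' = (\<lambda>n. if n < N then c n else 0)"
  have c': "ell2 C c'" using assms by (rule ell2_mono) (auto simp: c'_def)
  have eq: "herm_sum (phase s c) N x = herm_sum (phase s c') N x" for s x
    unfolding herm_sum_def phase_def c'_def by (intro sum.cong) auto
  have n6: "norm (herm_sum (phase s c) N x) ^ 6 =
      (norm (\<Sum>L<3 * N. exp (\<i> * of_real (2 * of_int (int L) * s)) * triple c' L x))\<^sup>2" for s x
  proof -
    have "norm (herm_sum (phase s c) N x) ^ 6 = (norm ((herm_sum (phase s c') N x) ^ 3))\<^sup>2"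
      by (simp add: eq norm_power power_mult[symmetric])
    also have "norm ((herm_sum (phase s c') N x) ^ 3) =
        norm (\<Sum>L<3 * N. exp (\<i> * of_real (2 * of_int (int L) * s)) * triple c' L x)"
      by (subst herm_sum_cube, simp add: c'_def) (simp only: norm_mult norm_exp_i_times mult_1)
    finally show ?thesis .
  qed
  have "(\<integral>\<^sup>+s. \<integral>\<^sup>+x. ennreal (indicator {- pi / 2..pi / 2} s * norm (herm_sum (phase s c) N x) ^ 6) \<partial>lborel \<partial>lborel)
     = (\<integral>\<^sup>+x. \<integral>\<^sup>+s. ennreal (indicator {- pi / 2..pi / 2} s * norm (herm_sum (phase s c) N x) ^ 6) \<partial>lborel \<partial>lborel)"
  proof (rule lborel_pair.Fubini'[symmetric])
    show "(\<lambda>(s, x). ennreal (indicator {- pi / 2..pi / 2} s * norm (herm_sum (phase s c) N x) ^ 6)) \<in> borel_measurable (lborel \<Otimes>\<^sub>M lborel)"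
      by measurable
  qed
  also have "\<dots> = (\<integral>\<^sup>+x. ennreal (pi * (\<Sum>L<3 * N. (norm (triple c' L x))\<^sup>2)) \<partial>lborel)"
  proof (rule nn_integral_cong)
    fix x
    show "(\<integral>\<^sup>+s. ennreal (indicator {- pi / 2..pi / 2} s * norm (herm_sum (phase s c) N x) ^ 6) \<partial>lborel) =
        ennreal (pi * (\<Sum>L<3 * N. (norm (triple c' L x))\<^sup>2))"
      unfolding n6 by (subst nn_integral_eq_integral[OF Parseval_period(1)]) (simp_all only: Parseval_period(2), simp)
  qed
  also have "\<dots> = ennreal (LINT x|lborel. pi * (\<Sum>L<3 * N. (norm (triple c' L x))\<^sup>2))"
  proof (rule nn_integral_eq_integral)
    show "integrable lborel (\<lambda>x. pi * (\<Sum>L<3 * N. (norm (triple c' L x))\<^sup>2))"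
      unfolding triple_def by (intro integrable_mult_right Bochner_Integration.integrable_sum trilinear_bound)
  qed (simp add: sum_nonneg)
  also have "(LINT x|lborel. pi * (\<Sum>L<3 * N. (norm (triple c' L x))\<^sup>2)) =
      pi * (\<Sum>L<3 * N. LINT x|lborel. (norm (triple c' L x))\<^sup>2)"
    unfolding triple_def
    by (simp only: integral_mult_right_zero Bochner_Integration.integral_sum trilinear_bound(1))
  also have "ennreal \<dots> \<le> ennreal (pi * C ^ 6)"
    by (intro ennreal_leI mult_left_mono triple_sum_bound c') simp
  finally show ?thesis .
qed

text \<open>\<open>propagator\<close> picks representatives independently for each s and need not be
  measurable in s. V is a pointwise limit along a subsequence independent of s, hence jointly
  measurable, and represents the same L2 element at every time.\<close>

lemma propagator_joint:
  assumes f: "f \<in> L2"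
  obtains V :: "real \<Rightarrow> real \<Rightarrow> complex" and \<kappa> :: "nat \<Rightarrow> nat" where "strict_mono \<kappa>"
    and "(\<lambda>(s, x). V s x) \<in> borel_measurable (borel \<Otimes>\<^sub>M borel)"
    and "\<And>s. V s \<in> L2" "\<And>s. AE x in lborel. propagator s f x = V s x"
    and "\<And>s. AE x in lborel. (\<lambda>k. herm_sum (phase s (coef f)) (\<kappa> k) x) \<longlonglongrightarrow> V s x"
    and "\<And>s N. (L2_norm (\<lambda>x. V s x - herm_sum (phase s (coef f)) N x))\<^sup>2 \<le> tail (coef f) N"
proof (rule Riesz_Fischer_Hermite[OF Bessel[OF f]])
  fix \<kappa> :: "nat \<Rightarrow> nat"
  define V where "V = (\<lambda>s x. lim (\<lambda>k. herm_sum (phase s (coef f)) (\<kappa> k) x))"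
  have ph: "norm (phase s (coef f) n) \<le> norm (coef f n)" for s n by (simp add: norm_phase)
  assume mono: "strict_mono \<kappa>"
    and AE: "\<And>e. (\<And>n. norm (e n) \<le> norm (coef f n)) \<Longrightarrow>
      AE x in lborel. (\<lambda>k. herm_sum e (\<kappa> k) x) \<longlonglongrightarrow> lim (\<lambda>k. herm_sum e (\<kappa> k) x)"
    and L2: "\<And>e. (\<And>n. norm (e n) \<le> norm (coef f n)) \<Longrightarrow> (\<lambda>x. lim (\<lambda>k. herm_sum e (\<kappa> k) x)) \<in> L2"
    and t: "\<And>e N. (\<And>n. norm (e n) \<le> norm (coef f n)) \<Longrightarrow>
      (L2_norm (\<lambda>x. lim (\<lambda>k. herm_sum e (\<kappa> k) x) - herm_sum e N x))\<^sup>2 \<le> tail (coef f) N"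
  have V: "V s \<in> L2" for s unfolding V_def by (rule L2[OF ph])
  have tV: "(L2_norm (\<lambda>x. V s x - herm_sum (phase s (coef f)) N x))\<^sup>2 \<le> tail (coef f) N" for s N
    unfolding V_def by (rule t[OF ph])
  show thesis
  proof (rule that[OF mono, of V])
    have "(\<lambda>p. lim (\<lambda>k. herm_sum (phase (fst p) (coef f)) (\<kappa> k) (snd p))) \<in> borel_measurable (borel \<Otimes>\<^sub>M borel)"
      using herm_sum_joint_measurable
      by (intro borel_measurable_lim_metric) (simp add: case_prod_unfold)
    then show "(\<lambda>(s, x). V s x) \<in> borel_measurable (borel \<Otimes>\<^sub>M borel)"
      by (simp add: V_def case_prod_unfold)
    show "AE x in lborel. propagator s f x = V s x" for s
      by (rule L2_limit_unique[OF propagator_L2(1)[OF f] V herm_sum_L2 propagator_L2(2)[OF f]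
          tail_norm_tendsto[OF Bessel[OF f] tV]])
    show "AE x in lborel. (\<lambda>k. herm_sum (phase s (coef f)) (\<kappa> k) x) \<longlonglongrightarrow> V s x" for s
      unfolding V_def by (rule AE[OF ph])
  qed (rule V tV)+
qed

lemma Strichartz:
  assumes c: "ell2 C c"
    and V[measurable]: "(\<lambda>(s, x). V s x) \<in> borel_measurable (borel \<Otimes>\<^sub>M borel)"
    and lim: "\<And>s. AE x in lborel. (\<lambda>k. herm_sum (phase s c) (\<kappa> k) x) \<longlonglongrightarrow> V s x"
  shows "(\<integral>\<^sup>+s. \<integral>\<^sup>+x. ennreal (indicator {- pi / 2..pi / 2} s * norm (V s x :: complex) ^ 6) \<partial>lborel \<partial>lborel)
    \<le> ennreal (pi * C ^ 6)"
proof -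
  define F where "F = (\<lambda>k s x. ennreal (indicator {- pi / 2..pi / 2} s * norm (herm_sum (phase s c) (\<kappa> k) x) ^ 6))"
  have F[measurable]: "(\<lambda>(s, x). F k s x) \<in> borel_measurable (borel \<Otimes>\<^sub>M borel)" for k
    unfolding F_def by measurable
  have "(\<integral>\<^sup>+x. ennreal (indicator {- pi / 2..pi / 2} s * norm (V s x) ^ 6) \<partial>lborel) \<le> liminf (\<lambda>k. \<integral>\<^sup>+x. F k s x \<partial>lborel)" for s
  proof -
    have "AE x in lborel. ennreal (indicator {- pi / 2..pi / 2} s * norm (V s x) ^ 6) = liminf (\<lambda>k. F k s x)"
      using lim[of s]
    proof eventually_elim
      case (elim x)
      have "(\<lambda>k. F k s x) \<longlonglongrightarrow> ennreal (indicator {- pi / 2..pi / 2} s * norm (V s x) ^ 6)"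
        unfolding F_def using elim
        by (intro tendsto_ennrealI tendsto_mult_left tendsto_power tendsto_norm)
      then show ?case by (intro lim_imp_Liminf[symmetric]) auto
    qed
    then have "(\<integral>\<^sup>+x. ennreal (indicator {- pi / 2..pi / 2} s * norm (V s x) ^ 6) \<partial>lborel) =
        (\<integral>\<^sup>+x. liminf (\<lambda>k. F k s x) \<partial>lborel)"
      by (rule nn_integral_cong_AE)
    also have "\<dots> \<le> liminf (\<lambda>k. \<integral>\<^sup>+x. F k s x \<partial>lborel)"
      by (rule nn_integral_liminf) measurable
    finally show ?thesis .
  qed
  then have "(\<integral>\<^sup>+s. \<integral>\<^sup>+x. ennreal (indicator {- pi / 2..pi / 2} s * norm (V s x) ^ 6) \<partial>lborel \<partial>lborel) \<le>
      (\<integral>\<^sup>+s. liminf (\<lambda>k. \<integral>\<^sup>+x. F k s x \<partial>lborel) \<partial>lborel)"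
    by (intro nn_integral_mono)
  also have "\<dots> \<le> liminf (\<lambda>k. \<integral>\<^sup>+s. \<integral>\<^sup>+x. F k s x \<partial>lborel \<partial>lborel)"
    by (rule nn_integral_liminf) measurable
  also have "\<dots> \<le> ennreal (pi * C ^ 6)"
  proof (rule Liminf_le)
    show "\<forall>\<^sub>F k in sequentially. (\<integral>\<^sup>+s. \<integral>\<^sup>+x. F k s x \<partial>lborel \<partial>lborel) \<le> ennreal (pi * C ^ 6)"
      unfolding F_def by (intro always_eventually allI Strichartz_finite[OF c])
  qed simp
  finally show ?thesis .
qed

section \<open>The cubic term\<close>

text \<open>The pairings in \<open>has_L2_integral\<close> agree with a Borel function only outside
  a null set; completeness of \<open>lebesgue\<close> makes them measurable, and the integral can be
  computed over \<open>lborel\<close>.\<close>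

lemma lebesgue_integral_AE_borel:
  fixes f g :: "real \<Rightarrow> complex"
  assumes "AE s in lborel. f s = g s" and g: "integrable lborel g"
  shows "integrable lebesgue f" "(LINT s|lebesgue. f s) = (LINT s|lborel. g s)"
proof -
  have AE: "AE s in lebesgue. f s = g s" using assms(1) by (rule AE_completion)
  have gm: "g \<in> borel_measurable lebesgue"
    using borel_measurable_integrable[OF g] by (intro measurable_completion) simp
  have fm: "f \<in> borel_measurable lebesgue"
  proof (rule measurableI)
    fix B :: "complex set" assume "B \<in> sets borel"
    then have S: "g -` B \<inter> space lebesgue \<in> sets lebesgue" using gm by (rule measurable_sets[rotated])
    have E: "AE s in lebesgue. s \<in> g -` B \<inter> space lebesgue \<longleftrightarrow> s \<in> f -` B \<inter> space lebesgue"
      using AE by eventually_elim auto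
    show "f -` B \<inter> space lebesgue \<in> sets lebesgue"
      by (rule completion.in_sets_AE[OF E S]) auto
  qed simp
  have "integrable lebesgue g" using g by (simp add: integrable_completion borel_measurable_integrable)
  then show "integrable lebesgue f" using integrable_cong_AE[OF fm gm AE] by simp
  have "(LINT s|lebesgue. f s) = (LINT s|lebesgue. g s)" by (rule integral_cong_AE[OF fm gm AE])
  also have "\<dots> = (LINT s|lborel. g s)" by (rule integral_completion) (use g in auto)
  finally show "(LINT s|lebesgue. f s) = (LINT s|lborel. g s)" .
qed

lemma coef_hermite: "coef (hermite_fun n) m = (if n = m then 1 else 0)"
  using hh_orthonormal[of n m]
  by (simp add: coef_def L2_inner_def hermite_fun_hh integral_complex_of_real flip: of_real_mult)

lemma coef_propagator:
  assumes "f \<in> L2"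
  shows "coef (propagator t f) n = phase t (coef f) n"
proof (rule LIMSEQ_unique)
  show "(\<lambda>N. \<Sum>m<N. phase t (coef f) m * cnj (coef (hermite_fun n) m)) \<longlonglongrightarrow> coef (propagator t f) n"
    unfolding coef_def[of "propagator t f"] by (rule propagator_inner[OF assms hermite_fun_L2])
  have "(\<Sum>m<N. phase t (coef f) m * cnj (coef (hermite_fun n) m)) = phase t (coef f) n" if "n < N" for N
    using that by (simp add: coef_hermite if_distrib[of cnj] if_distrib[of "\<lambda>x. _ * x"] cong: if_cong)
  then have "\<forall>\<^sub>F N in sequentially. phase t (coef f) n = (\<Sum>m<N. phase t (coef f) m * cnj (coef (hermite_fun n) m))"
    by (intro eventually_mono[OF eventually_gt_at_top[of n]]) simp
  then show "(\<lambda>N. \<Sum>m<N. phase t (coef f) m * cnj (coef (hermite_fun n) m)) \<longlonglongrightarrow> phase t (coef f) n"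
    by (rule Lim_transform_eventually[OF tendsto_const])
qed

definition cube :: "(real \<Rightarrow> complex) \<Rightarrow> real \<Rightarrow> complex" where
  "cube u y = of_real ((norm (u y))\<^sup>2) * u y"

lemma cube_measurable:
  assumes [measurable]: "u \<in> borel_measurable borel"
  shows "cube u \<in> borel_measurable borel"
  unfolding cube_def[abs_def] by measurable

lemma norm_cube_sq: "(norm (cube u x))\<^sup>2 = norm (u x) ^ 6"
  by (simp add: cube_def norm_mult power_mult_distrib power_mult[symmetric] power_add[symmetric] del: of_real_power)

lemma cube_L2:
  assumes "u \<in> borel_measurable borel" "integrable lborel (\<lambda>x. norm (u x) ^ 6)"
  shows "cube u \<in> L2"
  unfolding L2_def using assms by (simp add: norm_cube_sq cube_measurable)

lemma L2_AE_cong: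
  assumes "f \<in> L2" "g \<in> borel_measurable borel" "AE x in lborel. f x = g x"
  shows "g \<in> L2"
proof -
  have f[measurable]: "f \<in> borel_measurable borel" using assms(1) by (rule L2_measurable)
  note assms(2)[measurable]
  have m: "(\<lambda>x. (norm (f x))\<^sup>2) \<in> borel_measurable lborel" "(\<lambda>x. (norm (g x))\<^sup>2) \<in> borel_measurable lborel"
    by measurable
  have "AE x in lborel. (norm (g x))\<^sup>2 = (norm (f x))\<^sup>2"
    using assms(3) by eventually_elim simp
  then have "integrable lborel (\<lambda>x. (norm (g x))\<^sup>2) \<longleftrightarrow> integrable lborel (\<lambda>x. (norm (f x))\<^sup>2)"
    by (rule integrable_cong_AE[OF m(2,1)])
  then show ?thesis using assms(2) L2_integrable_sq[OF assms(1)] by (simp add: L2_def)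
qed

lemma L2_series:
  assumes d: "ell2 D d"
  obtains w where "w \<in> L2" "(\<lambda>N. L2_norm (\<lambda>x. w x - herm_sum d N x)) \<longlonglongrightarrow> 0"
proof (rule Riesz_Fischer_Hermite[OF d])
  fix \<kappa> :: "nat \<Rightarrow> nat"
  assume "\<And>e. (\<And>n. norm (e n) \<le> norm (d n)) \<Longrightarrow> (\<lambda>x. lim (\<lambda>k. herm_sum e (\<kappa> k) x)) \<in> L2"
    and "\<And>e N. (\<And>n. norm (e n) \<le> norm (d n)) \<Longrightarrow>
      (L2_norm (\<lambda>x. lim (\<lambda>k. herm_sum e (\<kappa> k) x) - herm_sum e N x))\<^sup>2 \<le> tail d N"
  then show thesis
    using tail_norm_tendsto[OF d] by (intro that[of "\<lambda>x. lim (\<lambda>k. herm_sum d (\<kappa> k) x)"]) auto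
qed

lemma has_L2_integral_unique:
  assumes "has_L2_integral F w A" "has_L2_integral F w' A"
  shows "AE x in lborel. w x = w' x"
proof -
  have L: "w \<in> L2" "w' \<in> L2" using assms by (auto simp: has_L2_integral_def)
  define g where "g = (\<lambda>x. w x - w' x)"
  have g: "g \<in> L2" unfolding g_def by (intro L2_diff L)
  have "L2_inner w g = L2_inner w' g" using assms g unfolding has_L2_integral_def by metis
  then have "L2_inner g g = 0" using L2_inner_diff_left[OF L g] by (simp add: g_def)
  then have "L2_norm g = 0" by (simp add: L2_inner_self)
  from L2_norm_eq_0[OF g this] show ?thesis by eventually_elim (simp add: g_def)
qed

lemma propagator_representative:
  assumes "f \<in> L2"
  shows "\<exists>G. (\<lambda>(s, x). G s x) \<in> borel_measurable (borel \<Otimes>\<^sub>M borel) \<and> (\<forall>s. G s \<in> L2) \<and>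
    (\<forall>s. AE x in lborel. propagator s f x = G s x)"
  by (rule propagator_joint[OF assms]) blast

text \<open>\<open>L2_integral\<close> is a choice, so an integral w has to be produced. Testing
  with Hermite functions dictates its coefficients d; pairing with partial sums of d bounds them in
  ell2, Riesz-Fischer yields w, and dominated convergence extends the weak identity to every g.
  Uniqueness then identifies \<open>T4 f\<close> with w up to the factor 8 / pi.\<close>

lemma T4_char:
  assumes f: "f \<in> L2"
    and \<kappa>V: "(\<lambda>(s, x). V s x) \<in> borel_measurable (borel \<Otimes>\<^sub>M borel)"
      "\<And>s. V s \<in> L2" "\<And>s. AE x in lborel. propagator s f x = V s x"
      "\<And>s. AE x in lborel. (\<lambda>k. herm_sum (phase s (coef f)) (\<kappa> k) x) \<longlonglongrightarrow> V s x"
  defines "A \<equiv> {- pi / 4..pi / 4}"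
  obtains w d D where "w \<in> L2" "ell2 D d" "(\<lambda>N. L2_norm (\<lambda>x. w x - herm_sum d N x)) \<longlonglongrightarrow> 0"
    and "AE x in lborel. T4 f x = of_real (8 / pi) * w x"
    and "AE s in lborel. s \<in> A \<longrightarrow> integrable lborel (\<lambda>x. norm (V s x) ^ 6)"
    and "integrable lborel (\<lambda>s. indicator A s * (LINT x|lborel. norm (V s x) ^ 6))"
    and "\<And>n. d n = (LINT s|lborel. indicator A s *\<^sub>R (exp (- \<i> * of_real s * of_nat (2 * n + 1)) * coef (cube (V s)) n))"
    and "\<And>g G. \<lbrakk>g \<in> L2; (\<lambda>(s, x). G s x) \<in> borel_measurable (borel \<Otimes>\<^sub>M borel); \<And>s. G s \<in> L2;
      \<And>s. AE x in lborel. propagator s g x = G s x\<rbrakk> \<Longrightarrow>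
      integrable lborel (\<lambda>s. indicator A s *\<^sub>R L2_inner (cube (V s)) (G s)) \<and>
      L2_inner w g = (LINT s|lborel. indicator A s *\<^sub>R L2_inner (cube (V s)) (G s))"
proof -
  note [measurable] = \<kappa>V(1)
  have A_sets[measurable]: "A \<in> sets borel" by (simp add: A_def)
  define C where "C = L2_norm f"
  have c: "ell2 C (coef f)" unfolding C_def by (rule Bessel[OF f])
  \<comment> \<open>The window A lies inside the full period of \<open>Strichartz\<close>, so I has
    finite integral over A and is finite at almost every s in A; all pointwise statements below are
    made at such s.\<close>
  define I where "I = (\<lambda>s. \<integral>\<^sup>+x. ennreal (norm (V s x) ^ 6) \<partial>lborel)"
  have I_meas[measurable]: "I \<in> borel_measurable borel" unfolding I_def by measurable
  have "(\<integral>\<^sup>+s. ennreal (indicator A s) * I s \<partial>lborel) \<le>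
      (\<integral>\<^sup>+s. \<integral>\<^sup>+x. ennreal (indicator {- pi / 2..pi / 2} s * norm (V s x) ^ 6) \<partial>lborel \<partial>lborel)"
  proof (rule nn_integral_mono)
    fix s
    have "ennreal (indicator A s) * I s = (\<integral>\<^sup>+x. ennreal (indicator A s) * ennreal (norm (V s x) ^ 6) \<partial>lborel)"
      unfolding I_def by (rule nn_integral_cmult[symmetric]) measurable
    also have "\<dots> \<le> (\<integral>\<^sup>+x. ennreal (indicator {- pi / 2..pi / 2} s * norm (V s x) ^ 6) \<partial>lborel)"
    proof (rule nn_integral_mono)
      fix x
      have "indicator A s \<le> (indicator {- pi / 2..pi / 2} s :: real)" by (auto simp: A_def indicator_def)
      then show "ennreal (indicator A s) * ennreal (norm (V s x) ^ 6) \<le> ennreal (indicator {- pi / 2..pi / 2} s * norm (V s x) ^ 6)"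
        by (subst ennreal_mult[symmetric]) (auto intro!: ennreal_leI mult_right_mono)
    qed
    finally show "ennreal (indicator A s) * I s \<le> (\<integral>\<^sup>+x. ennreal (indicator {- pi / 2..pi / 2} s * norm (V s x) ^ 6) \<partial>lborel)" .
  qed
  also have "\<dots> \<le> ennreal (pi * C ^ 6)" by (rule Strichartz[OF c \<kappa>V(1,4)])
  finally have I_fin: "(\<integral>\<^sup>+s. ennreal (indicator A s) * I s \<partial>lborel) < \<infinity>" by (rule le_less_trans) simp
  have "AE s in lborel. ennreal (indicator A s) * I s \<noteq> \<infinity>"
    by (rule nn_integral_PInf_AE) (use I_fin in auto)
  then have I_AE: "AE s in lborel. s \<in> A \<longrightarrow> I s < \<infinity>"
    by eventually_elim (auto simp: less_top)
  define i where "i = (\<lambda>s. LINT x|lborel. norm (V s x) ^ 6)"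
  have V_meas[measurable]: "V s \<in> borel_measurable borel" for s using \<kappa>V(2) by (rule L2_measurable)
  have V6: "integrable lborel (\<lambda>x. norm (V s x) ^ 6)" if "I s < \<infinity>" for s
    by (rule integrableI_bounded) (use that in \<open>auto simp: I_def\<close>)
  have I_i: "I s = ennreal (i s)" if "I s < \<infinity>" for s
    unfolding I_def i_def by (rule nn_integral_eq_integral[OF V6[OF that]]) simp
  have i0: "0 \<le> i s" for s unfolding i_def by (intro integral_nonneg_AE) simp
  have i_meas[measurable]: "i \<in> borel_measurable borel" unfolding i_def by measurable
  have i_int: "integrable lborel (\<lambda>s. indicator A s * i s)"
  proof (rule integrableI_bounded)
    have "(\<integral>\<^sup>+s. ennreal (norm (indicator A s * i s)) \<partial>lborel) = (\<integral>\<^sup>+s. ennreal (indicator A s) * I s \<partial>lborel)"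
      using I_AE
      by (intro nn_integral_cong_AE, eventually_elim) (auto simp: I_i i0 indicator_def)
    then show "(\<integral>\<^sup>+s. ennreal (norm (indicator A s * i s)) \<partial>lborel) < \<infinity>" using I_fin by simp
  qed (simp add: A_def)
  \<comment> \<open>Common majorant: the cube has L2 norm sqrt (i s), and sqrt (i s) \<le> 1 + i s
    is integrable over A.\<close>
  define b where "b = (\<lambda>s. indicator A s * (1 + i s))"
  have b_int: "integrable lborel b"
  proof -
    have "integrable lborel (\<lambda>s. indicator A s + indicator A s * i s :: real)"
      by (intro Bochner_Integration.integrable_add i_int) (simp add: A_def)
    then show ?thesis by (simp add: b_def distrib_left)
  qed
  have b0: "0 \<le> b s" for s using i0 by (simp add: b_def)
  define F where "F = (\<lambda>s. propagator (- s) (cube (propagator s f)))"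
  have P_meas[measurable]: "propagator s f \<in> borel_measurable borel" for s
    using propagator_L2(1)[OF f] by (rule L2_measurable)
  have cubeV: "cube (V s) \<in> L2" if "I s < \<infinity>" for s by (rule cube_L2[OF V_meas V6[OF that]])
  have cubeAE: "AE x in lborel. cube (V s) x = cube (propagator s f) x" for s
    using \<kappa>V(3)[of s] by eventually_elim (simp add: cube_def)
  have cubeP: "cube (propagator s f) \<in> L2" if "I s < \<infinity>" for s
    by (rule L2_AE_cong[OF cubeV[OF that] cube_measurable[OF P_meas] cubeAE])
  have F_L2: "F s \<in> L2" if "I s < \<infinity>" for s unfolding F_def by (rule propagator_L2(1)[OF cubeP[OF that]])
  have cube_norm: "L2_norm (cube (V s)) \<le> 1 + i s" for s
  proof -
    have "L2_norm (cube (V s)) = sqrt (i s)" unfolding L2_norm_def norm_cube_sq i_def ..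
    also have "\<dots> \<le> 1 + i s"
      using i0[of s] by (intro real_le_lsqrt) (auto simp: power2_eq_square algebra_simps)
    finally show ?thesis .
  qed
  have F_norm: "L2_norm (F s) \<le> 1 + i s" if "I s < \<infinity>" for s
  proof -
    have "L2_norm (F s) \<le> L2_norm (cube (propagator s f))" unfolding F_def by (rule propagator_norm_le[OF cubeP[OF that]])
    also have "\<dots> = L2_norm (cube (V s))"
      by (rule L2_norm_cong_AE[OF _ cubeP[OF that] cubeV[OF that]]) (use cubeAE[of s] in \<open>eventually_elim, simp\<close>)
    finally show ?thesis using cube_norm[of s] by linarith
  qed
  \<comment> \<open>Moves the propagator onto the test function by adjointness and then replaces
    both choices by jointly measurable representatives, so that the right-hand side is measurable in
    s.\<close>
  have F_inner: "L2_inner (F s) g = L2_inner (cube (V s)) (G s)"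
    if "I s < \<infinity>" "g \<in> L2" "\<And>s. G s \<in> L2" "\<And>s. AE x in lborel. propagator s g x = G s x" for s g G
  proof -
    have "L2_inner (F s) g = L2_inner (cube (propagator s f)) (propagator s g)"
      unfolding F_def by (rule propagator_adjoint[OF cubeP[OF that(1)] that(2)])
    also have "\<dots> = L2_inner (cube (V s)) (propagator s g)"
      by (rule L2_inner_cong_AE[OF _ cubeP[OF that(1)] cubeV[OF that(1)] propagator_L2(1)[OF that(2)]])
        (use cubeAE[of s] in \<open>eventually_elim, simp\<close>)
    also have "\<dots> = cnj (L2_inner (propagator s g) (cube (V s)))" by (rule L2_inner_cnj[symmetric])
    also have "L2_inner (propagator s g) (cube (V s)) = L2_inner (G s) (cube (V s))"
      by (rule L2_inner_cong_AE[OF that(4) propagator_L2(1)[OF that(2)] that(3) cubeV[OF that(1)]])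
    finally show ?thesis by (simp only: L2_inner_cnj)
  qed
  have M: "integrable lborel (\<lambda>s. indicator A s *\<^sub>R L2_inner (cube (V s)) (G s)) \<and>
      set_integrable lebesgue A (\<lambda>s. L2_inner (F s) g) \<and>
      (LINT s:A|lebesgue. L2_inner (F s) g) = (LINT s|lborel. indicator A s *\<^sub>R L2_inner (cube (V s)) (G s)) \<and>
      norm (LINT s|lborel. indicator A s *\<^sub>R L2_inner (cube (V s)) (G s)) \<le> (LINT s|lborel. b s) * L2_norm g"
    if g: "g \<in> L2" and G[measurable]: "(\<lambda>(s, x). G s x) \<in> borel_measurable (borel \<Otimes>\<^sub>M borel)"
      and GL: "\<And>s. G s \<in> L2" and GP: "\<And>s. AE x in lborel. propagator s g x = G s x" for g G
  proof -
    define m where "m = (\<lambda>s. indicator A s *\<^sub>R L2_inner (cube (V s)) (G s))"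
    have cnjm[measurable]: "cnj \<in> borel_measurable borel" by (intro borel_measurable_continuous_onI continuous_intros)
    have [measurable]: "(\<lambda>s. L2_inner (cube (V s)) (G s)) \<in> borel_measurable borel"
      unfolding L2_inner_def cube_def by measurable
    have [measurable]: "m \<in> borel_measurable borel" unfolding m_def A_def by measurable
    have bound: "AE s in lborel. norm (m s) \<le> norm (b s * L2_norm g)"
      using I_AE
    proof eventually_elim
      case (elim s)
      show ?case
      proof (cases "s \<in> A")
        case True
        then have Is: "I s < \<infinity>" using elim by simp
        have "norm (m s) = norm (L2_inner (F s) g)" using True F_inner[OF Is g GL GP] by (simp add: m_def)
        also have "\<dots> \<le> L2_norm (F s) * L2_norm g" by (rule L2_inner_le[OF F_L2[OF Is] g])
        also have "\<dots> \<le> (1 + i s) * L2_norm g" by (intro mult_right_mono F_norm[OF Is] L2_norm_nonneg)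
        finally show ?thesis using True i0[of s] L2_norm_nonneg[of g] by (simp add: b_def abs_mult)
      qed (simp add: m_def)
    qed
    have int: "integrable lborel m"
      by (rule Bochner_Integration.integrable_bound[OF integrable_mult_left[OF b_int] _ bound]) simp
    have AE: "AE s in lborel. indicator A s *\<^sub>R L2_inner (F s) g = m s"
      using I_AE by eventually_elim (auto simp: m_def indicator_def F_inner[OF _ g GL GP])
    have "norm (LINT s|lborel. m s) \<le> (LINT s|lborel. norm (m s))" by (rule integral_norm_bound)
    also have "\<dots> \<le> (LINT s|lborel. b s * L2_norm g)"
    proof (rule integral_mono_AE)
      show "AE s in lborel. norm (m s) \<le> b s * L2_norm g"
        using bound by eventually_elim (simp add: b0 L2_norm_nonneg abs_mult)
    qed (use int b_int in auto)
    finally have "norm (LINT s|lborel. m s) \<le> (LINT s|lborel. b s) * L2_norm g" by simp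
    then show ?thesis
      using lebesgue_integral_AE_borel[OF AE int] int
      unfolding set_integrable_def set_lebesgue_integral_def m_def by blast
  qed
  \<comment> \<open>Explicit representative of the propagated Hermite function, jointly measurable
    by continuity.\<close>
  define H where "H = (\<lambda>n s x. exp (\<i> * of_real s * of_nat (2 * n + 1)) * hermite_fun n x)"
  have H_joint: "(\<lambda>(s, x). H n s x) \<in> borel_measurable (borel \<Otimes>\<^sub>M borel)" for n
  proof -
    have "continuous_on UNIV (\<lambda>p::real \<times> real. hh n (snd p))"
      by (rule continuous_on_compose2[OF isCont_hh(1)[of UNIV n]]) (auto intro!: continuous_intros)
    then have "continuous_on UNIV (\<lambda>p. H n (fst p) (snd p))"
      unfolding H_def hermite_fun_hh by (intro continuous_intros)
    from borel_measurable_continuous_onI[OF this] show ?thesis by (simp add: borel_prod case_prod_unfold)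
  qed
  have H_L2: "H n s \<in> L2" for n s unfolding H_def by (rule L2_scale[OF hermite_fun_L2])
  have H_prop: "AE x in lborel. propagator s (hermite_fun n) x = H n s x" for n s
  proof (rule L2_limit_unique[OF propagator_L2(1)[OF hermite_fun_L2] H_L2 herm_sum_L2 propagator_L2(2)[OF hermite_fun_L2]])
    have "herm_sum (phase s (coef (hermite_fun n))) N x = H n s x" if "n < N" for N x
      using that unfolding herm_sum_def phase_def coef_hermite H_def
      by (simp add: if_distrib[of "\<lambda>x. _ * x"] if_distrib[of "\<lambda>x. x * _"] cong: if_cong)
    then have "L2_norm (\<lambda>x. H n s x - herm_sum (phase s (coef (hermite_fun n))) N x) = 0" if "n < N" for N
      using that by (simp add: L2_norm_def)
    then have "\<forall>\<^sub>F N in sequentially. 0 = L2_norm (\<lambda>x. H n s x - herm_sum (phase s (coef (hermite_fun n))) N x)"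
      by (intro eventually_mono[OF eventually_gt_at_top[of n]]) simp
    then show "(\<lambda>N. L2_norm (\<lambda>x. H n s x - herm_sum (phase s (coef (hermite_fun n))) N x)) \<longlonglongrightarrow> 0"
      by (rule Lim_transform_eventually[OF tendsto_const])
  qed
  have H_inner: "L2_inner (cube (V s)) (H n s) = exp (- \<i> * of_real s * of_nat (2 * n + 1)) * coef (cube (V s)) n" for n s
  proof -
    have "L2_inner (cube (V s)) (H n s) = cnj (L2_inner (H n s) (cube (V s)))" by (rule L2_inner_cnj[symmetric])
    also have "L2_inner (H n s) (cube (V s)) = exp (\<i> * of_real s * of_nat (2 * n + 1)) * L2_inner (hermite_fun n) (cube (V s))"
      unfolding H_def by (rule L2_inner_scale_left)
    finally show ?thesis by (simp add: coef_def L2_inner_cnj exp_cnj)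
  qed
  define d where "d = (\<lambda>n. LINT s|lborel. indicator A s *\<^sub>R L2_inner (cube (V s)) (H n s))"
  have hI: "integrable lborel (\<lambda>s. indicator A s *\<^sub>R L2_inner (cube (V s)) (H n s))" for n
    using M[OF hermite_fun_L2 H_joint H_L2 H_prop] by blast
  define D where "D = (LINT s|lborel. b s)"
  have D0: "0 \<le> D" unfolding D_def by (intro integral_nonneg_AE) (simp add: b0)
  have d: "ell2 D d"
    unfolding ell2_def
  proof (intro conjI allI D0)
    fix N
    \<comment> \<open>Pairing the would-be integral with its own partial sum gives S, the sum of |d
      n|^2, while the majorant bounds the pairing by D sqrt S.\<close>
    define y where "y = herm_sum d N"
    define S where "S = (\<Sum>n<N. (norm (d n))\<^sup>2)"
    have S0: "0 \<le> S" by (simp add: S_def sum_nonneg)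
    obtain Y :: "real \<Rightarrow> real \<Rightarrow> complex" and \<kappa>' :: "nat \<Rightarrow> nat" where Y: "(\<lambda>(s, x). Y s x) \<in> borel_measurable (borel \<Otimes>\<^sub>M borel)"
      "\<And>s. Y s \<in> L2" "\<And>s. AE x in lborel. propagator s y x = Y s x"
      using propagator_joint[OF herm_sum_L2[of d N]] unfolding y_def by metis
    note MY = M[OF herm_sum_L2[of d N, folded y_def] Y]
    have "AE s in lborel. indicator A s *\<^sub>R L2_inner (cube (V s)) (Y s) =
        (\<Sum>n<N. cnj (d n) * (indicator A s *\<^sub>R L2_inner (cube (V s)) (H n s)))"
      using I_AE
    proof eventually_elim
      case (elim s)
      show ?case
      proof (cases "s \<in> A")
        case True
        then have Is: "I s < \<infinity>" using elim by simp
        have "L2_inner (cube (V s)) (Y s) = L2_inner (F s) y"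
          by (rule F_inner[OF Is herm_sum_L2[of d N, folded y_def] Y(2,3), symmetric])
        also have "\<dots> = cnj (L2_inner (herm_sum d N) (F s))" by (simp add: L2_inner_cnj y_def)
        also have "\<dots> = (\<Sum>n<N. cnj (d n) * L2_inner (F s) (hermite_fun n))"
          by (simp add: L2_inner_herm_sum[OF F_L2[OF Is]] coef_def)
        also have "\<dots> = (\<Sum>n<N. cnj (d n) * L2_inner (cube (V s)) (H n s))"
          by (simp add: F_inner[OF Is hermite_fun_L2 H_L2 H_prop])
        finally show ?thesis using True by simp
      qed simp
    qed
    then have "(LINT s|lborel. indicator A s *\<^sub>R L2_inner (cube (V s)) (Y s)) =
        (LINT s|lborel. (\<Sum>n<N. cnj (d n) * (indicator A s *\<^sub>R L2_inner (cube (V s)) (H n s))))"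
    proof (rule integral_cong_AE[rotated 2])
      show "(\<lambda>s. indicator A s *\<^sub>R L2_inner (cube (V s)) (Y s)) \<in> borel_measurable lborel"
        by (rule borel_measurable_integrable[OF conjunct1[OF MY]])
      show "(\<lambda>s. \<Sum>n<N. cnj (d n) * (indicator A s *\<^sub>R L2_inner (cube (V s)) (H n s))) \<in> borel_measurable lborel"
        by (intro borel_measurable_integrable Bochner_Integration.integrable_sum integrable_mult_right hI)
    qed
    also have "\<dots> = (\<Sum>n<N. cnj (d n) * d n)"
      by (simp only: Bochner_Integration.integral_sum[OF integrable_mult_right[OF hI]] integral_mult_right_zero d_def)
    also have "\<dots> = of_real S"
      unfolding S_def of_real_sum by (intro sum.cong refl) (simp add: complex_norm_square mult.commute del: of_real_power)
    finally have "norm (complex_of_real S) \<le> D * L2_norm y" using MY unfolding D_def by simp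
    moreover have "L2_norm y = sqrt S"
      using herm_sum_norm[of d N] L2_norm_nonneg by (simp add: S_def y_def real_sqrt_unique)
    ultimately have "sqrt S * sqrt S \<le> D * sqrt S" using S0 by simp
    then have "sqrt S \<le> D"
      using S0 D0 mult_le_cancel_right_pos[of "sqrt S" "sqrt S" D]
      by (cases "S = 0") (simp_all del: real_sqrt_mult_self)
    then have "(sqrt S)\<^sup>2 \<le> D\<^sup>2" by (intro power_mono) (use S0 in auto)
    then show "(\<Sum>n<N. (norm (d n))\<^sup>2) \<le> D\<^sup>2" using S0 by (simp add: S_def)
  qed
  obtain w where w: "w \<in> L2" "(\<lambda>N. L2_norm (\<lambda>x. w x - herm_sum d N x)) \<longlonglongrightarrow> 0"
    using L2_series[OF d] by blast
  have wg: "L2_inner w g = (LINT s|lborel. indicator A s *\<^sub>R L2_inner (cube (V s)) (G s))"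
    if g: "g \<in> L2" and G: "(\<lambda>(s, x). G s x) \<in> borel_measurable (borel \<Otimes>\<^sub>M borel)"
      and GL: "\<And>s. G s \<in> L2" and GP: "\<And>s. AE x in lborel. propagator s g x = G s x" for g G
  proof (rule LIMSEQ_unique)
    show "(\<lambda>N. L2_inner (herm_sum d N) g) \<longlonglongrightarrow> L2_inner w g"
      by (rule L2_inner_tendsto[OF w(1) g herm_sum_L2 w(2)])
    \<comment> \<open>For almost every s in A this is the pairing of g with the N-th partial sum of
      \<open>F s\<close>: it converges as N grows and is dominated by
      \<open>b s * L2_norm g\<close>.\<close>
    define u where "u = (\<lambda>N s. \<Sum>n<N. (indicator A s *\<^sub>R L2_inner (cube (V s)) (H n s)) * cnj (coef g n))"
    have u_int: "integrable lborel (u N)" for N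
      unfolding u_def by (intro Bochner_Integration.integrable_sum integrable_mult_left hI)
    have "L2_inner (herm_sum d N) g = (LINT s|lborel. u N s)" for N
      by (simp only: L2_inner_herm_sum[OF g] u_def d_def integral_mult_left_zero
          Bochner_Integration.integral_sum[OF integrable_mult_left[OF hI]])
    moreover have "(\<lambda>N. LINT s|lborel. u N s) \<longlonglongrightarrow> (LINT s|lborel. indicator A s *\<^sub>R L2_inner (cube (V s)) (G s))"
    proof (rule integral_dominated_convergence)
      show "(\<lambda>s. indicator A s *\<^sub>R L2_inner (cube (V s)) (G s)) \<in> borel_measurable lborel"
        using M[OF g G GL GP] by (intro borel_measurable_integrable) blast
      show "u N \<in> borel_measurable lborel" for N by (intro borel_measurable_integrable u_int)
      show "integrable lborel (\<lambda>s. b s * L2_norm g)" by (intro integrable_mult_left b_int)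
      have uF: "u N s = (\<Sum>n<N. phase (- s) (coef (cube (propagator s f))) n * cnj (coef g n)) \<and>
          u N s = L2_inner (herm_sum (coef (F s)) N) g" if "s \<in> A" "I s < \<infinity>" for N s
      proof -
        have "u N s = (\<Sum>n<N. coef (F s) n * cnj (coef g n))"
          unfolding u_def using that
          by (simp add: F_inner[OF that(2) hermite_fun_L2 H_L2 H_prop, symmetric] coef_def[of "F s"])
        then show ?thesis
          by (simp add: L2_inner_herm_sum[OF g] F_def coef_propagator[OF cubeP[OF that(2)]])
      qed
      show "AE s in lborel. (\<lambda>N. u N s) \<longlonglongrightarrow> indicator A s *\<^sub>R L2_inner (cube (V s)) (G s)"
        using I_AE
      proof eventually_elim
        case (elim s)
        show ?case
        proof (cases "s \<in> A")
          case True
          then have Is: "I s < \<infinity>" using elim by simp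
          have "(\<lambda>N. u N s) \<longlonglongrightarrow> L2_inner (F s) g"
            using propagator_inner[OF cubeP[OF Is] g, of "- s"] uF[OF True Is] by (simp add: F_def)
          then show ?thesis using True F_inner[OF Is g GL GP] by simp
        qed (simp add: u_def)
      qed
      show "AE s in lborel. norm (u N s) \<le> b s * L2_norm g" for N
        using I_AE
      proof eventually_elim
        case (elim s)
        show ?case
        proof (cases "s \<in> A")
          case True
          then have Is: "I s < \<infinity>" using elim by simp
          have "norm (u N s) \<le> L2_norm (herm_sum (coef (F s)) N) * L2_norm g"
            unfolding conjunct2[OF uF[OF True Is]] by (rule L2_inner_le[OF herm_sum_L2 g])
          also have "\<dots> \<le> (1 + i s) * L2_norm g"
          proof (intro mult_right_mono L2_norm_nonneg)
            have "(L2_norm (herm_sum (coef (F s)) N))\<^sup>2 \<le> (L2_norm (F s))\<^sup>2"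
              using Bessel[OF F_L2[OF Is]] unfolding herm_sum_norm ell2_def by blast
            then have "L2_norm (herm_sum (coef (F s)) N) \<le> L2_norm (F s)"
              by (rule power2_le_imp_le[OF _ L2_norm_nonneg])
            then show "L2_norm (herm_sum (coef (F s)) N) \<le> 1 + i s" using F_norm[OF Is] by linarith
          qed
          finally show ?thesis using True by (simp add: b_def)
        qed (simp add: u_def b0 L2_norm_nonneg)
      qed
    qed
    ultimately show "(\<lambda>N. L2_inner (herm_sum d N) g) \<longlonglongrightarrow> (LINT s|lborel. indicator A s *\<^sub>R L2_inner (cube (V s)) (G s))"
      by simp
  qed
  have hasI: "has_L2_integral F w A"
    unfolding has_L2_integral_def
  proof (intro conjI ballI w)
    have "AE s in lborel. s \<in> A \<longrightarrow> F s \<in> L2"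
      using I_AE by eventually_elim (use F_L2 in blast)
    then show "AE s in lebesgue. s \<in> A \<longrightarrow> F s \<in> L2" by (rule AE_completion)
    fix g assume g: "g \<in> L2"
    obtain G where G: "(\<lambda>(s, x). G s x) \<in> borel_measurable (borel \<Otimes>\<^sub>M borel)"
      "\<And>s. G s \<in> L2" "\<And>s. AE x in lborel. propagator s g x = G s x"
      using propagator_representative[OF g] by blast
    show "set_integrable lebesgue A (\<lambda>s. L2_inner (F s) g)" using M[OF g G] by blast
    show "(LINT s:A|lebesgue. L2_inner (F s) g) = L2_inner w g" using M[OF g G] wg[OF g G] by simp
  qed
  then have "has_L2_integral F (L2_integral A F) A" unfolding L2_integral_def by (rule someI[of "\<lambda>w. has_L2_integral F w A"])
  then have "AE x in lborel. L2_integral A F x = w x" by (rule has_L2_integral_unique[OF _ hasI])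
  then have T4: "AE x in lborel. T4 f x = of_real (8 / pi) * w x"
    unfolding T4_def F_def A_def cube_def[abs_def] by eventually_elim simp
  show thesis
  proof (rule that[OF w(1) d w(2) T4])
    show "AE s in lborel. s \<in> A \<longrightarrow> integrable lborel (\<lambda>x. norm (V s x) ^ 6)"
      using I_AE by eventually_elim (auto intro: V6)
    show "integrable lborel (\<lambda>s. indicator A s * (LINT x|lborel. norm (V s x) ^ 6))"
      using i_int by (simp add: i_def)
    show "d n = (LINT s|lborel. indicator A s *\<^sub>R (exp (- \<i> * of_real s * of_nat (2 * n + 1)) * coef (cube (V s)) n))" for n
      unfolding d_def H_inner ..
  qed (use M wg in blast)
qed

section \<open>Completeness of the Hermite functions\<close>

text \<open>Positive and negative part of g have equal mass, by the case t = 0. If the mass is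
  positive, normalizing them gives two probability densities with equal characteristic functions,
  and Levy uniqueness applies.\<close>

lemma fourier_injective_real:
  fixes g :: "real \<Rightarrow> real"
  assumes g: "integrable lborel g"
    and zero: "\<And>t. (LINT x|lborel. g x *\<^sub>R iexp (t * x)) = 0"
  shows "AE x in lborel. g x = 0"
proof -
  have [measurable]: "g \<in> borel_measurable borel" using g by auto
  define p q where "p = (\<lambda>x. max 0 (g x))" and "q = (\<lambda>x. max 0 (- g x))"
  have int: "integrable lborel p" "integrable lborel q"
    unfolding p_def q_def using g by (auto intro: integrable_max)
  have [measurable]: "p \<in> borel_measurable borel" "q \<in> borel_measurable borel" using int by auto
  have pos: "0 \<le> p x" "0 \<le> q x" for x by (simp_all add: p_def q_def)
  have diff: "g x = p x - q x" for x by (auto simp: p_def q_def max_def)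
  define m where "m = (LINT x|lborel. p x)"
  have m0: "0 \<le> m" unfolding m_def by (intro integral_nonneg_AE) (simp add: pos)
  have "(LINT x|lborel. g x *\<^sub>R (1 :: complex)) = 0" using zero[of 0] by simp
  then have "(LINT x|lborel. complex_of_real (g x)) = 0" by (simp add: scaleR_conv_of_real)
  then have "(LINT x|lborel. g x) = 0" by (simp only: integral_complex_of_real of_real_eq_0_iff)
  then have mq: "(LINT x|lborel. q x) = m" unfolding m_def diff using int by simp
  have expi: "integrable lborel (\<lambda>x. h x *\<^sub>R iexp (t * x))" if "integrable lborel h" for h :: "real \<Rightarrow> real" and t
  proof (rule Bochner_Integration.integrable_bound[OF that])
    have [measurable]: "h \<in> borel_measurable borel" using that by auto
    show "(\<lambda>x. h x *\<^sub>R iexp (t * x)) \<in> borel_measurable lborel" by measurable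
    show "AE x in lborel. norm (h x *\<^sub>R iexp (t * x)) \<le> norm (h x)"
      by (simp only: norm_scaleR norm_exp_i_times) simp
  qed
  show ?thesis
  proof (cases "m = 0")
    case True
    have "AE x in lborel. p x = 0" "AE x in lborel. q x = 0"
      using integral_nonneg_eq_0_iff_AE[OF int(1)] integral_nonneg_eq_0_iff_AE[OF int(2)] pos True mq
      by (simp_all add: m_def)
    then show ?thesis by eventually_elim (simp add: diff)
  next
    case False
    then have m: "0 < m" using m0 by simp
    define M where "M = (\<lambda>h :: real \<Rightarrow> real. density lborel (\<lambda>x. ennreal (h x / m)))"
    have M: "real_distribution (M h) \<and> char (M h) t = (LINT x|lborel. (h x / m) *\<^sub>R iexp (t * x))"
      if h: "integrable lborel h" "\<And>x. 0 \<le> h x" "(LINT x|lborel. h x) = m" for h t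
    proof
      have [measurable]: "h \<in> borel_measurable borel" using h(1) by auto
      have "emeasure (M h) (space (M h)) = (\<integral>\<^sup>+x. ennreal (h x / m) \<partial>lborel)"
        unfolding M_def by (simp add: emeasure_density)
      also have "\<dots> = ennreal (LINT x|lborel. h x / m)"
        using h m by (intro nn_integral_eq_integral) auto
      also have "\<dots> = 1" using h(3) m by simp
      finally have "prob_space (M h)" by (rule prob_spaceI)
      then show "real_distribution (M h)"
        by (simp add: real_distribution_def real_distribution_axioms_def M_def)
      show "char (M h) t = (LINT x|lborel. (h x / m) *\<^sub>R iexp (t * x))"
        unfolding char_def M_def by (rule integral_density) (use h(2) m in auto)
    qed
    have "char (M p) t = char (M q) t" for t
    proof -
      have e: "(LINT x|lborel. (h x / m) *\<^sub>R iexp (t * x)) = of_real (1 / m) * (LINT x|lborel. h x *\<^sub>R iexp (t * x))" for h :: "real \<Rightarrow> real"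
        unfolding integral_mult_right_zero[symmetric] by (simp add: scaleR_conv_of_real)
      have "(LINT x|lborel. p x *\<^sub>R iexp (t * x)) - (LINT x|lborel. q x *\<^sub>R iexp (t * x)) =
          (LINT x|lborel. g x *\<^sub>R iexp (t * x))"
        unfolding diff scaleR_left_diff_distrib
        by (rule Bochner_Integration.integral_diff[symmetric]) (intro expi int)+
      then have "(LINT x|lborel. p x *\<^sub>R iexp (t * x)) = (LINT x|lborel. q x *\<^sub>R iexp (t * x))"
        unfolding zero by simp
      then show ?thesis
        by (simp only: M[OF int(1) pos(1) m_def[symmetric]] M[OF int(2) pos(2) mq] e)
    qed
    then have "M p = M q"
      using M[OF int(1) pos(1) m_def[symmetric]] M[OF int(2) pos(2) mq]
      by (intro Levy_uniqueness) (auto simp: fun_eq_iff)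
    then have "AE x in lborel. ennreal (p x / m) = ennreal (q x / m)"
      unfolding M_def by (subst (asm) sigma_finite_measure.density_unique_iff[OF lborel.sigma_finite_measure_axioms]) auto
    then show ?thesis
    proof eventually_elim
      case (elim x)
      then have "p x / m = q x / m" using pos m by (subst (asm) ennreal_inj) auto
      then show ?case using m by (simp add: diff)
    qed
  qed
qed

text \<open>The recurrence turns orthogonality to all h_n into the vanishing of all moments of u
  h_n. Exchanging the Taylor series of exp(i t x) with the integral shows that u h_0 has zero
  Fourier transform, and h_0 has no zeros.\<close>

lemma hermite_complete_real:
  fixes u :: "real \<Rightarrow> real"
  assumes [measurable]: "u \<in> borel_measurable borel" and u: "integrable lborel (\<lambda>x. (u x)\<^sup>2)"
    and zero: "\<And>n. (LINT x|lborel. u x * hh n x) = 0"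
  shows "AE x in lborel. u x = 0"
proof -
  have amgm: "\<bar>a * b\<bar> \<le> a\<^sup>2 + b\<^sup>2" for a b :: real
  proof -
    have half: "2 * m \<le> s \<Longrightarrow> 0 \<le> m \<Longrightarrow> m \<le> s" for m s :: real by linarith
    have "2 * \<bar>a * b\<bar> \<le> a\<^sup>2 + b\<^sup>2"
      using sum_squares_bound[of "\<bar>a\<bar>" "\<bar>b\<bar>"] by (simp only: abs_mult power2_abs mult.assoc)
    then show ?thesis by (rule half) simp
  qed
  have gp: "gaussian_poly (\<lambda>x. x ^ m * hh n x)" for m n
    using gaussian_poly_poly_mult[OF gaussian_poly_hh[of n], of "monom 1 m"] by (simp add: poly_monom)
  have int: "integrable lborel (\<lambda>x. u x * (x ^ m * hh n x))" for m n
  proof (rule Bochner_Integration.integrable_bound)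
    show "integrable lborel (\<lambda>x. (u x)\<^sup>2 + (x ^ m * hh n x) * (x ^ m * hh n x))"
      by (intro Bochner_Integration.integrable_add u gaussian_poly_integrable gaussian_poly_mult gp)
    show "AE x in lborel. norm (u x * (x ^ m * hh n x)) \<le> norm ((u x)\<^sup>2 + (x ^ m * hh n x) * (x ^ m * hh n x))"
      using amgm by (simp flip: power2_eq_square)
  qed measurable
  have mom: "(LINT x|lborel. u x * (x ^ m * hh n x)) = 0" for m n
  proof (induction m arbitrary: n)
    case 0
    then show ?case using zero by simp
  next
    case (Suc m)
    have e: "u x * (x ^ Suc m * hh n x) = (sqrt (Suc n) / sqrt 2) * (u x * (x ^ m * hh (Suc n) x))
        + (sqrt n / sqrt 2) * (u x * (x ^ m * hh (n - 1) x))" for x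
    proof -
      have "x * hh n x = (sqrt (Suc n) * hh (Suc n) x + sqrt n * hh (n - 1) x) / sqrt 2"
        unfolding hh_rec by simp
      then have "u x * (x ^ m * (x * hh n x)) = u x * (x ^ m * ((sqrt (Suc n) * hh (Suc n) x + sqrt n * hh (n - 1) x) / sqrt 2))"
        by (simp only:)
      then show ?thesis by (simp add: field_simps del: of_nat_Suc)
    qed
    show ?case unfolding e by (simp only: Bochner_Integration.integral_add integrable_mult_right int integral_mult_right_zero Suc)
  qed
  have "(LINT x|lborel. (u x * hh 0 x) *\<^sub>R iexp (t * x)) = 0" for t
  proof (rule LIMSEQ_unique)
    define z where "z = (\<lambda>x. \<i> * complex_of_real (t * x))"
    define s where "s = (\<lambda>N x. \<Sum>k<N. (u x * hh 0 x) *\<^sub>R (z x ^ k /\<^sub>R fact k))"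
    have zk: "(u x * hh 0 x) *\<^sub>R (z x ^ k /\<^sub>R fact k) =
        ((\<i> * of_real t) ^ k /\<^sub>R fact k) * complex_of_real (u x * (x ^ k * hh 0 x))" for x k
      by (simp add: z_def scaleR_conv_of_real power_mult_distrib mult_ac)
    have ik: "integrable lborel (\<lambda>x. (u x * hh 0 x) *\<^sub>R (z x ^ k /\<^sub>R fact k))" for k
      unfolding zk by (intro integrable_mult_right integrable_of_real int)
    have "(LINT x|lborel. s N x) = 0" for N
      unfolding s_def
      by (simp only: Bochner_Integration.integral_sum[OF ik])
        (simp only: zk integral_mult_right_zero integral_complex_of_real mom, simp)
    then show "(\<lambda>N. LINT x|lborel. s N x) \<longlonglongrightarrow> 0" by simp
    show "(\<lambda>N. LINT x|lborel. s N x) \<longlonglongrightarrow> (LINT x|lborel. (u x * hh 0 x) *\<^sub>R iexp (t * x))"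
    proof (rule integral_dominated_convergence)
      show "s N \<in> borel_measurable lborel" for N
        unfolding s_def by (intro borel_measurable_integrable Bochner_Integration.integrable_sum ik)
      show "(\<lambda>x. (u x * hh 0 x) *\<^sub>R iexp (t * x)) \<in> borel_measurable lborel" by measurable
      \<comment> \<open>The majorant comes from |u| h_0 exp |t x| \<le> u^2 + (h_0 exp |t x|)^2 and
        2 |t x| \<le> 2 t^2 + x^2 / 2.\<close>
      show "integrable lborel (\<lambda>x. (u x)\<^sup>2 + exp (2 * t\<^sup>2) * exp (- x\<^sup>2 / 2))"
        using integrable_poly_gaussian[of 1]
        by (intro Bochner_Integration.integrable_add u integrable_mult_right) simp
      show "AE x in lborel. (\<lambda>N. s N x) \<longlonglongrightarrow> (u x * hh 0 x) *\<^sub>R iexp (t * x)"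
      proof (rule AE_I2)
        fix x
        have "(\<lambda>k. (u x * hh 0 x) *\<^sub>R (z x ^ k /\<^sub>R fact k)) sums ((u x * hh 0 x) *\<^sub>R exp (z x))"
          by (intro sums_scaleR_right exp_converges)
        then show "(\<lambda>N. s N x) \<longlonglongrightarrow> (u x * hh 0 x) *\<^sub>R iexp (t * x)"
          unfolding sums_def s_def z_def .
      qed
      show "AE x in lborel. norm (s N x) \<le> (u x)\<^sup>2 + exp (2 * t\<^sup>2) * exp (- x\<^sup>2 / 2)" for N
      proof (rule AE_I2)
        fix x
        have es: "(\<lambda>k. norm (z x) ^ k /\<^sub>R fact k) sums exp (norm (z x))" by (rule exp_converges)
        have "norm (s N x) \<le> (\<Sum>k<N. norm ((u x * hh 0 x) *\<^sub>R (z x ^ k /\<^sub>R fact k)))"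
          unfolding s_def by (rule norm_sum)
        also have "\<dots> = \<bar>u x * hh 0 x\<bar> * (\<Sum>k<N. norm (z x) ^ k /\<^sub>R fact k)"
          unfolding sum_distrib_left by (intro sum.cong refl) (simp add: norm_power abs_mult)
        also have "\<dots> \<le> \<bar>u x * hh 0 x\<bar> * exp (norm (z x))"
          using sum_le_suminf[OF sums_summable[OF es], of "{..<N}"] sums_unique[OF es]
          by (intro mult_left_mono) auto
        also have "\<dots> = \<bar>u x * (hh 0 x * exp \<bar>t * x\<bar>)\<bar>"
          by (simp add: z_def norm_mult abs_mult mult.assoc)
        also have "\<dots> \<le> (u x)\<^sup>2 + (hh 0 x * exp \<bar>t * x\<bar>)\<^sup>2" by (rule amgm)
        also have "(hh 0 x * exp \<bar>t * x\<bar>)\<^sup>2 = exp (- x\<^sup>2 + 2 * \<bar>t * x\<bar>) / sqrt pi"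
          by (simp add: hh_0 power_mult_distrib power_divide exp_double[symmetric] mult_exp_exp)
        also have "\<dots> \<le> exp (- x\<^sup>2 + 2 * \<bar>t * x\<bar>) / 1"
          using pi_gt3 by (intro divide_left_mono) auto
        also have "\<dots> \<le> exp (2 * t\<^sup>2 + - x\<^sup>2 / 2)"
          using sum_squares_bound[of "2 * \<bar>t\<bar>" "\<bar>x\<bar>"]
          by (simp add: abs_mult power_mult_distrib field_simps)
        also have "\<dots> = exp (2 * t\<^sup>2) * exp (- x\<^sup>2 / 2)" by (rule exp_add)
        finally show "norm (s N x) \<le> (u x)\<^sup>2 + exp (2 * t\<^sup>2) * exp (- x\<^sup>2 / 2)" by simp
      qed
    qed
  qed
  then have "AE x in lborel. u x * hh 0 x = 0"
    using int[of 0 0] by (intro fourier_injective_real) simp_all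
  then show ?thesis by eventually_elim (simp add: hh_0)
qed

text \<open>Hermite functions are real, so the real and imaginary parts of f are separately
  orthogonal to them.\<close>

lemma hermite_complete:
  assumes f: "f \<in> L2" and zero: "\<And>n. coef f n = 0"
  shows "AE x in lborel. f x = 0"
proof -
  have [measurable]: "f \<in> borel_measurable borel" using f by (rule L2_measurable)
  have part: "AE x in lborel. h (f x) = 0"
    if h: "bounded_linear h" "\<And>z. (h z)\<^sup>2 \<le> (norm z)\<^sup>2" for h :: "complex \<Rightarrow> real"
  proof (rule hermite_complete_real)
    have [measurable]: "h \<in> borel_measurable borel"
      using h(1) by (intro borel_measurable_continuous_onI linear_continuous_on)
    show "(\<lambda>x. h (f x)) \<in> borel_measurable borel" by measurable
    show "integrable lborel (\<lambda>x. (h (f x))\<^sup>2)"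
      by (rule Bochner_Integration.integrable_bound[OF L2_integrable_sq[OF f]]) (measurable, simp add: h(2))
    fix n
    have e: "h (f x) * hh n x = h (f x * cnj (hermite_fun n x))" for x
      using linear_scale[OF bounded_linear.linear[OF h(1)], of "hh n x" "f x"]
      by (simp add: hermite_fun_hh scaleR_conv_of_real mult.commute)
    have "(LINT x|lborel. h (f x) * hh n x) = h (L2_inner f (hermite_fun n))"
      unfolding e L2_inner_def
      by (rule integral_bounded_linear[OF h(1) L2_inner_integrable[OF f hermite_fun_L2]])
    then show "(LINT x|lborel. h (f x) * hh n x) = 0"
      using zero[of n] linear_0[OF bounded_linear.linear[OF h(1)]] by (simp add: coef_def)
  qed
  have "AE x in lborel. Re (f x) = 0" "AE x in lborel. Im (f x) = 0"
    by (rule part[OF bounded_linear_Re], simp add: cmod_def)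
      (rule part[OF bounded_linear_Im], simp add: cmod_def)
  then show ?thesis by eventually_elim (simp add: complex_eq_iff)
qed

section \<open>Reduction to the resonant system\<close>

lemma norm_cube_diff:
  "norm (cube u x - cube v x) \<le> 2 * ((norm (u x))\<^sup>2 + (norm (v x))\<^sup>2) * norm (u x - v x)"
proof -
  define p q n where "p = norm (u x)" and "q = norm (v x)" and "n = norm (u x - v x)"
  have pqn: "0 \<le> p" "0 \<le> q" "0 \<le> n" "\<bar>p - q\<bar> \<le> n"
    by (simp_all add: p_def q_def n_def norm_triangle_ineq3)
  have half: "2 * m \<le> a + b \<Longrightarrow> 0 \<le> m \<Longrightarrow> a + m + b \<le> 2 * (a + b)" for m a b :: real by argo
  have "cube u x - cube v x = of_real (p\<^sup>2) * (u x - v x) + of_real ((p - q) * (p + q)) * v x"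
    by (simp add: cube_def p_def[symmetric] q_def[symmetric] algebra_simps power2_eq_square)
  then have "norm (cube u x - cube v x) \<le> norm (of_real (p\<^sup>2) * (u x - v x)) + norm (of_real ((p - q) * (p + q)) * v x)"
    by (simp only: norm_triangle_ineq)
  also have "\<dots> = p\<^sup>2 * n + \<bar>p - q\<bar> * (p + q) * q"
    using pqn by (simp only: norm_mult norm_of_real abs_mult n_def[symmetric] q_def[symmetric]) simp
  also have "\<dots> \<le> p\<^sup>2 * n + n * (p + q) * q"
    using pqn by (intro add_left_mono mult_right_mono) auto
  also have "\<dots> = (p\<^sup>2 + p * q + q\<^sup>2) * n" by (simp add: algebra_simps power2_eq_square)
  also have "\<dots> \<le> (2 * (p\<^sup>2 + q\<^sup>2)) * n"
  proof (rule mult_right_mono[OF _ pqn(3)])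
    have "2 * (p * q) \<le> p\<^sup>2 + q\<^sup>2" using sum_squares_bound[of p q] by (simp only: mult.assoc)
    then show "p\<^sup>2 + p * q + q\<^sup>2 \<le> 2 * (p\<^sup>2 + q\<^sup>2)"
      using half[of "p * q" "p\<^sup>2" "q\<^sup>2"] mult_nonneg_nonneg[OF pqn(1,2)] by blast
  qed
  finally show ?thesis by (simp add: p_def q_def n_def)
qed

text \<open>A Lipschitz bound that is linear in the L2 distance. Since h_n is bounded,
  Cauchy-Schwarz asks for |u|^2 + |v|^2 in L2, that is for fourth powers, and 2 p^4 \<le> p^2 + p^6
  reduces these to the L2 and L6 norms that Strichartz controls.\<close>

lemma coef_cube_diff:
  assumes u: "u \<in> L2" "integrable lborel (\<lambda>x. norm (u x) ^ 6)"
    and v: "v \<in> L2" "integrable lborel (\<lambda>x. norm (v x) ^ 6)"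
  shows "norm (coef (cube u) n - coef (cube v) n) \<le> 2 * (real n + 3) * L2_norm (\<lambda>x. u x - v x) *
    (1 + (L2_norm u)\<^sup>2 + (L2_norm v)\<^sup>2 + (LINT x|lborel. norm (u x) ^ 6) + (LINT x|lborel. norm (v x) ^ 6))"
proof -
  have [measurable]: "u \<in> borel_measurable borel" "v \<in> borel_measurable borel"
    using u v by (auto intro: L2_measurable)
  define X where "X = (L2_norm u)\<^sup>2 + (L2_norm v)\<^sup>2 + (LINT x|lborel. norm (u x) ^ 6) + (LINT x|lborel. norm (v x) ^ 6)"
  define P where "P = (\<lambda>x. complex_of_real ((norm (u x))\<^sup>2 + (norm (v x))\<^sup>2))"
  define Q where "Q = (\<lambda>x. u x - v x)"
  define Y where "Y = (\<lambda>x. (norm (u x))\<^sup>2 + (norm (v x))\<^sup>2 + norm (u x) ^ 6 + norm (v x) ^ 6)"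
  have Q: "Q \<in> L2" unfolding Q_def by (intro L2_diff u v)
  have [measurable]: "P \<in> borel_measurable borel" "Q \<in> borel_measurable borel"
    unfolding P_def Q_def by measurable
  have Y: "integrable lborel Y"
    unfolding Y_def by (intro Bochner_Integration.integrable_add u v L2_integrable_sq)
  have YX: "(LINT x|lborel. Y x) = X"
    unfolding Y_def X_def L2_norm_sq using u v by (simp add: L2_integrable_sq)
  have X0: "0 \<le> X" unfolding YX[symmetric] by (intro integral_nonneg_AE) (simp add: Y_def)
  have PY: "(norm (P x))\<^sup>2 \<le> Y x" for x
  proof -
    define p q where "p = norm (u x)" and "q = norm (v x)"
    have a: "2 * p ^ 4 \<le> p\<^sup>2 + p ^ 6" for p :: real
    proof -
      have "0 \<le> p\<^sup>2 * (1 - p\<^sup>2)\<^sup>2" by simp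
      also have "\<dots> = p\<^sup>2 + p ^ 6 - 2 * p ^ 4" by (simp add: algebra_simps power2_eq_square eval_nat_numeral)
      finally show ?thesis by simp
    qed
    have "(p\<^sup>2 + q\<^sup>2)\<^sup>2 \<le> 2 * p ^ 4 + 2 * q ^ 4"
      using sum_squares_bound[of "p\<^sup>2" "q\<^sup>2"] by (simp add: power2_sum)
    also have "\<dots> \<le> p\<^sup>2 + q\<^sup>2 + p ^ 6 + q ^ 6" using a[of p] a[of q] by linarith
    finally have "(p\<^sup>2 + q\<^sup>2)\<^sup>2 \<le> Y x" by (simp add: Y_def p_def q_def)
    moreover have "(norm (P x))\<^sup>2 = (p\<^sup>2 + q\<^sup>2)\<^sup>2"
      unfolding P_def p_def q_def by (simp only: norm_of_real power2_abs)
    ultimately show ?thesis by (simp only:)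
  qed
  have P: "integrable lborel (\<lambda>x. (norm (P x))\<^sup>2)"
  proof (rule Bochner_Integration.integrable_bound[OF Y])
    show "AE x in lborel. norm ((norm (P x))\<^sup>2) \<le> norm (Y x)"
      using order_trans[OF PY abs_ge_self] by simp
  qed measurable
  have sqrtX: "sqrt (LINT x|lborel. (norm (P x))\<^sup>2) \<le> 1 + X"
  proof -
    have "(LINT x|lborel. (norm (P x))\<^sup>2) \<le> X"
      unfolding YX[symmetric] by (intro integral_mono P Y PY)
    also have "X \<le> (1 + X)\<^sup>2" using X0 by (simp add: power2_sum)
    finally show ?thesis using X0 by (intro real_le_lsqrt) auto
  qed
  have PQ: "integrable lborel (\<lambda>x. norm (P x) * norm (Q x))"
    using integrable_norm[OF integral_Cauchy_Schwarz(1)[OF _ _ P L2_integrable_sq[OF Q]]]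
    by (simp add: norm_mult)
  have cu: "cube u \<in> L2" "cube v \<in> L2" using u v by (auto intro: cube_L2 L2_measurable)
  have "coef (cube u) n - coef (cube v) n = L2_inner (\<lambda>x. cube u x - cube v x) (hermite_fun n)"
    unfolding coef_def by (rule L2_inner_diff_left[symmetric]) (intro cu hermite_fun_L2)+
  also have "norm \<dots> \<le> (LINT x|lborel. norm ((cube u x - cube v x) * cnj (hermite_fun n x)))"
    unfolding L2_inner_def by (rule integral_norm_bound)
  also have "\<dots> \<le> (LINT x|lborel. 2 * (real n + 3) * (norm (P x) * norm (Q x)))"
  proof (intro integral_mono integrable_norm L2_inner_integrable L2_diff cu hermite_fun_L2 integrable_mult_right PQ)
    fix x
    have "norm ((cube u x - cube v x) * cnj (hermite_fun n x)) \<le>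
        (2 * ((norm (u x))\<^sup>2 + (norm (v x))\<^sup>2) * norm (u x - v x)) * (real n + 3)"
      unfolding norm_mult using hh_sup_bound[of n x]
      by (intro mult_mono norm_cube_diff) (auto simp: hermite_fun_hh)
    also have "norm (P x) = (norm (u x))\<^sup>2 + (norm (v x))\<^sup>2"
      unfolding P_def norm_of_real by simp
    then have "(2 * ((norm (u x))\<^sup>2 + (norm (v x))\<^sup>2) * norm (u x - v x)) * (real n + 3) =
        2 * (real n + 3) * (norm (P x) * norm (Q x))" by (simp only: Q_def mult_ac)
    finally show "norm ((cube u x - cube v x) * cnj (hermite_fun n x)) \<le> 2 * (real n + 3) * (norm (P x) * norm (Q x))" .
  qed
  also have "\<dots> = 2 * (real n + 3) * (LINT x|lborel. norm (P x) * norm (Q x))" by simp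
  also have "\<dots> \<le> 2 * (real n + 3) * (sqrt (LINT x|lborel. (norm (P x))\<^sup>2) * L2_norm Q)"
    unfolding L2_norm_def
    by (intro mult_left_mono integral_Cauchy_Schwarz(2) P L2_integrable_sq Q) auto
  also have "\<dots> \<le> 2 * (real n + 3) * ((1 + X) * L2_norm Q)"
    by (intro mult_left_mono mult_right_mono sqrtX L2_norm_nonneg) auto
  finally show ?thesis by (simp add: X_def Q_def mult_ac add.assoc)
qed

lemma herm_sum_power6: "integrable lborel (\<lambda>x. norm (herm_sum e N x) ^ 6)"
proof -
  have [measurable]: "herm_sum e N \<in> borel_measurable borel" using herm_sum_L2 by (rule L2_measurable)
  define M where "M = (\<Sum>n<N. norm (e n) * (real n + 3))"
  have M: "norm (herm_sum e N x) \<le> M" for x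
    unfolding herm_sum_def M_def
    by (intro sum_norm_le) (auto simp: norm_mult hermite_fun_hh intro!: mult_left_mono hh_sup_bound)
  show ?thesis
  proof (rule Bochner_Integration.integrable_bound)
    show "integrable lborel (\<lambda>x. M ^ 4 * (norm (herm_sum e N x))\<^sup>2)"
      by (intro integrable_mult_right L2_integrable_sq herm_sum_L2)
    show "AE x in lborel. norm (norm (herm_sum e N x) ^ 6) \<le> norm (M ^ 4 * (norm (herm_sum e N x))\<^sup>2)"
    proof (rule AE_I2)
      fix x
      have "norm (herm_sum e N x) ^ 6 = norm (herm_sum e N x) ^ 4 * (norm (herm_sum e N x))\<^sup>2"
        by (simp flip: power_add)
      also have "\<dots> \<le> M ^ 4 * (norm (herm_sum e N x))\<^sup>2"
        by (intro mult_right_mono power_mono M) auto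
      finally show "norm (norm (herm_sum e N x) ^ 6) \<le> norm (M ^ 4 * (norm (herm_sum e N x))\<^sup>2)" by simp
    qed
  qed measurable
qed

lemma coef_cube_herm_sum:
  "coef (cube (herm_sum e N)) n =
    (\<Sum>l<N. \<Sum>a<N. \<Sum>b<N. (e a * e b * cnj (e l)) * of_real (quartic a b l n))"
proof -
  have int: "integrable lborel (\<lambda>x. complex_of_real (hh a x * hh b x * (hh l x * hh n x)))" for a b l
    by (intro integrable_of_real integrable_hh4)
  have eq: "cube (herm_sum e N) x * cnj (hermite_fun n x) = (\<Sum>l<N. \<Sum>a<N. \<Sum>b<N.
      (e a * e b * cnj (e l)) * complex_of_real (hh a x * hh b x * (hh l x * hh n x)))" for x
  proof -
    have "cube (herm_sum e N) x = cnj (herm_sum e N x) * (herm_sum e N x * herm_sum e N x)"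
      unfolding cube_def complex_norm_square by (simp add: mult_ac)
    also have "\<dots> = (\<Sum>l<N. \<Sum>a<N. \<Sum>b<N. (cnj (e l) * hh l x) * ((e a * hh a x) * (e b * hh b x)))"
      unfolding herm_sum_def hermite_fun_hh cnj_sum sum_product
      by (simp add: sum_distrib_left)
    finally show ?thesis by (simp only: sum_distrib_right) (simp add: hermite_fun_hh mult_ac)
  qed
  show ?thesis
    unfolding coef_def L2_inner_def eq
    by (simp only: Bochner_Integration.integral_sum Bochner_Integration.integrable_sum integrable_mult_right int
        integral_mult_right_zero integral_complex_of_real quartic_def)
qed

lemma sum_diagonal:
  fixes F :: "nat \<Rightarrow> nat \<Rightarrow> 'a::comm_monoid_add"
  shows "(\<Sum>a<N. \<Sum>b<N. if a + b = m then F a b else 0) =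
    (\<Sum>a\<le>m. if a < N \<and> m - a < N then F a (m - a) else 0)"
proof -
  have "(\<Sum>b<N. if a + b = m then F a b else 0) = (if a \<le> m \<and> m - a < N then F a (m - a) else 0)" for a
  proof -
    have "(\<Sum>b<N. if a + b = m then F a b else 0) =
        (\<Sum>b<N. if m - a = b then if a \<le> m then F a b else 0 else 0)"
      by (intro sum.cong refl) auto
    then show ?thesis by (simp add: sum.delta)
  qed
  then have "(\<Sum>a<N. \<Sum>b<N. if a + b = m then F a b else 0) =
      (\<Sum>a<N. if a \<le> m \<and> m - a < N then F a (m - a) else 0)" by simp
  also have "\<dots> = (\<Sum>a\<le>m. if a < N \<and> m - a < N then F a (m - a) else 0)"
    by (rule sum.mono_neutral_cong) auto
  finally show ?thesis .
qed

text \<open>The interaction of a, b and the conjugated l into n oscillates with frequency 2 (a + b -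
  l - n). What survives is the resonant sum, multiplied by pi / 2, the length of the window; the
  bound N on all indices becomes the zero extension \<open>tr\<close>.\<close>

lemma resonant_time_average:
  fixes c :: "nat \<Rightarrow> complex" and N n :: nat
  defines "tr \<equiv> (\<lambda>n. if n < N then c n else 0)"
    and "g \<equiv> (\<lambda>s. indicator {- pi / 4..pi / 4} s *\<^sub>R
      (exp (- \<i> * of_real s * of_nat (2 * n + 1)) * coef (cube (herm_sum (phase s c) N)) n))"
  shows "integrable lborel g" and "(LINT s|lborel. g s) = of_real (pi / 2) * cubic N tr tr tr n"
proof -
  define k where "k = (\<lambda>l a b. int a + int b - int l - int n)"
  define E where "E = (\<lambda>l a b s. indicator {- (pi / 4)..pi / 4} s *\<^sub>R exp (\<i> * of_real (2 * of_int (k l a b) * s)))"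
  define q where "q = (\<lambda>l a b. c a * c b * cnj (c l) * of_real (quartic a b l n))"
  have E: "integrable lborel (E l a b)" for l a b
    unfolding E_def by (rule integral_exp_period(1)) simp
  have ph: "exp (- \<i> * of_real s * of_nat (2 * n + 1)) * (phase s c a * phase s c b * cnj (phase s c l)) =
      exp (\<i> * of_real (2 * of_int (k l a b) * s)) * (c a * c b * cnj (c l))" for s a b l
  proof -
    have "exp (- \<i> * of_real s * of_nat (2 * n + 1)) * (exp (\<i> * of_real s * of_nat (2 * a + 1)) *
        exp (\<i> * of_real s * of_nat (2 * b + 1)) * cnj (exp (\<i> * of_real s * of_nat (2 * l + 1)))) =
        exp (\<i> * of_real (2 * of_int (k l a b) * s))"
      unfolding exp_cnj mult_exp_exp
      by (rule arg_cong[of _ _ exp]) (simp add: k_def algebra_simps)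
    then show ?thesis unfolding phase_def complex_cnj_mult by (simp only: mult_ac)
  qed
  have g: "g = (\<lambda>s. \<Sum>l<N. \<Sum>a<N. \<Sum>b<N. q l a b * E l a b s)"
  proof
    fix s
    have "exp (- \<i> * of_real s * of_nat (2 * n + 1)) * coef (cube (herm_sum (phase s c) N)) n =
      (\<Sum>l<N. \<Sum>a<N. \<Sum>b<N. (exp (- \<i> * of_real s * of_nat (2 * n + 1)) *
        (phase s c a * phase s c b * cnj (phase s c l))) * of_real (quartic a b l n))"
      unfolding coef_cube_herm_sum sum_distrib_left by (simp only: mult.assoc)
    also have "\<dots> = (\<Sum>l<N. \<Sum>a<N. \<Sum>b<N. q l a b * exp (\<i> * of_real (2 * of_int (k l a b) * s)))"
      unfolding ph q_def by (simp only: mult_ac)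
    finally show "g s = (\<Sum>l<N. \<Sum>a<N. \<Sum>b<N. q l a b * E l a b s)"
      unfolding g_def E_def by (simp add: scaleR_sum_right)
  qed
  show "integrable lborel g"
    unfolding g by (intro Bochner_Integration.integrable_sum integrable_mult_right E)
  have qE: "q l a b * (LINT s|lborel. E l a b s) = (if a + b = n + l then of_real (pi / 2) * q l a b else 0)" for l a b
  \<comment> \<open>Over half a period only even k integrates as required; for odd k the integral in
    time need not vanish, but the quartic coefficient does by parity.\<close>
  proof (cases "even (k l a b)")
    case True
    then obtain j where j: "k l a b = 2 * j" by (auto elim: evenE)
    have "sin (2 * of_int (k l a b) * (pi / 4)) = 0"
      unfolding j sin_zero_iff_int2 by (intro exI[of _ j]) simp
    from integral_exp_period(2)[OF _ this]
    have "(LINT s|lborel. E l a b s) = (if k l a b = 0 then of_real (2 * (pi / 4)) else 0)"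
      unfolding E_def by simp
    moreover have "k l a b = 0 \<longleftrightarrow> a + b = n + l" unfolding k_def by linarith
    ultimately show ?thesis by (simp add: mult.commute)
  next
    case False
    then have "odd (a + b + l + n)" unfolding k_def by simp
    then have "quartic a b l n = 0" unfolding quartic_def by (rule hh_quartic_parity)
    then show ?thesis by (simp add: q_def)
  qed
  have "(LINT s|lborel. g s) = (\<Sum>l<N. \<Sum>a<N. \<Sum>b<N. q l a b * (LINT s|lborel. E l a b s))"
    unfolding g by (simp only: Bochner_Integration.integral_sum Bochner_Integration.integrable_sum
        integrable_mult_right E integral_mult_right_zero)
  also have "\<dots> = (\<Sum>l<N. \<Sum>a\<le>n + l. if a < N \<and> n + l - a < N then of_real (pi / 2) * q l a (n + l - a) else 0)"
    unfolding qE sum_diagonal ..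
  also have "\<dots> = of_real (pi / 2) * cubic N tr tr tr n"
    unfolding cubic_def sum_distrib_left by (intro sum.cong refl) (simp add: tr_def q_def)
  finally show "(LINT s|lborel. g s) = of_real (pi / 2) * cubic N tr tr tr n" .
qed

text \<open>Passage from partial sums to V. By \<open>coef_cube_diff\<close> the integrands differ
  by at most the square root of the tail times a function whose integral is bounded uniformly in N,
  thanks to the Strichartz estimate for partial sums.\<close>

lemma resonant_limit:
  fixes n :: nat
  assumes f: "f \<in> L2" and \<kappa>: "strict_mono \<kappa>"
    and V[measurable]: "(\<lambda>(s, x). V s x) \<in> borel_measurable (borel \<Otimes>\<^sub>M borel)"
    and VL: "\<And>s. V s \<in> L2" and VP: "\<And>s. AE x in lborel. propagator s f x = V s x"
    and Vt: "\<And>s N. (L2_norm (\<lambda>x. V s x - herm_sum (phase s (coef f)) N x))\<^sup>2 \<le> tail (coef f) N"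
    and V6: "AE s in lborel. s \<in> {- pi / 4..pi / 4} \<longrightarrow> integrable lborel (\<lambda>x. norm (V s x) ^ 6)"
    and VI: "integrable lborel (\<lambda>s. indicator {- pi / 4..pi / 4} s * (LINT x|lborel. norm (V s x) ^ 6))"
  defines "tr \<equiv> (\<lambda>M n. if n < M then coef f n else 0)"
  shows "(\<lambda>j. of_real (pi / 2) * cubic (\<kappa> j) (tr (\<kappa> j)) (tr (\<kappa> j)) (tr (\<kappa> j)) n) \<longlonglongrightarrow>
    (LINT s|lborel. indicator {- pi / 4..pi / 4} s *\<^sub>R
      (exp (- \<i> * of_real s * of_nat (2 * n + 1)) * coef (cube (V s)) n))"
proof -
  define A where "A = {- pi / 4..pi / 4}"
  have [measurable]: "A \<in> sets borel" by (simp add: A_def)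
  define C where "C = L2_norm f"
  have c: "ell2 C (coef f)" unfolding C_def by (rule Bessel[OF f])
  define e where "e = (\<lambda>s :: real. exp (- \<i> * of_real s * of_nat (2 * n + 1)))"
  have ne: "norm (e s) = 1" for s
    using norm_exp_i_times[of "- s * real (2 * n + 1)"] by (simp add: e_def mult.assoc)
  have [measurable]: "e \<in> borel_measurable borel"
    unfolding e_def by (intro borel_measurable_continuous_onI continuous_intros)
  define G where "G = (\<lambda>s. indicator A s *\<^sub>R (e s * coef (cube (V s)) n))"
  define H where "H = (\<lambda>N s. indicator A s *\<^sub>R (e s * coef (cube (herm_sum (phase s (coef f)) N)) n))"
  define iV where "iV = (\<lambda>s. indicator A s * (LINT x|lborel. norm (V s x) ^ 6))"
  define iS where "iS = (\<lambda>N s. indicator A s * (LINT x|lborel. norm (herm_sum (phase s (coef f)) N x) ^ 6))"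
  have H: "integrable lborel (H N)" "(LINT s|lborel. H N s) = of_real (pi / 2) * cubic N (tr N) (tr N) (tr N) n" for N
    using resonant_time_average[of n "coef f" N] unfolding H_def A_def e_def tr_def by blast+
  have iV: "integrable lborel iV" using VI unfolding iV_def A_def .
  have iA: "integrable lborel (indicator A :: real \<Rightarrow> real)" by (simp add: A_def)
  have GH: "AE s in lborel. norm (G s - H N s) \<le>
      2 * (real n + 3) * sqrt (tail (coef f) N) * ((1 + 2 * C\<^sup>2) * indicator A s + iV s + iS N s)" for N
    using V6
  proof eventually_elim
    case (elim s)
    define S where "S = herm_sum (phase s (coef f)) N"
    show ?case
    proof (cases "s \<in> A")
      case True
      then have V6: "integrable lborel (\<lambda>x. norm (V s x) ^ 6)" using elim by (simp add: A_def)
      have t: "L2_norm (\<lambda>x. V s x - S x) \<le> sqrt (tail (coef f) N)"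
        unfolding S_def by (rule real_le_rsqrt[OF Vt])
      have "L2_norm (V s) = L2_norm (propagator s f)"
        using VP[of s] by (intro L2_norm_cong_AE[symmetric] propagator_L2(1) f VL)
      then have "L2_norm (V s) \<le> C" using propagator_norm_le[OF f] by (simp add: C_def)
      then have nV: "(L2_norm (V s))\<^sup>2 \<le> C\<^sup>2" by (intro power_mono L2_norm_nonneg)
      have nS: "(L2_norm S)\<^sup>2 \<le> C\<^sup>2"
        using c unfolding S_def herm_sum_norm norm_phase ell2_def by blast
      have "norm (G s - H N s) = norm (e s * (coef (cube (V s)) n - coef (cube S) n))"
        using True by (simp add: G_def H_def S_def right_diff_distrib)
      also have "\<dots> = norm (coef (cube (V s)) n - coef (cube S) n)" by (simp add: norm_mult ne)
      also have "\<dots> \<le> 2 * (real n + 3) * L2_norm (\<lambda>x. V s x - S x) *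
          (1 + (L2_norm (V s))\<^sup>2 + (L2_norm S)\<^sup>2 + (LINT x|lborel. norm (V s x) ^ 6) + (LINT x|lborel. norm (S x) ^ 6))"
        unfolding S_def by (intro coef_cube_diff VL V6 herm_sum_L2 herm_sum_power6)
      also have "\<dots> \<le> 2 * (real n + 3) * sqrt (tail (coef f) N) *
          ((1 + 2 * C\<^sup>2) + (LINT x|lborel. norm (V s x) ^ 6) + (LINT x|lborel. norm (S x) ^ 6))"
      proof (intro mult_mono mult_left_mono t)
        show "1 + (L2_norm (V s))\<^sup>2 + (L2_norm S)\<^sup>2 + (LINT x|lborel. norm (V s x) ^ 6) + (LINT x|lborel. norm (S x) ^ 6)
            \<le> (1 + 2 * C\<^sup>2) + (LINT x|lborel. norm (V s x) ^ 6) + (LINT x|lborel. norm (S x) ^ 6)"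
          using nV nS by linarith
      qed (auto intro!: mult_nonneg_nonneg add_nonneg_nonneg integral_nonneg_AE tail_nonneg[OF c] L2_norm_nonneg)
      finally show ?thesis using True by (simp add: iV_def iS_def S_def)
    qed (simp add: G_def H_def iV_def iS_def)
  qed
  have iS: "integrable lborel (iS N) \<and> (LINT s|lborel. iS N s) \<le> pi * C ^ 6" for N
  proof -
    have [measurable]: "iS N \<in> borel_measurable borel"
      unfolding iS_def by measurable
    have iS0: "0 \<le> iS N s" for s
      unfolding iS_def by (intro mult_nonneg_nonneg integral_nonneg_AE) auto
    have "(\<integral>\<^sup>+s. ennreal (iS N s) \<partial>lborel) \<le>
      (\<integral>\<^sup>+s. \<integral>\<^sup>+x. ennreal (indicator {- pi / 2..pi / 2} s * norm (herm_sum (phase s (coef f)) N x) ^ 6) \<partial>lborel \<partial>lborel)"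
    proof (rule nn_integral_mono)
      fix s
      have "ennreal (iS N s) \<le> ennreal (LINT x|lborel. indicator {- pi / 2..pi / 2} s * norm (herm_sum (phase s (coef f)) N x) ^ 6)"
        unfolding iS_def integral_mult_right_zero
        by (intro ennreal_leI mult_right_mono integral_nonneg_AE) (auto simp: A_def indicator_def)
      also have "\<dots> = (\<integral>\<^sup>+x. ennreal (indicator {- pi / 2..pi / 2} s * norm (herm_sum (phase s (coef f)) N x) ^ 6) \<partial>lborel)"
        by (intro nn_integral_eq_integral[symmetric] integrable_mult_right herm_sum_power6) auto
      finally show "ennreal (iS N s) \<le> \<dots>" .
    qed
    also have "\<dots> \<le> ennreal (pi * C ^ 6)" by (rule Strichartz_finite[OF c])
    finally have le: "(\<integral>\<^sup>+s. ennreal (iS N s) \<partial>lborel) \<le> ennreal (pi * C ^ 6)" .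
    have int: "integrable lborel (iS N)"
      by (rule integrableI_bounded) (use le iS0 in \<open>auto intro: le_less_trans\<close>)
    have "ennreal (LINT s|lborel. iS N s) \<le> ennreal (pi * C ^ 6)"
      using le iS0 by (subst nn_integral_eq_integral[OF int, symmetric]) auto
    moreover have "0 \<le> pi * C ^ 6" using c by (simp add: ell2_def)
    ultimately show ?thesis using int by simp
  qed
  have dom: "integrable lborel (\<lambda>s. 2 * (real n + 3) * sqrt (tail (coef f) N) * ((1 + 2 * C\<^sup>2) * indicator A s + iV s + iS N s))" for N
    using iS by (intro integrable_mult_right Bochner_Integration.integrable_add iA iV) blast
  have G_meas[measurable]: "G \<in> borel_measurable borel"
    unfolding G_def coef_def L2_inner_def cube_def hermite_fun_hh complex_cnj_complex_of_real by measurable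
  have GHi: "integrable lborel (\<lambda>s. G s - H N s)" for N
  proof (rule Bochner_Integration.integrable_bound[OF dom])
    have [measurable]: "H N \<in> borel_measurable borel" using H(1)[of N] by auto
    show "(\<lambda>s. G s - H N s) \<in> borel_measurable lborel" by measurable
    show "AE s in lborel. norm (G s - H N s) \<le> norm (2 * (real n + 3) * sqrt (tail (coef f) N) * ((1 + 2 * C\<^sup>2) * indicator A s + iV s + iS N s))"
      using GH[of N] by eventually_elim simp
  qed
  have G: "integrable lborel G"
    using Bochner_Integration.integrable_add[OF GHi[of 0] H(1)[of 0]] by simp
  define K where "K = 2 * (real n + 3) * ((1 + 2 * C\<^sup>2) * (LINT s|lborel. indicator A s) + (LINT s|lborel. iV s) + pi * C ^ 6)"
  have bound: "norm ((LINT s|lborel. G s) - (LINT s|lborel. H N s)) \<le> K * sqrt (tail (coef f) N)" for N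
  proof -
    have "norm ((LINT s|lborel. G s) - (LINT s|lborel. H N s)) = norm (LINT s|lborel. G s - H N s)"
      using G H(1) by simp
    also have "\<dots> \<le> (LINT s|lborel. norm (G s - H N s))" by (rule integral_norm_bound)
    also have "\<dots> \<le> (LINT s|lborel. 2 * (real n + 3) * sqrt (tail (coef f) N) * ((1 + 2 * C\<^sup>2) * indicator A s + iV s + iS N s))"
      using GH by (intro integral_mono_AE integrable_norm GHi dom)
    also have "\<dots> = 2 * (real n + 3) * sqrt (tail (coef f) N) *
        ((1 + 2 * C\<^sup>2) * (LINT s|lborel. indicator A s) + (LINT s|lborel. iV s) + (LINT s|lborel. iS N s))"
      using iS[of N] by (simp only: integral_mult_right_zero Bochner_Integration.integral_add
          Bochner_Integration.integrable_add integrable_mult_right iA iV)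
    also have "\<dots> \<le> 2 * (real n + 3) * sqrt (tail (coef f) N) *
        ((1 + 2 * C\<^sup>2) * (LINT s|lborel. indicator A s) + (LINT s|lborel. iV s) + pi * C ^ 6)"
      using iS[of N] tail_nonneg[OF c] by (intro mult_left_mono add_left_mono) auto
    finally show ?thesis by (simp only: K_def mult_ac)
  qed
  have "(\<lambda>j. (LINT s|lborel. G s) - (LINT s|lborel. H (\<kappa> j) s)) \<longlonglongrightarrow> 0"
  proof (rule Lim_null_comparison)
    show "\<forall>\<^sub>F j in sequentially. norm ((LINT s|lborel. G s) - (LINT s|lborel. H (\<kappa> j) s)) \<le> K * sqrt (tail (coef f) (\<kappa> j))"
      by (intro always_eventually allI bound)
    have "(\<lambda>j. tail (coef f) (\<kappa> j)) \<longlonglongrightarrow> 0"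
      using LIMSEQ_subseq_LIMSEQ[OF tail_tendsto[OF c] \<kappa>] by (simp add: o_def)
    from tendsto_mult_left[OF tendsto_real_sqrt[OF this], of K]
    show "(\<lambda>j. K * sqrt (tail (coef f) (\<kappa> j))) \<longlonglongrightarrow> 0" by simp
  qed
  from tendsto_diff[OF tendsto_const[of "LINT s|lborel. G s"] this]
  have "(\<lambda>j. LINT s|lborel. H (\<kappa> j) s) \<longlonglongrightarrow> (LINT s|lborel. G s)" by simp
  then show ?thesis unfolding H(2) G_def A_def e_def .
qed

section \<open>Stationary waves\<close>

lemma coef_L2_limit:
  assumes "w \<in> L2" "(\<lambda>N. L2_norm (\<lambda>x. w x - herm_sum d N x)) \<longlonglongrightarrow> 0"
  shows "coef w n = d n"
proof (rule LIMSEQ_unique)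
  show "(\<lambda>N. \<Sum>m<N. d m * cnj (coef (hermite_fun n) m)) \<longlonglongrightarrow> coef w n"
    using L2_inner_tendsto[OF assms(1) hermite_fun_L2 herm_sum_L2 assms(2), of n]
    by (simp add: coef_def[of w] L2_inner_herm_sum[OF hermite_fun_L2])
  have "(\<Sum>m<N. d m * cnj (coef (hermite_fun n) m)) = d n" if "n < N" for N
    using that by (simp add: coef_hermite if_distrib[of cnj] if_distrib[of "\<lambda>x. _ * x"] cong: if_cong)
  then have "\<forall>\<^sub>F N in sequentially. d n = (\<Sum>m<N. d m * cnj (coef (hermite_fun n) m))"
    by (intro eventually_mono[OF eventually_gt_at_top[of n]]) simp
  then show "(\<lambda>N. \<Sum>m<N. d m * cnj (coef (hermite_fun n) m)) \<longlonglongrightarrow> d n"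
    by (rule Lim_transform_eventually[OF tendsto_const])
qed

text \<open>The L2 sum of the series has the same coefficients as f, so completeness identifies the
  two. Its values agree with the pointwise sum because partial sums along a subsequence converge
  almost everywhere to both.\<close>

lemma hermite_series_AE:
  assumes f: "f \<in> L2" and sum: "\<And>x. summable (\<lambda>n. coef f n * complex_of_real (hh n x))"
  shows "AE x in lborel. f x = (\<Sum>n. coef f n * of_real (hh n x))"
proof -
  have c: "ell2 (L2_norm f) (coef f)" by (rule Bessel[OF f])
  show ?thesis
  proof (rule Riesz_Fischer_Hermite[OF c])
    fix \<kappa> :: "nat \<Rightarrow> nat"
    define g where "g = (\<lambda>x. lim (\<lambda>k. herm_sum (coef f) (\<kappa> k) x))"
    assume \<kappa>: "strict_mono \<kappa>"
      and AE: "\<And>e. (\<And>n. norm (e n) \<le> norm (coef f n)) \<Longrightarrow>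
        AE x in lborel. (\<lambda>k. herm_sum e (\<kappa> k) x) \<longlonglongrightarrow> lim (\<lambda>k. herm_sum e (\<kappa> k) x)"
      and L2: "\<And>e. (\<And>n. norm (e n) \<le> norm (coef f n)) \<Longrightarrow> (\<lambda>x. lim (\<lambda>k. herm_sum e (\<kappa> k) x)) \<in> L2"
      and t: "\<And>e N. (\<And>n. norm (e n) \<le> norm (coef f n)) \<Longrightarrow>
        (L2_norm (\<lambda>x. lim (\<lambda>k. herm_sum e (\<kappa> k) x) - herm_sum e N x))\<^sup>2 \<le> tail (coef f) N"
    have g: "g \<in> L2" unfolding g_def by (rule L2) simp
    have gt: "(\<lambda>N. L2_norm (\<lambda>x. g x - herm_sum (coef f) N x)) \<longlonglongrightarrow> 0"
      by (rule tail_norm_tendsto[OF c]) (unfold g_def, rule t, simp)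
    have "coef (\<lambda>x. f x - g x) n = 0" for n
      using coef_L2_limit[OF g gt, of n]
      unfolding coef_def by (simp add: L2_inner_diff_left[OF f g hermite_fun_L2])
    then have fg: "AE x in lborel. f x - g x = 0"
      by (intro hermite_complete L2_diff f g)
    have lim: "AE x in lborel. (\<lambda>k. herm_sum (coef f) (\<kappa> k) x) \<longlonglongrightarrow> g x"
      unfolding g_def by (rule AE) simp
    show ?thesis
      using fg lim
    proof eventually_elim
      case (elim x)
      have "(\<lambda>N. herm_sum (coef f) N x) \<longlonglongrightarrow> (\<Sum>n. coef f n * of_real (hh n x))"
        using summable_LIMSEQ[OF sum[of x]] by (simp add: herm_sum_def hermite_fun_hh)
      from LIMSEQ_subseq_LIMSEQ[OF this \<kappa>]
      have "(\<lambda>k. herm_sum (coef f) (\<kappa> k) x) \<longlonglongrightarrow> (\<Sum>n. coef f n * of_real (hh n x))"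
        by (simp add: o_def)
      from LIMSEQ_unique[OF elim(2) this] elim(1) show ?case by simp
    qed
  qed
qed

text \<open>The transform multiplies the coefficients by (-i)^n and keeps their moduli, so one
  exponent serves as \<alpha> and \<beta>. The integral defining the transform does not see the
  change of f on a null set.\<close>

lemma gaussian_decay_of_geometric_coef:
  assumes f: "f \<in> L2" and r: "0 < r" "r < 1" and c: "\<And>n. norm (coef f n) \<le> A * r ^ n"
  shows "(\<exists>\<alpha>>0. \<exists>\<beta>>0. (\<lambda>x. f x * of_real (exp (\<alpha> * x\<^sup>2))) \<in> Linf \<and>
            (\<lambda>\<xi>. fourier_transform f \<xi> * of_real (exp (\<beta> * \<xi>\<^sup>2))) \<in> Linf) \<and>
         (\<exists>\<Phi>. \<Phi> holomorphic_on UNIV \<and> (AE x in lborel. \<Phi> (of_real x) = f x))"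
proof -
  have [measurable]: "f \<in> borel_measurable borel" using f by (rule L2_measurable)
  define \<psi> where "\<psi> = (\<lambda>x. \<Sum>n. coef f n * complex_of_real (hh n x))"
  define \<eta> where "\<eta> = (\<lambda>x. \<Sum>n. (coef f n * (- \<i>) ^ n) * complex_of_real (hh n x))"
  have [measurable]: "\<psi> \<in> borel_measurable borel" "\<eta> \<in> borel_measurable borel"
    unfolding \<psi>_def \<eta>_def by measurable
  obtain \<alpha> B where \<alpha>: "0 < \<alpha>" and B': "\<forall>(d :: nat \<Rightarrow> complex) x. (\<forall>n. norm (d n) \<le> A * r ^ n) \<longrightarrow>
      summable (\<lambda>n. norm (d n * of_real (hh n x))) \<and> norm (\<Sum>n. d n * of_real (hh n x)) * exp (\<alpha> * x\<^sup>2) \<le> B"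
    using geometric_hermite_series(1)[OF r c] by (elim exE conjE)
  have B: "summable (\<lambda>n. norm (d n * of_real (hh n x)))" "norm (\<Sum>n. d n * of_real (hh n x)) * exp (\<alpha> * x\<^sup>2) \<le> B"
    if "\<And>n. norm (d n) \<le> A * r ^ n" for d :: "nat \<Rightarrow> complex" and x
    using B'[rule_format, of d x, OF that] by simp_all
  have f\<psi>: "AE x in lborel. f x = \<psi> x"
    unfolding \<psi>_def by (rule hermite_series_AE[OF f summable_norm_cancel[OF B(1)[OF c]]])
  have "fourier_transform f \<xi> = fourier_transform \<psi> \<xi>" for \<xi>
    unfolding fourier_transform_def
  proof (rule arg_cong[of _ _ "\<lambda>z. of_real (1 / sqrt (2 * pi)) * z"], rule integral_cong_AE[rotated 2])
    show "AE x in lborel. exp (- \<i> * of_real (x * \<xi>)) * f x = exp (- \<i> * of_real (x * \<xi>)) * \<psi> x"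
      using f\<psi> by eventually_elim simp
  qed measurable
  then have F: "fourier_transform f = \<eta>"
    unfolding \<psi>_def \<eta>_def fourier_hermite_series[OF r c] by (simp add: fun_eq_iff)
  have "norm (coef f n * (- \<i>) ^ n) \<le> A * r ^ n" for n
    using c[of n] by (simp add: norm_mult norm_power)
  from B(2)[OF this] have \<eta>B: "norm (\<eta> x * of_real (exp (\<alpha> * x\<^sup>2))) \<le> B" for x
    by (simp only: \<eta>_def norm_mult norm_of_real abs_exp_cancel)
  have \<psi>B: "norm (\<psi> x * of_real (exp (\<alpha> * x\<^sup>2))) \<le> B" for x
    using B(2)[OF c] by (simp only: \<psi>_def norm_mult norm_of_real abs_exp_cancel)
  have "AE x in lborel. norm (f x * of_real (exp (\<alpha> * x\<^sup>2))) \<le> B"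
    using f\<psi> by eventually_elim (simp only: \<psi>B)
  moreover have "(\<lambda>x. f x * of_real (exp (\<alpha> * x\<^sup>2))) \<in> borel_measurable lborel" by measurable
  ultimately have 1: "(\<lambda>x. f x * of_real (exp (\<alpha> * x\<^sup>2))) \<in> Linf" unfolding Linf_def by blast
  have "AE x in lborel. norm (\<eta> x * of_real (exp (\<alpha> * x\<^sup>2))) \<le> B" using \<eta>B by (intro AE_I2)
  moreover have "(\<lambda>x. \<eta> x * of_real (exp (\<alpha> * x\<^sup>2))) \<in> borel_measurable lborel" by measurable
  ultimately have 2: "(\<lambda>x. fourier_transform f x * of_real (exp (\<alpha> * x\<^sup>2))) \<in> Linf"
    unfolding Linf_def F by blast
  obtain \<Phi> where \<Phi>: "\<Phi> holomorphic_on UNIV" "\<And>x. \<Phi> (of_real x) = \<psi> x"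
    using geometric_hermite_series(2)[OF r c] unfolding \<psi>_def by blast
  have 3: "AE x in lborel. \<Phi> (of_real x) = f x"
    using f\<psi> by eventually_elim (simp add: \<Phi>(2))
  show ?thesis using \<alpha> 1 2 \<Phi>(1) 3 by blast
qed

text \<open>The pairing of the cube with V is the integral of |V|^4, nonnegative at each time. A
  vanishing time integral over a window of positive length leaves at least one time at which V is
  zero; one time is enough, since the propagator preserves the moduli of the coefficients.\<close>

lemma quartic_mass_zero:
  assumes V[measurable]: "(\<lambda>(s, x). V s x) \<in> borel_measurable (borel \<Otimes>\<^sub>M borel)"
    and VL: "\<And>s. V s \<in> L2"
    and V6: "AE s in lborel. s \<in> {- pi / 4..pi / 4} \<longrightarrow> integrable lborel (\<lambda>x. norm (V s x) ^ 6)"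
    and int: "integrable lborel (\<lambda>s. indicator {- pi / 4..pi / 4} s *\<^sub>R L2_inner (cube (V s)) (V s))"
    and zero: "(LINT s|lborel. indicator {- pi / 4..pi / 4} s *\<^sub>R L2_inner (cube (V s)) (V s)) = 0"
  shows "\<exists>s. AE x in lborel. V s x = 0"
proof -
  define A where "A = {- pi / 4..pi / 4}"
  define Q where "Q = (\<lambda>s. indicator A s * (LINT x|lborel. norm (V s x) ^ 4))"
  have Q: "indicator A s *\<^sub>R L2_inner (cube (V s)) (V s) = complex_of_real (Q s)" for s
  proof -
    have "cube (V s) x * cnj (V s x) = complex_of_real (norm (V s x) ^ 4)" for x
    proof -
      have "cube (V s) x * cnj (V s x) = of_real ((norm (V s x))\<^sup>2) * (V s x * cnj (V s x))"
        by (simp only: cube_def mult.assoc)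
      also have "\<dots> = of_real ((norm (V s x))\<^sup>2 * (norm (V s x))\<^sup>2)"
        by (simp only: complex_norm_square[symmetric] of_real_mult)
      finally show ?thesis by (simp only: power_add[symmetric]) simp
    qed
    then have "L2_inner (cube (V s)) (V s) = of_real (LINT x|lborel. norm (V s x) ^ 4)"
      unfolding L2_inner_def by (simp only: integral_complex_of_real)
    then show ?thesis by (simp only: Q_def scaleR_conv_of_real of_real_mult)
  qed
  have Q0: "0 \<le> Q s" for s unfolding Q_def by (intro mult_nonneg_nonneg integral_nonneg_AE) auto
  have "integrable lborel Q" "(LINT s|lborel. Q s) = 0"
    using int zero unfolding A_def[symmetric] Q complex_of_real_integrable_eq
    by (simp_all only: integral_complex_of_real of_real_eq_0_iff)
  then have "AE s in lborel. Q s = 0" using integral_nonneg_eq_0_iff_AE[of lborel Q] Q0 by simp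
  \<comment> \<open>The time s must also have a finite sixth moment: otherwise the integral of |V|^4
    could be 0 merely as the default value for a function that is not integrable.\<close>
  then have AE: "AE s in lborel. Q s = 0 \<and> (s \<in> A \<longrightarrow> integrable lborel (\<lambda>x. norm (V s x) ^ 6))"
    using V6 unfolding A_def by eventually_elim blast
  have "\<exists>s\<in>A. Q s = 0 \<and> integrable lborel (\<lambda>x. norm (V s x) ^ 6)"
  proof (rule ccontr)
    assume none: "\<not> ?thesis"
    have "AE s in lborel. s \<notin> A" using AE by eventually_elim (use none in blast)
    then have "A \<in> null_sets lborel" by (subst AE_iff_null_sets) (auto simp: A_def)
    then show False by (auto simp: A_def null_sets_def)
  qed
  then obtain s where s: "s \<in> A" "Q s = 0" "integrable lborel (\<lambda>x. norm (V s x) ^ 6)" by blast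
  have [measurable]: "V s \<in> borel_measurable borel" using VL by (rule L2_measurable)
  have "integrable lborel (\<lambda>x. norm (V s x) ^ 4)"
  proof (rule Bochner_Integration.integrable_bound)
    show "integrable lborel (\<lambda>x. (norm (V s x))\<^sup>2 + norm (V s x) ^ 6)"
      by (intro Bochner_Integration.integrable_add L2_integrable_sq VL s)
    have "norm (p ^ 4) \<le> norm (p\<^sup>2 + p ^ 6)" for p :: real
    proof -
      have "0 \<le> p\<^sup>2 * (1 - p\<^sup>2)\<^sup>2" "0 \<le> p ^ 4" by simp_all
      moreover have "p\<^sup>2 * (1 - p\<^sup>2)\<^sup>2 = p\<^sup>2 + p ^ 6 - 2 * p ^ 4" by (simp add: algebra_simps power2_eq_square eval_nat_numeral)
      ultimately have "p ^ 4 \<le> p\<^sup>2 + p ^ 6" by linarith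
      then show ?thesis by simp
    qed
    then show "AE x in lborel. norm (norm (V s x) ^ 4) \<le> norm ((norm (V s x))\<^sup>2 + norm (V s x) ^ 6)"
      by (intro AE_I2)
  qed measurable
  moreover have "(LINT x|lborel. norm (V s x) ^ 4) = 0" using s by (simp add: Q_def)
  ultimately have "AE x in lborel. norm (V s x) ^ 4 = 0"
    using integral_nonneg_eq_0_iff_AE[of lborel "\<lambda>x. norm (V s x) ^ 4"] by simp
  then have "AE x in lborel. V s x = 0" by eventually_elim simp
  then show ?thesis by blast
qed

lemma L2_inner_AE_0:
  assumes "f \<in> L2" "g \<in> L2" "AE x in lborel. f x = 0"
  shows "L2_inner f g = 0"
  using L2_inner_cong_AE[of f "\<lambda>x. 0 * f x" g] assms L2_scale[OF assms(1), of 0]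
  by (simp add: L2_inner_def)

lemma stationary_coef_decay:
  assumes f: "f \<in> L2" and eq: "AE x in lborel. of_real \<omega> * f x = T4 f x"
  shows "\<exists>A r. 0 < r \<and> r < 1 \<and> (\<forall>n. norm (coef f n) \<le> A * r ^ n)"
proof (rule propagator_joint[OF f])
  fix V :: "real \<Rightarrow> real \<Rightarrow> complex" and \<kappa> :: "nat \<Rightarrow> nat"
  assume \<kappa>: "strict_mono \<kappa>"
    and V: "(\<lambda>(s, x). V s x) \<in> borel_measurable (borel \<Otimes>\<^sub>M borel)"
    and VL: "\<And>s. V s \<in> L2" and VP: "\<And>s. AE x in lborel. propagator s f x = V s x"
    and Vlim: "\<And>s. AE x in lborel. (\<lambda>k. herm_sum (phase s (coef f)) (\<kappa> k) x) \<longlonglongrightarrow> V s x"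
    and Vt: "\<And>s N. (L2_norm (\<lambda>x. V s x - herm_sum (phase s (coef f)) N x))\<^sup>2 \<le> tail (coef f) N"
  show ?thesis
  proof (rule T4_char[OF f V VL VP Vlim])
    fix w d D
    assume w: "w \<in> L2" "(\<lambda>N. L2_norm (\<lambda>x. w x - herm_sum d N x)) \<longlonglongrightarrow> 0"
      and T4: "AE x in lborel. T4 f x = of_real (8 / pi) * w x"
      and V6: "AE s in lborel. s \<in> {- pi / 4..pi / 4} \<longrightarrow> integrable lborel (\<lambda>x. norm (V s x) ^ 6)"
      and VI: "integrable lborel (\<lambda>s. indicator {- pi / 4..pi / 4} s * (LINT x|lborel. norm (V s x) ^ 6))"
      and d: "\<And>n. d n = (LINT s|lborel. indicator {- pi / 4..pi / 4} s *\<^sub>R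
        (exp (- \<i> * of_real s * of_nat (2 * n + 1)) * coef (cube (V s)) n))"
      and inner: "\<And>g G. \<lbrakk>g \<in> L2; (\<lambda>(s, x). G s x) \<in> borel_measurable (borel \<Otimes>\<^sub>M borel); \<And>s. G s \<in> L2;
        \<And>s. AE x in lborel. propagator s g x = G s x\<rbrakk> \<Longrightarrow>
        integrable lborel (\<lambda>s. indicator {- pi / 4..pi / 4} s *\<^sub>R L2_inner (cube (V s)) (G s)) \<and>
        L2_inner w g = (LINT s|lborel. indicator {- pi / 4..pi / 4} s *\<^sub>R L2_inner (cube (V s)) (G s))"
    show ?thesis
    proof (cases "\<omega> = 0")
      case True
      have "AE x in lborel. w x = 0"
        using eq T4 by eventually_elim (simp add: True)
      from L2_inner_AE_0[OF w(1) f this]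
      have "(LINT s|lborel. indicator {- pi / 4..pi / 4} s *\<^sub>R L2_inner (cube (V s)) (V s)) = 0"
        unfolding conjunct2[OF inner[OF f V VL VP]] .
      then have "\<exists>s. AE x in lborel. V s x = 0"
        by (rule quartic_mass_zero[OF V VL V6 conjunct1[OF inner[OF f V VL VP]]])
      then obtain s where s: "AE x in lborel. V s x = 0" ..
      have "AE x in lborel. propagator s f x = 0"
        using VP[of s] s by eventually_elim simp
      then have "coef (propagator s f) n = 0" for n
        unfolding coef_def by (intro L2_inner_AE_0 propagator_L2(1) f hermite_fun_L2)
      then have "norm (coef f n) = 0" for n
        using norm_phase[of s "coef f" n] by (simp add: coef_propagator[OF f])
      then show ?thesis by (intro exI[of _ 0] exI[of _ "1 / 2"]) simp
    next
      case False
      define l where "l = complex_of_real (8 / (pi * \<omega>))"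
      have fw: "AE x in lborel. f x = l * w x"
        using eq T4
      proof eventually_elim
        case (elim x)
        then have "of_real \<omega> * f x = of_real (8 / pi) * w x" by simp
        then show ?case using False by (simp add: l_def field_simps)
      qed
      have fd: "coef f n = l * d n" for n
      proof -
        have "coef f n = L2_inner (\<lambda>x. l * w x) (hermite_fun n)"
          unfolding coef_def by (rule L2_inner_cong_AE[OF fw f L2_scale[OF w(1)] hermite_fun_L2])
        also have "\<dots> = l * coef w n" by (simp only: L2_inner_scale_left coef_def)
        finally show ?thesis by (simp only: coef_L2_limit[OF w])
      qed
      define tr where "tr = (\<lambda>M n. if n < M then coef f n else 0)"
      have lim: "(\<lambda>j. of_real (pi / 2) * cubic (\<kappa> j) (tr (\<kappa> j)) (tr (\<kappa> j)) (tr (\<kappa> j)) n) \<longlonglongrightarrow> d n" for n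
        unfolding tr_def d by (rule resonant_limit[OF f \<kappa> V VL VP Vt V6 VI])
      \<comment> \<open>The constant of the resonant system is 4 / \<omega>: the prefactor 8 / pi
        times the window length pi / 2, divided by \<omega>.\<close>
      have "(\<lambda>j. (l * of_real (pi / 2)) * cubic (\<kappa> j) (tr (\<kappa> j)) (tr (\<kappa> j)) (tr (\<kappa> j)) n) \<longlonglongrightarrow> coef f n" for n
        unfolding fd mult.assoc by (rule tendsto_mult_left[OF lim])
      then show ?thesis
        unfolding tr_def by (rule resonant_decay[OF Bessel[OF f] filterlim_subseq[OF \<kappa>]])
    qed
  qed
qed

theorem theorem4p13:
  fixes \<phi> :: "real \<Rightarrow> complex" and \<omega> :: real
  assumes "\<phi> \<in> L2"
    and "AE x in lborel. of_real \<omega> * \<phi> x = T4 \<phi> x"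
  shows "(\<exists>\<alpha>>0. \<exists>\<beta>>0.
            (\<lambda>x. \<phi> x * of_real (exp (\<alpha> * x\<^sup>2))) \<in> Linf \<and>
            (\<lambda>\<xi>. fourier_transform \<phi> \<xi> * of_real (exp (\<beta> * \<xi>\<^sup>2))) \<in> Linf) \<and>
         (\<exists>\<Phi> :: complex \<Rightarrow> complex. \<Phi> holomorphic_on UNIV \<and>
            (AE x in lborel. \<Phi> (of_real x) = \<phi> x))"
proof -
  obtain A r where "0 < r" "r < 1" "\<And>n. norm (coef \<phi> n) \<le> A * r ^ n"
    using stationary_coef_decay[OF assms] by blast
  then show ?thesis by (rule gaussian_decay_of_geometric_coef[OF assms(1)])
qed

end
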